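(* Let $P$ be a $d$-polytope that is Gale and braxial with respect to the vertex array $x_0<x_1<\cdots<x_n$, where $n\ge d+1\ge 7$ and $d$ is even. Then there is an integer $s$ with $1\le s\le n-d+1$ such that, for $0\le j\le n-1$, $[x_j,x_n]$ is an edge of $P$ if and only if $j=0$ or $s\le j\le n-1$. Furthermore: (i) if $s=1$, then $P$ is cyclic with $x_0<x_1<\cdots<x_n$; (ii) if $2\le s\le n-d$, then $P$ is periodically-cyclic with period $k=n-s+2$; (iii) if $s=n-d+1$, then $P$ is a $d$-braxtope with $x_0<x_1<\cdots<x_n$.
   Context: All polytopes are convex. $[y_1,\ldots,y_s]$ denotes the convex hull of $\{y_1,\ldots,y_s\}$. A vertex array of a polytope is a total ordering $x_0<x_1<\cdots<x_n$ of its full vertex set ($x_i<x_j$ iff $i<j$). The vertex array of a face (or of the convex hull of a subset of the vertices) is the induced ordering. Gale: if $X$ is a totally ordered finite set, $Y\subset X$ is a Gale subset if any two points of $X\setminus Y$ have an even number of points of $Y$ strictly between them. A $d$-polytope is Gale with respect to a vertex array if the vertex set of each of its facets is a Gale subset of the vertex set. A polytope is cyclic (with a given vertex array) if it is simplicial and Gale with respect to that vertex array. Periodically-cyclic: a $d$-polytope is periodically-cyclic with period $k$ if there is a vertex array $x_0<x_1<\cdots<x_n$ of it and $k$ is an integer with $d+2\le k\le n+1$ such that $[x_{i+1},x_{i+2},\ldots,x_{i+k}]$ is a cyclic $d$-polytope with the induced vertex array for $-1\le i\le n-k$, and $[x_{i+1},x_{i+2},\ldots,x_{i+k},x_{i+k+1}]$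 is not cyclic for $-1\le i\le n-k-1$. Braxtope: for $e\ge 3$, an $e$-polytope $Q$ with vertex array $y_0<y_1<\cdots<y_m$, $m\ge e$, is an $e$-braxtope (with respect to this array) if its set of facets is exactly $\{T_0,\ldots,T_{m-e+1},E_2,\ldots,E_m\}$, where $T_i=[y_i,y_{i+1},\ldots,y_{i+e-1}]$ for $0\le i\le m-e+1$ and $E_j=[y_0,y_{j-e+2},\ldots,y_{j-1},y_{j+1},\ldots,y_{j+e-2}]$ for $2\le j\le m$, with the convention $y_t=y_0$ for $t\le 0$ and $y_t=y_m$ for $t\ge m$. For $0\le e\le 2$ an $e$-braxtope is an $e$-simplex. A $d$-polytope is braxial with respect to a vertex array if each of its facets is a $(d-1)$-braxtope with respect to the induced ordering. *)

theory Defs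
  imports "HOL-Analysis.Analysis"
begin

text \<open>A polytope of dimension \<open>d\<close> may lie in a Euclidean space of larger dimension.\<close>

definition d_polytope :: "nat \<Rightarrow> 'a::euclidean_space set \<Rightarrow> bool" where
  "d_polytope d P \<longleftrightarrow> polytope P \<and> aff_dim P = int d"

definition vertices :: "'a::euclidean_space set \<Rightarrow> 'a set" where
  "vertices P = {v. v extreme_point_of P}"

text \<open>A total ordering \<open>x\<^sub>0 < \<dots> < x\<^sub>n\<close> of the vertices is the list of the vertices in
  increasing order, so \<open>x\<^sub>j\<close> is \<open>xs ! j\<close> and \<open>n + 1 = length xs\<close>.\<close>

definition vertex_array :: "'a::euclidean_space set \<Rightarrow> 'a list \<Rightarrow> bool" where
  "vertex_array P xs \<longleftrightarrow> distinct xs \<and> set xs = vertices P"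

definition induced_array :: "'a list \<Rightarrow> 'a::euclidean_space set \<Rightarrow> 'a list" where
  "induced_array xs F = filter (\<lambda>v. v \<in> vertices F) xs"

definition gale_subset :: "'a list \<Rightarrow> 'a set \<Rightarrow> bool" where
  "gale_subset xs Y \<longleftrightarrow> Y \<subseteq> set xs \<and>
     (\<forall>a b. a < b \<and> b < length xs \<and> xs ! a \<notin> Y \<and> xs ! b \<notin> Y
        \<longrightarrow> even (card {c. a < c \<and> c < b \<and> xs ! c \<in> Y}))"

definition gale_polytope :: "'a::euclidean_space set \<Rightarrow> 'a list \<Rightarrow> bool" where
  "gale_polytope P xs \<longleftrightarrow> polytope P \<and> vertex_array P xs \<and>
     (\<forall>F. F facet_of P \<longrightarrow> gale_subset xs (vertices F))"

definition simplicial_polytope :: "'a::euclidean_space set \<Rightarrow> bool" where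
  "simplicial_polytope P \<longleftrightarrow> polytope P \<and> (\<forall>F. F facet_of P \<longrightarrow> aff_dim F simplex F)"

definition cyclic_polytope :: "'a::euclidean_space set \<Rightarrow> 'a list \<Rightarrow> bool" where
  "cyclic_polytope P xs \<longleftrightarrow> simplicial_polytope P \<and> gale_polytope P xs"

text \<open>Here \<open>take l (drop i xs)\<close> is the block of \<open>l\<close> consecutive vertices starting with
  \<open>x\<^sub>i\<close>. Its convex hull carries the induced array, and both the positive and the negative
  cyclicity condition refer to that array.\<close>

definition periodically_cyclic_wrt ::
    "nat \<Rightarrow> nat \<Rightarrow> 'a::euclidean_space set \<Rightarrow> 'a list \<Rightarrow> bool" where
  "periodically_cyclic_wrt d k P xs \<longleftrightarrow>
     d_polytope d P \<and> vertex_array P xs \<and> d + 2 \<le> k \<and> k \<le> length xs \<and>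
     (\<forall>i. i + k \<le> length xs \<longrightarrow>
        d_polytope d (convex hull set (take k (drop i xs))) \<and>
        cyclic_polytope (convex hull set (take k (drop i xs))) (take k (drop i xs))) \<and>
     (\<forall>i. i + (k + 1) \<le> length xs \<longrightarrow>
        \<not> cyclic_polytope (convex hull set (take (k + 1) (drop i xs))) (take (k + 1) (drop i xs)))"

definition periodically_cyclic :: "nat \<Rightarrow> nat \<Rightarrow> 'a::euclidean_space set \<Rightarrow> bool" where
  "periodically_cyclic d k P \<longleftrightarrow> (\<exists>xs. periodically_cyclic_wrt d k P xs)"

text \<open>The vertex \<open>y\<^sub>t\<close> for arbitrary integers \<open>t\<close>: \<open>y\<^sub>t = y\<^sub>0\<close> for \<open>t \<le> 0\<close> and
  \<open>y\<^sub>t = y\<^sub>m\<close> for \<open>t \<ge> m\<close>, where \<open>m + 1\<close> is the length of the list.\<close>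

definition clipped_nth :: "'a list \<Rightarrow> int \<Rightarrow> 'a" where
  "clipped_nth ys t = ys ! nat (max 0 (min t (int (length ys) - 1)))"

definition braxtope_T :: "nat \<Rightarrow> 'a::euclidean_space list \<Rightarrow> nat \<Rightarrow> 'a set" where
  "braxtope_T e ys i = convex hull ((\<lambda>t. ys ! t) ` {i..i + e - 1})"

text \<open>Only the index \<open>t = j\<close> is left out: for \<open>j = m\<close> the vertex \<open>y\<^sub>m\<close> is still present
  as \<open>y\<^sub>m\<^sub>+\<^sub>1\<close>.\<close>

definition braxtope_E :: "nat \<Rightarrow> 'a::euclidean_space list \<Rightarrow> nat \<Rightarrow> 'a set" where
  "braxtope_E e ys j = convex hull
     (insert (ys ! 0) (clipped_nth ys ` ({int j - int e + 2..int j + int e - 2} - {int j})))"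

definition braxtope :: "nat \<Rightarrow> 'a::euclidean_space set \<Rightarrow> 'a list \<Rightarrow> bool" where
  "braxtope e Q ys \<longleftrightarrow> vertex_array Q ys \<and>
     (if e \<le> 2 then int e simplex Q
      else d_polytope e Q \<and>
        (\<exists>m. length ys = m + 1 \<and> e \<le> m \<and>
          {F. F facet_of Q} = braxtope_T e ys ` {0..m - e + 1} \<union> braxtope_E e ys ` {2..m}))"

definition braxial :: "nat \<Rightarrow> 'a::euclidean_space set \<Rightarrow> 'a list \<Rightarrow> bool" where
  "braxial d P xs \<longleftrightarrow> d_polytope d P \<and> vertex_array P xs \<and>
     (\<forall>F. F facet_of P \<longrightarrow> braxtope (d - 1) F (induced_array xs F))"

end

theory Submission
  imports Defs
begin

text \<open>
  A facet is recorded by the set of indices of its vertices. A braxtope that is not a simplex forces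
  the vertex \<open>x\<^sub>0\<close> into every nonsimplicial facet, so a facet without \<open>x\<^sub>0\<close> is a union of \<open>d/2\<close>
  disjoint pairs of neighbouring indices. Passing from such a facet to the neighbour across a ridge
  either shifts one pair or leads to a facet with \<open>x\<^sub>0\<close> in which the ridge is consecutive; crossing
  the next consecutive ridge of the latter translates the hull of the facet by one. Hence, for some
  number \<open>L\<close>, the facets without \<open>x\<^sub>0\<close> are exactly the paired \<open>d\<close>-sets that fit into \<open>L\<close> consecutive
  indices, and \<open>s = n - L + 1\<close>.

  Every paired \<open>d\<close>-set in a window of \<open>L + 1\<close> consecutive indices is then the trace of a facet on that
  window. In even dimension this determines the window: the negative part of an affine dependency
  cannot be covered by \<open>d/2\<close> pairs, so every circuit alternates in sign and the window is cyclic.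
  A window of \<open>L + 2\<close> indices meets some facet in more than \<open>d\<close> vertices.
\<close>

section \<open>Positions in finite sets of numbers\<close>

text \<open>Two features of the ridges of a braxial facet carry the combinatorics. A ridge without
  the least vertex of its facet is consecutive in it, so a facet reached from one without 0 either
  misses 0 too or has no new vertex inside the hull of the ridge. A ridge with at least
  \<open>d\<close> vertices has exactly one inner gap, apart from a jump after the first vertex, and
  this gap is never at position 2, where at most \<open>d - 1\<close> vertices would remain.
  Omitting position 3 leaves exactly \<open>d\<close>, because 3 is within the reach
  \<open>d - 3\<close>; here \<open>d >= 6\<close> enters. Most contradictions cross such a ridge
  and find that parity forces a second extra vertex, or puts the extra one at position 2; others
  exhibit a facet properly inside another.

  The hull of a window may have facets that do not come from facets of the polytope. Hence its
  cyclicity is not read off from the traces: these only supply supporting hyperplanes for the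
  expected facets, and the remaining facets are controlled by the sign pattern of affine
  dependencies.\<close>

definition pos :: "nat set \<Rightarrow> nat \<Rightarrow> nat" where
  "pos Z y = card (Z \<inter> {..<y})"

lemma pos_0 [simp]: "pos Z 0 = 0"
  by (simp add: pos_def)

lemma pos_Suc: "pos Z (Suc y) = pos Z y + (if y \<in> Z then 1 else 0)"
proof -
  have "Z \<inter> {..<Suc y} = (if y \<in> Z then insert y (Z \<inter> {..<y}) else Z \<inter> {..<y})"
    by (auto simp: less_Suc_eq)
  then show ?thesis by (simp add: pos_def)
qed

lemma pos_add: "pos Z (y + k) = pos Z y + card (Z \<inter> {y..<y + k})"
proof (induction k)
  case (Suc k)
  have "Z \<inter> {y..<y + Suc k} = (if y + k \<in> Z then insert (y + k) (Z \<inter> {y..<y + k}) else Z \<inter> {y..<y + k})"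
    by (auto simp: less_Suc_eq)
  then show ?case using Suc pos_Suc[of Z "y + k"] by simp
qed simp

lemma pos_split: "y \<le> y' \<Longrightarrow> pos Z y' = pos Z y + card (Z \<inter> {y..<y'})"
  using pos_add[of Z y "y' - y"] by simp

lemma pos_mono: "y \<le> y' \<Longrightarrow> pos Z y \<le> pos Z y'"
  by (simp add: pos_split)

lemma pos_less: "y \<in> Z \<Longrightarrow> y < y' \<Longrightarrow> pos Z y < pos Z y'"
  using pos_mono[of "Suc y" y' Z] by (simp add: pos_Suc)

lemma pos_less_iff: "y \<in> Z \<Longrightarrow> y' \<in> Z \<Longrightarrow> pos Z y < pos Z y' \<longleftrightarrow> y < y'"
  by (metis linorder_less_linear order_less_asym pos_less)

lemma pos_le_iff: "y \<in> Z \<Longrightarrow> y' \<in> Z \<Longrightarrow> pos Z y \<le> pos Z y' \<longleftrightarrow> y \<le> y'"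
  by (meson linorder_not_less pos_less_iff)

lemma pos_less_card: "finite Z \<Longrightarrow> y \<in> Z \<Longrightarrow> pos Z y < card Z"
  unfolding pos_def by (rule psubset_card_mono) auto

lemma pos_le_card: "finite Z \<Longrightarrow> pos Z y \<le> card Z"
  unfolding pos_def by (rule card_mono) auto

lemma pos_all: "Z \<subseteq> {..<y} \<Longrightarrow> pos Z y = card Z"
  by (simp add: pos_def inf.absorb1)

lemma pos_none: "Z \<inter> {..<y} = {} \<Longrightarrow> pos Z y = 0"
  by (simp add: pos_def)

lemma inj_pos: "inj_on (pos Z) Z"
  by (rule inj_onI) (metis linorder_neqE_nat order_less_irrefl pos_less)

lemma bij_pos: "finite Z \<Longrightarrow> bij_betw (pos Z) Z {..<card Z}"
proof -
  assume f: "finite Z"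
  have "pos Z ` Z \<subseteq> {..<card Z}" using pos_less_card[OF f] by auto
  moreover have "card (pos Z ` Z) = card {..<card Z}" by (simp add: card_image inj_pos)
  ultimately have "pos Z ` Z = {..<card Z}" by (simp add: card_subset_eq)
  then show ?thesis by (simp add: bij_betw_def inj_pos)
qed

lemma card_pos_between:
  assumes "finite Z" "b \<le> card Z"
  shows "card {y \<in> Z. a \<le> pos Z y \<and> pos Z y < b} = b - a"
proof -
  have im: "pos Z ` Z = {..<card Z}" using bij_pos[OF assms(1)] by (simp add: bij_betw_def)
  let ?A = "{y \<in> Z. a \<le> pos Z y \<and> pos Z y < b}"
  have "pos Z ` ?A = {a..<b}"
  proof
    show "{a..<b} \<subseteq> pos Z ` ?A"
    proof
      fix i assume i: "i \<in> {a..<b}"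
      then have "i \<in> pos Z ` Z" using im assms(2) by simp
      then obtain y where "y \<in> Z" "i = pos Z y" by (rule imageE)
      then show "i \<in> pos Z ` ?A" using i by simp
    qed
  qed auto
  moreover have "inj_on (pos Z) ?A" by (rule inj_on_subset[OF inj_pos]) auto
  ultimately show ?thesis by (metis card_image card_atLeastLessThan)
qed

lemma pos_surj:
  assumes "finite Z" "i < card Z" obtains y where "y \<in> Z" "pos Z y = i"
  using bij_pos[OF assms(1)] assms(2) unfolding bij_betw_def by (metis imageE lessThan_iff)

lemma pos_insert: "finite X \<Longrightarrow> b \<notin> X \<Longrightarrow> pos (insert b X) y = pos X y + (if b < y then 1 else 0)"
  by (auto simp: pos_def Int_insert_left)

lemma pos_remove: "finite X \<Longrightarrow> a \<in> X \<Longrightarrow> pos X y = pos (X - {a}) y + (if a < y then 1 else 0)"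
  using pos_insert[of "X - {a}" a y] by (simp add: insert_absorb)

lemma pos_Un: "finite X \<Longrightarrow> finite Y \<Longrightarrow> X \<inter> Y = {} \<Longrightarrow> pos (X \<union> Y) y = pos X y + pos Y y"
  unfolding pos_def Int_Un_distrib2 by (rule card_Un_disjoint) auto

lemma pos_interval: "pos {a..b} y = min y (Suc b) - a"
proof -
  have "{a..b} \<inter> {..<y} = {a..<min y (Suc b)}" by auto
  then show ?thesis by (simp add: pos_def)
qed

lemma pos_interval_less: "pos {a..<b} y = min y b - a"
proof -
  have "{a..<b} \<inter> {..<y} = {a..<min y b}" by auto
  then show ?thesis by (simp add: pos_def)
qed

text \<open>These are the disjoint unions of pairs \<open>{y, Suc y}\<close>. Non-members above the
  whole set are included, so the cardinality is even as well.\<close>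

definition paired :: "nat set \<Rightarrow> bool" where
  "paired B \<longleftrightarrow> finite B \<and> (\<forall>y. y \<notin> B \<longrightarrow> even (pos B y))"

lemma paired_finite: "paired B \<Longrightarrow> finite B"
  by (simp add: paired_def)

lemma paired_even: "paired B \<Longrightarrow> y \<notin> B \<Longrightarrow> even (pos B y)"
  by (simp add: paired_def)

lemma paired_Suc: "paired B \<Longrightarrow> y \<in> B \<Longrightarrow> even (pos B y) \<Longrightarrow> Suc y \<in> B"
  using paired_even[of B "Suc y"] by (auto simp: pos_Suc)

lemma paired_pred:
  assumes "paired B" "Suc y \<in> B" "odd (pos B (Suc y))" shows "y \<in> B"
  using assms paired_even[of B y] by (auto simp: pos_Suc split: if_splits)

lemma paired_Min:
  assumes "paired B" "B \<noteq> {}" shows "Min B \<in> B" "Suc (Min B) \<in> B"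
proof -
  have f: "finite B" using assms paired_finite by auto
  then show m: "Min B \<in> B" using assms by simp
  have "pos B (Min B) = 0" using f by (intro pos_none) (auto simp: Min_le leD)
  then show "Suc (Min B) \<in> B" using paired_Suc[OF assms(1) m] by simp
qed

lemma paired_Max:
  assumes "paired B" "B \<noteq> {}" shows "Max B \<in> B" "0 < Max B" "Max B - 1 \<in> B"
proof -
  have f: "finite B" using assms paired_finite by auto
  then show m: "Max B \<in> B" using assms by simp
  have "Suc (Min B) \<le> Max B" using paired_Min[OF assms] f by simp
  then show g: "0 < Max B" by simp
  have "Suc (Max B) \<notin> B" using f by (metis Max_ge Suc_n_not_le_n)
  then have "even (pos B (Suc (Max B)))" by (rule paired_even[OF assms(1)])
  then have "odd (pos B (Max B))" using m by (simp add: pos_Suc)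
  then show "Max B - 1 \<in> B" using paired_pred[OF assms(1), of "Max B - 1"] m g by simp
qed

lemma paired_shift:
  assumes "paired B" shows "paired ((+) i ` B)"
  unfolding paired_def
proof (intro conjI allI impI)
  show "finite ((+) i ` B)" using paired_finite[OF assms] by simp
  fix y assume y: "y \<notin> (+) i ` B"
  show "even (pos ((+) i ` B) y)"
  proof (cases "i \<le> y")
    case True
    have "y - i \<notin> B" using y True by (metis imageI le_add_diff_inverse)
    have "(+) i ` B \<inter> {..<y} = (+) i ` (B \<inter> {..<y - i})" using True by auto
    then have "pos ((+) i ` B) y = pos B (y - i)" by (simp add: pos_def card_image)
    then show ?thesis using paired_even[OF assms \<open>y - i \<notin> B\<close>] by simp
  next
    case False
    then have "(+) i ` B \<inter> {..<y} = {}" by auto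
    then show ?thesis by (simp add: pos_none)
  qed
qed

section \<open>Index patterns of the facets of a braxtope\<close>

definition ridge_T :: "nat \<Rightarrow> nat set \<Rightarrow> nat \<Rightarrow> nat set" where
  "ridge_T e Z i = {y \<in> Z. i \<le> pos Z y \<and> pos Z y < i + e}"

text \<open>The pattern of \<open>E_m\<close>: clipping turns the index \<open>m + 1\<close> into
  \<open>m\<close>, so the omitted vertex returns and the last \<open>e - 1\<close> positions
  survive next to position 0.\<close>

definition ridge_L :: "nat \<Rightarrow> nat set \<Rightarrow> nat set" where
  "ridge_L e Z = {y \<in> Z. pos Z y = 0 \<or> card Z \<le> pos Z y + (e - 1)}"

text \<open>The pattern of \<open>E_j\<close> for \<open>j < m\<close>, with \<open>x\<close> the
  omitted vertex at position \<open>j\<close>. Clipping adds nothing: position 0 is present anyway,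
  and the last position is within distance \<open>e - 2\<close> whenever clipping reaches
  it.\<close>

definition ridge_E :: "nat \<Rightarrow> nat set \<Rightarrow> nat \<Rightarrow> nat set" where
  "ridge_E e Z x = {y \<in> Z. y \<noteq> x \<and>
     (pos Z y = 0 \<or> pos Z y \<le> pos Z x + (e - 2) \<and> pos Z x \<le> pos Z y + (e - 2))}"

definition ridge :: "nat \<Rightarrow> nat set \<Rightarrow> nat set \<Rightarrow> bool" where
  "ridge e Z R \<longleftrightarrow> (\<exists>i. i + e \<le> card Z \<and> R = ridge_T e Z i) \<or> R = ridge_L e Z \<or>
     (\<exists>x \<in> Z. 2 \<le> pos Z x \<and> pos Z x + 1 < card Z \<and> R = ridge_E e Z x)"

lemma ridge_TI: "i + e \<le> card Z \<Longrightarrow> ridge e Z (ridge_T e Z i)"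
  unfolding ridge_def by (rule disjI1, rule exI[of _ i]) simp

lemma ridge_LI: "ridge e Z (ridge_L e Z)"
  unfolding ridge_def by (rule disjI2, rule disjI1) (rule refl)

lemma ridge_EI: "x \<in> Z \<Longrightarrow> 2 \<le> pos Z x \<Longrightarrow> pos Z x + 1 < card Z \<Longrightarrow> ridge e Z (ridge_E e Z x)"
  unfolding ridge_def by (rule disjI2, rule disjI2, rule bexI[of _ x]) simp_all

lemma ridge_cases:
  assumes "ridge e Z R"
  obtains (T) i where "i + e \<le> card Z" "R = ridge_T e Z i" | (L) "R = ridge_L e Z" |
    (E) x where "x \<in> Z" "2 \<le> pos Z x" "pos Z x + 1 < card Z" "R = ridge_E e Z x"
  using assms unfolding ridge_def by blast

lemma ridge_subset: "ridge e Z R \<Longrightarrow> R \<subseteq> Z"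
  by (auto simp: ridge_def ridge_T_def ridge_L_def ridge_E_def)

text \<open>Lets a consecutive ridge be given by an interval of indices, which is how facets with 0
  are crossed when hulls are translated.\<close>

lemma ridge_T_interval:
  assumes f: "finite Z" and R: "R = Z \<inter> {a..b}" and c: "card R = e" and e: "0 < e"
  shows "ridge e Z R"
proof -
  have ab: "a \<le> b" using R c e by (cases "a \<le> b") auto
  have pb: "pos Z (Suc b) = pos Z a + e"
    using pos_split[of a "Suc b" Z] ab R c by (simp add: atLeastLessThanSuc_atLeastAtMost)
  have "R = ridge_T e Z (pos Z a)"
  proof (rule set_eqI)
    fix y
    have "y \<in> Z \<Longrightarrow> pos Z a \<le> pos Z y \<longleftrightarrow> a \<le> y"
      by (meson linorder_not_less pos_less pos_mono)
    moreover have "y \<in> Z \<Longrightarrow> pos Z y < pos Z (Suc b) \<longleftrightarrow> y \<le> b"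
      by (meson less_Suc_eq_le linorder_not_less pos_less pos_mono)
    ultimately show "y \<in> R \<longleftrightarrow> y \<in> ridge_T e Z (pos Z a)"
      using R pb by (auto simp: ridge_T_def)
  qed
  moreover have "pos Z a + e \<le> card Z" using pb pos_le_card[OF f, of "Suc b"] by simp
  ultimately show ?thesis unfolding ridge_def by blast
qed

text \<open>\<open>ridge_L\<close> and \<open>ridge_E\<close> always contain position 0, so only the
  consecutive pattern can avoid the least vertex.\<close>

lemma ridge_min_mem:
  assumes "ridge e Z R" "z \<in> Z" "pos Z z = 0" "z \<notin> R"
    and "v \<in> R" "w \<in> R" "v \<le> y" "y \<le> w" "y \<in> Z"
  shows "y \<in> R"
proof -
  have "\<exists>i. R = ridge_T e Z i"
    using assms(1-4) by (auto simp: ridge_def ridge_L_def ridge_E_def)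
  then show ?thesis using assms(5-) pos_mono[OF assms(7), of Z] pos_mono[OF assms(8), of Z]
    by (auto simp: ridge_T_def)
qed

text \<open>A gap directly after position 0 may occur in \<open>ridge_L\<close> and
  \<open>ridge_E\<close>; a gap above a vertex of positive position can only be the omitted vertex
  of \<open>ridge_E\<close>.\<close>

lemma ridge_gap:
  assumes "ridge e Z R" "v \<in> R" "w \<in> R" "0 < pos Z v" "v < y" "y < w" "y \<in> Z" "y \<notin> R"
  shows "R = ridge_E e Z y \<and> 2 \<le> pos Z y \<and> pos Z y + 1 < card Z"
proof -
  have vZ: "v \<in> Z" and wZ: "w \<in> Z" using assms(1-3) ridge_subset by blast+
  have p: "pos Z v < pos Z y" "pos Z y < pos Z w"
    using pos_less[OF vZ assms(5)] pos_less[OF assms(7,6)] by auto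
  consider i where "R = ridge_T e Z i" | "R = ridge_L e Z" |
    x where "x \<in> Z" "2 \<le> pos Z x" "pos Z x + 1 < card Z" "R = ridge_E e Z x"
    using assms(1) by (auto simp: ridge_def)
  then show ?thesis
  proof cases
    case 1 then show ?thesis using assms(2,3,7,8) p by (auto simp: ridge_T_def)
  next
    case 2 then show ?thesis using assms(2-4,7,8) p by (auto simp: ridge_L_def)
  next
    case 3
    then have "y = x" using assms(2-4,7,8) p by (auto simp: ridge_E_def)
    then show ?thesis using 3 by auto
  qed
qed

lemma ridge_gap_unique:
  assumes "ridge e Z R" "v \<in> R" "w \<in> R" "0 < pos Z v"
    and "v < y" "y < w" "y \<in> Z" "y \<notin> R" and "v < y'" "y' < w" "y' \<in> Z" "y' \<notin> R"
  shows "y = y'"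
proof (rule ccontr)
  assume "y \<noteq> y'"
  have y: "R = ridge_E e Z y" using ridge_gap[OF assms(1-8)] by simp
  have vZ: "v \<in> Z" and wZ: "w \<in> Z" using assms(1-3) ridge_subset by blast+
  have p: "pos Z v < pos Z y'" "pos Z y' < pos Z w"
    using pos_less[OF vZ assms(9)] pos_less[OF assms(11,10)] by auto
  show False using \<open>y \<noteq> y'\<close> y assms(2-4,11,12) p by (auto simp: ridge_E_def)
qed

text \<open>The start of the order cuts off the left run, so only positions 0, 1 and 3 to
  \<open>e\<close> remain. This is the obstruction that excludes position 2 for nonsimplicial
  ridges.\<close>

lemma ridge_E_card_2:
  assumes x: "x \<in> Z" and p: "pos Z x = 2" and e: "2 \<le> e" shows "card (ridge_E e Z x) \<le> e"
proof -
  have "pos Z y \<in> {0, 1} \<union> {3..e}" if y: "y \<in> ridge_E e Z x" for y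
  proof -
    have "pos Z y \<noteq> 2" using y p inj_onD[OF inj_pos, of Z y x] x by (auto simp: ridge_E_def)
    then show ?thesis using y p e by (auto simp: ridge_E_def)
  qed
  then have "pos Z ` ridge_E e Z x \<subseteq> {0, 1} \<union> {3..e}" by (rule image_subsetI)
  then have "card (pos Z ` ridge_E e Z x) \<le> card ({0, 1} \<union> {3..e})"
    by (intro card_mono) auto
  also have "\<dots> \<le> e" using e by (subst card_Un_disjoint) auto
  finally show ?thesis
    by (metis (no_types, lifting) card_image inj_on_subset inj_pos mem_Collect_eq ridge_E_def subsetI)
qed

text \<open>Such a vertex is beyond the reach of the pattern, so the complete left run of
  \<open>e - 2\<close> vertices separates it from \<open>x\<close>.\<close>

lemma ridge_E_low:
  assumes f: "finite Z" and x: "x \<in> Z" and y: "y \<in> Z" "y \<notin> ridge_E e Z x" "y < x" "0 < pos Z y"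
  shows "e - 2 \<le> card (ridge_E e Z x \<inter> {y<..<x})"
proof -
  have l: "pos Z y + (e - 2) < pos Z x"
    using y x pos_less[of y Z x] by (auto simp: ridge_E_def)
  let ?A = "{z \<in> Z. pos Z x - (e - 2) \<le> pos Z z \<and> pos Z z < pos Z x}"
  have "card ?A = pos Z x - (pos Z x - (e - 2))"
    using pos_less_card[OF f x] by (intro card_pos_between[OF f]) simp
  also have "\<dots> = e - 2" using l by simp
  finally have "card ?A = e - 2" .
  moreover have "?A \<subseteq> ridge_E e Z x \<inter> {y<..<x}"
  proof
    fix z assume z: "z \<in> ?A"
    then have "pos Z y < pos Z z" using l by auto
    then have "y < z" using z y pos_less_iff[of y Z z] by auto
    moreover have "z < x" using z x pos_less_iff[of z Z x] by auto
    ultimately show "z \<in> ridge_E e Z x \<inter> {y<..<x}" using z by (auto simp: ridge_E_def)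
  qed
  ultimately show ?thesis using card_mono[of "ridge_E e Z x \<inter> {y<..<x}" ?A] by simp
qed

lemma ridge_E_high:
  assumes f: "finite Z" and x: "x \<in> Z" and y: "y \<in> Z" "y \<notin> ridge_E e Z x" "x < y"
  shows "e - 2 \<le> card (ridge_E e Z x \<inter> {x<..<y})"
proof -
  have l: "pos Z x + (e - 2) < pos Z y"
    using y x pos_less[of x Z y] by (auto simp: ridge_E_def)
  let ?A = "{z \<in> Z. pos Z x + 1 \<le> pos Z z \<and> pos Z z < pos Z x + (e - 2) + 1}"
  have "card ?A = pos Z x + (e - 2) + 1 - (pos Z x + 1)"
    using l pos_less_card[OF f y(1)] by (intro card_pos_between[OF f]) simp
  then have "card ?A = e - 2" by simp
  moreover have "?A \<subseteq> ridge_E e Z x \<inter> {x<..<y}"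
  proof
    fix z assume z: "z \<in> ?A"
    then have "pos Z z < pos Z y" using l by auto
    then have "z < y" using z y pos_less_iff[of z Z y] by auto
    moreover have "x < z" using z x pos_less_iff[of x Z z] by auto
    ultimately show "z \<in> ridge_E e Z x \<inter> {x<..<y}" using z by (auto simp: ridge_E_def)
  qed
  ultimately show ?thesis using card_mono[of "ridge_E e Z x \<inter> {x<..<y}" ?A] by simp
qed

lemma ridge_E_left_card:
  assumes f: "finite Z" and x: "x \<in> Z"
  shows "card {y \<in> ridge_E e Z x. y < x \<and> 0 < pos Z y} \<le> e - 2"
proof -
  let ?A = "{z \<in> Z. pos Z x - (e - 2) \<le> pos Z z \<and> pos Z z < pos Z x}"
  have "{y \<in> ridge_E e Z x. y < x \<and> 0 < pos Z y} \<subseteq> ?A"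
    using pos_less[of _ Z x] by (auto simp: ridge_E_def)
  then have "card {y \<in> ridge_E e Z x. y < x \<and> 0 < pos Z y} \<le> card ?A"
    using f by (intro card_mono) auto
  also have "\<dots> = pos Z x - (pos Z x - (e - 2))"
    using pos_less_card[OF f x] by (intro card_pos_between[OF f]) simp
  finally show ?thesis by simp
qed

text \<open>Deleting position 0, position 1 or the last one gives \<open>ridge_T\<close> at 1,
  \<open>ridge_L\<close> and \<open>ridge_T\<close> at 0; every other deletion is a
  \<open>ridge_E\<close>. So any vertex of a simplex facet can be exchanged.\<close>

lemma ridge_remove:
  assumes f: "finite B" and c: "card B = Suc e" and b: "b \<in> B" and e: "3 \<le> e"
  shows "ridge e B (B - {b})"
proof -
  have pb: "pos B b \<le> e" using pos_less_card[OF f b] c by simp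
  have all: "y \<in> B \<Longrightarrow> pos B y \<le> e" for y using pos_less_card[OF f, of y] c by simp
  have inj: "y \<in> B \<Longrightarrow> pos B y = pos B b \<longleftrightarrow> y = b" for y
    using b by (metis inj_onD inj_pos)
  consider "pos B b = 0" | "pos B b = 1" | "2 \<le> pos B b" "pos B b < e" | "pos B b = e"
    using pb by linarith
  then show ?thesis
  proof cases
    case 1
    have "B - {b} = ridge_T e B 1"
    proof (rule set_eqI)
      fix y show "y \<in> B - {b} \<longleftrightarrow> y \<in> ridge_T e B 1"
        using all[of y] inj[of y] 1 by (auto simp: ridge_T_def)
    qed
    then show ?thesis using c by (auto simp: ridge_def intro!: exI[of _ 1])
  next
    case 2
    have "B - {b} = ridge_L e B" 
    proof (rule set_eqI)
      fix y show "y \<in> B - {b} \<longleftrightarrow> y \<in> ridge_L e B"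
        using inj[of y] 2 c e by (auto simp: ridge_L_def)
    qed
    then show ?thesis by (auto simp: ridge_def)
  next
    case 3
    have "B - {b} = ridge_E e B b"
    proof (rule set_eqI)
      fix y show "y \<in> B - {b} \<longleftrightarrow> y \<in> ridge_E e B b"
        using all[of y] 3 e by (auto simp: ridge_E_def)
    qed
    then show ?thesis using 3 c b by (auto simp: ridge_def)
  next
    case 4
    have "B - {b} = ridge_T e B 0"
    proof (rule set_eqI)
      fix y show "y \<in> B - {b} \<longleftrightarrow> y \<in> ridge_T e B 0"
        using all[of y] inj[of y] 4 by (auto simp: ridge_T_def)
    qed
    then show ?thesis using c by (auto simp: ridge_def intro!: exI[of _ 0])
  qed
qed

section \<open>Facets of a Gale and braxial polytope as sets of indices\<close>

lemma paired_shift_right: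
  assumes p: "paired X" and a: "a \<in> X" "Suc a \<in> X" "Suc (Suc a) \<notin> X"
  shows "paired (insert (Suc (Suc a)) (X - {a}))" "card (insert (Suc (Suc a)) (X - {a})) = card X"
proof -
  have f: "finite X" by (rule paired_finite[OF p])
  show "card (insert (Suc (Suc a)) (X - {a})) = card X"
    using f a by (simp add: card_Diff_singleton card_gt_0_iff) (metis Suc_pred card_gt_0_iff empty_iff)
  have pa: "even (pos X a)" using paired_even[OF p a(3)] a by (simp add: pos_Suc)
  have e: "pos (insert (Suc (Suc a)) (X - {a})) y + (if a < y then 1 else 0)
      = pos X y + (if Suc (Suc a) < y then 1 else 0)" for y
    using f a pos_insert[of "X - {a}" "Suc (Suc a)" y] pos_remove[of X a y] by simp
  show "paired (insert (Suc (Suc a)) (X - {a}))"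
    unfolding paired_def
  proof (intro conjI allI impI)
    fix y assume y: "y \<notin> insert (Suc (Suc a)) (X - {a})"
    show "even (pos (insert (Suc (Suc a)) (X - {a})) y)"
    proof (cases "y = a")
      case True then show ?thesis using e[of a] pa by simp
    next
      case False
      then have "y \<notin> X" "y \<noteq> Suc a" using y a by auto
      then show ?thesis using e[of y] y False paired_even[OF p] by (cases "a < y") auto
    qed
  qed (use f in simp)
qed

lemma paired_shift_left:
  assumes p: "paired X" and a: "a \<notin> X" "Suc a \<in> X" "Suc (Suc a) \<in> X"
  shows "paired (insert a (X - {Suc (Suc a)}))" "card (insert a (X - {Suc (Suc a)})) = card X"
proof -
  have f: "finite X" by (rule paired_finite[OF p])
  show "card (insert a (X - {Suc (Suc a)})) = card X"
    using f a by (simp add: card_Diff_singleton card_gt_0_iff) (metis Suc_pred card_gt_0_iff empty_iff)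
  have pa: "even (pos X a)" using paired_even[OF p a(1)] .
  have e: "pos (insert a (X - {Suc (Suc a)})) y + (if Suc (Suc a) < y then 1 else 0)
      = pos X y + (if a < y then 1 else 0)" for y
    using f a pos_insert[of "X - {Suc (Suc a)}" a y] pos_remove[of X "Suc (Suc a)" y] by simp
  show "paired (insert a (X - {Suc (Suc a)}))"
    unfolding paired_def
  proof (intro conjI allI impI)
    fix y assume y: "y \<notin> insert a (X - {Suc (Suc a)})"
    show "even (pos (insert a (X - {Suc (Suc a)})) y)"
    proof (cases "y = Suc (Suc a)")
      case True then show ?thesis using e[of y] pa a by (simp add: pos_Suc)
    next
      case False
      then have "y \<notin> X" "y \<noteq> Suc a" "y \<noteq> a" using y a by auto
      then show ?thesis using e[of y] False paired_even[OF p] by (cases "a < y") auto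
    qed
  qed (use f in simp)
qed

text \<open>What is kept of the polytope: \<open>FF\<close> holds the vertex index sets of its
  facets. Gale evenness is stated through counts below a gap, \<open>nbr\<close> is the crossing of
  a ridge, and \<open>miss_zero\<close> provides a starting facet for the construction of
  \<open>L\<close>.\<close>

locale braxial_family =
  fixes n d :: nat and FF :: "nat set set"
  assumes even_d: "even d" and d6: "6 \<le> d" and dn: "d < n"
    and facet_sub: "F \<in> FF \<Longrightarrow> F \<subseteq> {..n}"
    and facet_card: "F \<in> FF \<Longrightarrow> d \<le> card F"
    and gale: "F \<in> FF \<Longrightarrow> a \<le> n \<Longrightarrow> b \<le> n \<Longrightarrow> a \<notin> F \<Longrightarrow> b \<notin> F \<Longrightarrow> even (pos F a) = even (pos F b)"
    and nbr: "F \<in> FF \<Longrightarrow> ridge (d - 1) F R \<Longrightarrow> \<exists>G\<in>FF. G \<inter> F = R \<and> ridge (d - 1) G R"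
    and antichain: "F \<in> FF \<Longrightarrow> G \<in> FF \<Longrightarrow> F \<subseteq> G \<Longrightarrow> F = G"
    and miss_zero: "\<exists>F\<in>FF. 0 \<notin> F"
begin

lemma facet_finite: "F \<in> FF \<Longrightarrow> finite F"
  using facet_sub finite_subset by blast

lemma facet_le: "F \<in> FF \<Longrightarrow> y \<in> F \<Longrightarrow> y \<le> n"
  using facet_sub by blast

lemma gale_zero: "F \<in> FF \<Longrightarrow> 0 \<notin> F \<Longrightarrow> b \<le> n \<Longrightarrow> b \<notin> F \<Longrightarrow> even (pos F b)"
  using gale[of F 0 b] by simp

lemma gale_adj: "F \<in> FF \<Longrightarrow> a \<notin> F \<Longrightarrow> Suc a \<in> F \<Longrightarrow> Suc (Suc a) \<le> n \<Longrightarrow> Suc (Suc a) \<in> F"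
  using gale[of F a "Suc (Suc a)"] by (auto simp: pos_Suc)

lemma gale_adj': "F \<in> FF \<Longrightarrow> Suc (Suc a) \<notin> F \<Longrightarrow> Suc a \<in> F \<Longrightarrow> Suc (Suc a) \<le> n \<Longrightarrow> a \<in> F"
  using gale_adj by blast

text \<open>The patterns \<open>ridge_T\<close> and \<open>ridge_L\<close> have at most
  \<open>d - 1\<close> vertices, so a larger ridge has an omitted inner vertex.\<close>

lemma ridge_big:
  assumes G: "G \<in> FF" and R: "ridge (d - 1) G W" "d \<le> card W"
  shows "\<exists>x\<in>G. 2 \<le> pos G x \<and> pos G x + 1 < card G \<and> W = ridge_E (d - 1) G x"
proof -
  note f = facet_finite[OF G]
  have "W \<noteq> ridge_T (d - 1) G i" if i: "i + (d - 1) \<le> card G" for i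
    using card_pos_between[OF f i, of i] R(2) d6 by (auto simp: ridge_T_def)
  moreover have "W \<noteq> ridge_L (d - 1) G"
  proof
    assume W: "W = ridge_L (d - 1) G"
    have "W \<subseteq> {y \<in> G. 0 \<le> pos G y \<and> pos G y < 1}
        \<union> {y \<in> G. card G - (d - 2) \<le> pos G y \<and> pos G y < card G}"
      using pos_less_card[OF f] by (auto simp: W ridge_L_def)
    then have "card W \<le> card ({y \<in> G. 0 \<le> pos G y \<and> pos G y < 1}
        \<union> {y \<in> G. card G - (d - 2) \<le> pos G y \<and> pos G y < card G})"
      using f by (intro card_mono) auto
    also have "\<dots> \<le> card {y \<in> G. 0 \<le> pos G y \<and> pos G y < 1}
        + card {y \<in> G. card G - (d - 2) \<le> pos G y \<and> pos G y < card G}"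
      by (rule card_Un_le)
    also have "\<dots> = 1 + (card G - (card G - (d - 2)))"
      using card_pos_between[OF f, of 1 0] card_pos_between[OF f order_refl, of "card G - (d - 2)"]
        facet_card[OF G] d6 by simp
    finally show False using R(2) facet_card[OF G] d6 by simp
  qed
  ultimately show ?thesis using R(1) unfolding ridge_def by blast
qed

lemma ridge_not_2:
  assumes G: "G \<in> FF" and x: "x \<in> G" and W: "W = ridge_E (d - 1) G x" "d \<le> card W"
  shows "pos G x \<noteq> 2"
proof
  assume "pos G x = 2"
  then have "card W \<le> d - 1" using ridge_E_card_2[OF x, of "d - 1"] W(1) d6 by simp
  then show False using W(2) d6 by simp
qed

lemma ridge_3:
  assumes F: "F \<in> FF" and c: "d + 1 \<le> card F"
  obtains x W G where "x \<in> F" "pos F x = 3" "W = {y \<in> F. pos F y \<le> d} - {x}" "card W = d"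
    "G \<in> FF" "G \<inter> F = W" "ridge (d - 1) G W"
proof -
  note f = facet_finite[OF F]
  obtain x where x: "x \<in> F" "pos F x = 3" using pos_surj[OF f, of 3] c d6 by auto
  define W where "W = {y \<in> F. pos F y \<le> d} - {x}"
  have "card {y \<in> F. 0 \<le> pos F y \<and> pos F y < d + 1} = d + 1"
    using card_pos_between[OF f c, of 0] by simp
  then have "card {y \<in> F. pos F y \<le> d} = d + 1" by (simp add: less_Suc_eq_le)
  then have cW: "card W = d" using x d6 by (simp add: W_def)
  have "W = ridge_E (d - 1) F x"
    using x d6 by (auto simp: W_def ridge_E_def)
  moreover have "2 \<le> pos F x" "pos F x + 1 < card F" using x c d6 by auto
  ultimately have "ridge (d - 1) F W" using x unfolding ridge_def by blast
  then obtain G where "G \<in> FF" "G \<inter> F = W" "ridge (d - 1) G W" using nbr[OF F] by blast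
  then show ?thesis using that x W_def cW by blast
qed

text \<open>Without 0, positions 0, 1 and positions 2, 3 of \<open>F\<close> are adjacent pairs. The
  facet \<open>G\<close> across the ridge of \<open>ridge_3\<close> starts at the same vertex and
  loses \<open>x\<close>, so parity demands a new vertex below \<open>x\<close>. The only room is
  between \<open>z1\<close> and \<open>z2\<close>, at position 2 of \<open>G\<close>, where the
  ridge would be too small.\<close>

lemma simplex_facet:
  assumes F: "F \<in> FF" "0 \<notin> F"
  shows "card F = d"
proof (rule ccontr)
  note f = facet_finite[OF F(1)]
  assume "card F \<noteq> d"
  then have c: "d + 1 \<le> card F" using facet_card[OF F(1)] by simp
  obtain x W G where x: "x \<in> F" "pos F x = 3" and W: "W = {y \<in> F. pos F y \<le> d} - {x}" "card W = d"
    and G: "G \<in> FF" "G \<inter> F = W" "ridge (d - 1) G W" using ridge_3[OF F(1) c] .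
  obtain z0 where z0: "z0 \<in> F" "pos F z0 = 0" using pos_surj[OF f, of 0] c d6 by auto
  obtain z1 where z1: "z1 \<in> F" "pos F z1 = 1" using pos_surj[OF f, of 1] c d6 by auto
  obtain z2 where z2: "z2 \<in> F" "pos F z2 = 2" using pos_surj[OF f, of 2] c d6 by auto
  have ord: "z0 < z1" "z1 < z2" "z2 < x"
    using pos_less_iff[OF z0(1) z1(1)] pos_less_iff[OF z1(1) z2(1)] pos_less_iff[OF z2(1) x(1)]
      z0 z1 z2 x by auto
  have s2: "x = Suc z2"
  proof -
    have "Suc z2 \<le> n" using ord facet_le[OF F(1) x(1)] by simp
    then have "Suc z2 \<in> F" using gale_zero[OF F, of "Suc z2"] z2 by (auto simp: pos_Suc)
    moreover have "pos F (Suc z2) = pos F x" using z2 x by (simp add: pos_Suc)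
    ultimately show ?thesis using inj_pos[of F] x(1) by (metis inj_onD)
  qed
  have s1: "z1 = Suc z0"
  proof -
    have "Suc z0 \<le> n" using ord facet_le[OF F(1) x(1)] by simp
    then have "Suc z0 \<in> F" using gale_zero[OF F, of "Suc z0"] z0 by (auto simp: pos_Suc)
    moreover have "pos F (Suc z0) = pos F z1" using z0 z1 by (simp add: pos_Suc)
    ultimately show ?thesis using inj_pos[of F] z1(1) by (metis inj_onD)
  qed
  have below: "u \<in> {z0, z1, z2}" if "u \<in> F" "u < x" for u
  proof -
    have "pos F u < 3" using pos_less[OF that] x by simp
    then consider "pos F u = 0" | "pos F u = 1" | "pos F u = 2" by linarith
    then show ?thesis using that(1) z0 z1 z2 inj_pos[of F] by cases (metis inj_onD insertCI)+
  qed
  have zW: "z0 \<in> W" "z1 \<in> W" "z2 \<in> W" using z0 z1 z2 x d6 ord by (auto simp: W)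
  then have zG: "z0 \<in> G" "z1 \<in> G" "z2 \<in> G" using G(2) by auto
  have xG: "x \<notin> G" using x G(2) W by auto
  obtain y where y: "y \<in> G" "2 \<le> pos G y" "W = ridge_E (d - 1) G y"
    using ridge_big[OF G(1,3)] W(2) by auto
  obtain m where m: "m \<in> G" "pos G m = 0" using pos_surj[OF facet_finite[OF G(1)], of 0] facet_card[OF G(1)] d6 by auto
  have "m \<in> W" using m y by (auto simp: ridge_E_def)
  then have "m \<in> F" using W by auto
  then have "z0 \<le> m" using pos_le_iff[OF z0(1), of m] z0 by simp
  moreover have "m \<le> z0" using pos_le_iff[OF m(1) zG(1)] m by simp
  ultimately have mz: "m = z0" by simp
  have lowest: "z0 \<le> u" if "u \<in> G" for u using pos_le_iff[OF m(1) that] m mz by simp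
  have "0 < z0" using z0 F(2) by (metis gr0I)
  then have "0 \<notin> G" using lowest by fastforce
  then have ev: "even (pos G x)" using gale_zero[OF G(1) _ _ xG] facet_le[OF F(1) x(1)] by simp
  have uW: "u \<notin> W \<and> z1 < u \<and> u < z2" if "u \<in> G" "u < x" "u \<notin> {z0, z1, z2}" for u
  proof -
    have "u \<notin> W" using below that W by auto
    moreover have "z1 < u" using lowest[OF that(1)] s1 that(3) by auto
    ultimately show ?thesis using that s2 by auto
  qed
  have "G \<inter> {..<x} \<noteq> {z0, z1, z2}"
  proof
    assume "G \<inter> {..<x} = {z0, z1, z2}"
    then have "pos G x = 3" using ord by (simp add: pos_def)
    then show False using ev by simp
  qed
  then obtain u where u: "u \<in> G" "u < x" "u \<notin> {z0, z1, z2}" using zG ord by auto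
  have z1p: "0 < pos G z1" using pos_less[OF zG(1), of z1] ord by simp
  have E: "W = ridge_E (d - 1) G u"
    using ridge_gap[OF G(3) zW(2,3) z1p _ _ u(1)] uW[OF u] by simp
  have "G \<inter> {..<u} = {z0, z1}"
  proof
    show "{z0, z1} \<subseteq> G \<inter> {..<u}" using zG ord uW[OF u] by auto
    show "G \<inter> {..<u} \<subseteq> {z0, z1}"
    proof
      fix v assume v: "v \<in> G \<inter> {..<u}"
      show "v \<in> {z0, z1}"
      proof (rule ccontr)
        assume "v \<notin> {z0, z1}"
        then have "v \<in> G" "v < x" "v \<notin> {z0, z1, z2}" using v u uW[OF u] by auto
        then have "v = u"
          using ridge_gap_unique[OF G(3) zW(2,3) z1p, of v u] uW uW[OF u] u(1) by blast
        then show False using v by simp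
      qed
    qed
  qed
  then have "pos G u = 2" using ord by (simp add: pos_def)
  then show False using ridge_not_2[OF G(1) u(1) E] W(2) by simp
qed

lemma facet_paired:
  assumes F: "F \<in> FF" "0 \<notin> F" shows "paired F"
  unfolding paired_def
proof (intro conjI allI impI)
  fix y assume y: "y \<notin> F"
  show "even (pos F y)"
  proof (cases "y \<le> n")
    case True then show ?thesis using gale_zero F y by blast
  next
    case False
    then have "F \<subseteq> {..<y}" using facet_sub[OF F(1)] by auto
    then show ?thesis using simplex_facet[OF F] even_d by (simp add: pos_all)
  qed
qed (rule facet_finite[OF F(1)])

text \<open>If the neighbour contains 0, this is its least vertex and lies outside the ridge. The
  ridge is then consecutive in the neighbour, so no new vertex lies between two of its
  vertices.\<close>

lemma simplex_nbr:
  assumes B: "B \<in> FF" "0 \<notin> B" and b: "b \<in> B"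
  obtains G where "G \<in> FF" "G \<inter> B = B - {b}" "b \<notin> G" "B - {b} \<subseteq> G"
    "0 \<in> G \<longrightarrow> (\<forall>v\<in>B - {b}. \<forall>w\<in>B - {b}. G \<inter> {v..w} \<subseteq> B - {b})"
proof -
  have "ridge (d - 1) B (B - {b})"
    using ridge_remove[OF facet_finite[OF B(1)] _ b, of "d - 1"] simplex_facet[OF B] d6 by simp
  then obtain G where G: "G \<in> FF" "G \<inter> B = B - {b}" "ridge (d - 1) G (B - {b})"
    using nbr[OF B(1)] by blast
  have c: "0 \<in> G \<longrightarrow> (\<forall>v\<in>B - {b}. \<forall>w\<in>B - {b}. G \<inter> {v..w} \<subseteq> B - {b})"
  proof (intro impI ballI subsetI)
    fix v w y assume z: "0 \<in> G" "v \<in> B - {b}" "w \<in> B - {b}" "y \<in> G \<inter> {v..w}"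
    show "y \<in> B - {b}"
      using ridge_min_mem[OF G(3) z(1) pos_0 _ z(2,3)] z(4) B(2) by simp
  qed
  have "b \<notin> G" "B - {b} \<subseteq> G" using G(2) b by auto
  from that[OF G(1,2) this c] show ?thesis .
qed

section \<open>Moving pairs inside the hull of a facet\<close>

lemma shift_right:
  assumes X: "X \<in> FF" "0 \<notin> X" and a: "a \<in> X" "Suc a \<in> X" "Suc (Suc a) \<notin> X" and z: "z \<in> X" "Suc a < z"
  shows "insert (Suc (Suc a)) (X - {a}) \<in> FF"
proof -
  obtain G where G0: "G \<in> FF" "G \<inter> X = X - {a}" "a \<notin> G" "X - {a} \<subseteq> G"
    "0 \<in> G \<longrightarrow> (\<forall>v\<in>X - {a}. \<forall>w\<in>X - {a}. G \<inter> {v..w} \<subseteq> X - {a})"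
    using simplex_nbr[OF X a(1)] .
  note G = G0(1,3,4,5)
  have "Suc (Suc a) \<le> n" using z facet_le[OF X(1)] by fastforce
  then have s: "Suc (Suc a) \<in> G" using gale_adj[OF G(1,2)] G(3) a by auto
  \<comment> \<open>With 0 in \<open>G\<close> the ridge would be consecutive, but the forced index
    \<open>Suc (Suc a)\<close> lies between its vertices \<open>Suc a\<close> and
    \<open>z\<close>.\<close>
  have "0 \<notin> G"
  proof
    assume "0 \<in> G"
    then have "G \<inter> {Suc a..z} \<subseteq> X - {a}" using G(4) a z by auto
    then show False using s a z by auto
  qed
  then have "card G = d" by (rule simplex_facet[OF G(1)])
  moreover have "card (insert (Suc (Suc a)) (X - {a})) = d"
    using paired_shift_right(2)[OF facet_paired[OF X] a] simplex_facet[OF X] by simp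
  ultimately have "insert (Suc (Suc a)) (X - {a}) = G"
    using s G(3) by (intro card_subset_eq[OF facet_finite[OF G(1)]]) auto
  then show ?thesis using G(1) by simp
qed

lemma shift_left:
  assumes X: "X \<in> FF" "0 \<notin> X" and a: "a \<notin> X" "Suc a \<in> X" "Suc (Suc a) \<in> X" and z: "z \<in> X" "z < Suc a"
  shows "insert a (X - {Suc (Suc a)}) \<in> FF"
proof -
  obtain G where G0: "G \<in> FF" "G \<inter> X = X - {Suc (Suc a)}" "Suc (Suc a) \<notin> G" "X - {Suc (Suc a)} \<subseteq> G"
    "0 \<in> G \<longrightarrow> (\<forall>v\<in>X - {Suc (Suc a)}. \<forall>w\<in>X - {Suc (Suc a)}. G \<inter> {v..w} \<subseteq> X - {Suc (Suc a)})"
    using simplex_nbr[OF X a(3)] .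
  note G = G0(1,3,4,5)
  have "Suc (Suc a) \<le> n" using a facet_le[OF X(1)] by fastforce
  then have s: "a \<in> G" using gale_adj'[OF G(1,2)] G(3) a by auto
  have "0 \<notin> G"
  proof
    assume "0 \<in> G"
    then have "G \<inter> {z..Suc a} \<subseteq> X - {Suc (Suc a)}" using G(4) a z by auto
    then show False using s a z by auto
  qed
  then have "card G = d" by (rule simplex_facet[OF G(1)])
  moreover have "card (insert a (X - {Suc (Suc a)})) = d"
    using paired_shift_left(2)[OF facet_paired[OF X] a] simplex_facet[OF X] by simp
  ultimately have "insert a (X - {Suc (Suc a)}) = G"
    using s G(3) by (intro card_subset_eq[OF facet_finite[OF G(1)]]) auto
  then show ?thesis using G(1) by simp
qed

text \<open>Normal form of a paired set with given ends: the lowest pair stays, the other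
  \<open>d - 2\<close> indices are packed against \<open>hi\<close>.\<close>

definition split_block :: "nat \<Rightarrow> nat \<Rightarrow> nat set" where
  "split_block lo hi = {lo, Suc lo} \<union> {hi + 3 - d..hi}"

text \<open>Every pair except the lowest is pushed to the right. \<open>shift_right\<close> needs a
  vertex above the moved pair, supplied by \<open>Max X = hi\<close>; undoing a move by
  \<open>shift_left\<close> needs one below, supplied by the lowest pair. Hence only the forward
  implication mentions the maximum.\<close>

lemma stretch:
  assumes "paired X" "card X = d" "X \<subseteq> {Min X..hi}" "0 < Min X"
  shows "(X \<in> FF \<and> Max X = hi \<longrightarrow> split_block (Min X) hi \<in> FF) \<and>
    (split_block (Min X) hi \<in> FF \<longrightarrow> X \<in> FF)"
  using assms
proof (induction "\<Sum>x\<in>X. hi - x" arbitrary: X rule: less_induct)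
  case less
  let ?lo = "Min X"
  have f: "finite X" and ne: "X \<noteq> {}" using less.prems paired_finite d6 by auto
  have lo: "?lo \<in> X" "Suc ?lo \<in> X" using paired_Min[OF less.prems(1) ne] .
  show ?case
  proof (cases "\<exists>x\<in>X. Suc ?lo < x \<and> x < hi \<and> Suc x \<notin> X")
    case True
    then obtain x where x: "x \<in> X" "Suc ?lo < x" "x < hi" "Suc x \<notin> X" by blast
    then obtain a where a: "x = Suc a" by (cases x) auto
    \<comment> \<open>The index \<open>x\<close> is followed by a gap, so it is the upper member of
      its pair and \<open>a\<close> is the lower one.\<close>
    have "odd (pos X (Suc a))"
      using paired_even[OF less.prems(1) x(4)] x(1) by (simp add: pos_Suc a)
    then have aX: "a \<in> X" using paired_pred[OF less.prems(1)] x(1) a by auto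
    let ?Y = "insert (Suc (Suc a)) (X - {a})"
    have sh: "a \<in> X" "Suc a \<in> X" "Suc (Suc a) \<notin> X" using aX x a by auto
    have la: "?lo < a" using x a by simp
    have MinY: "Min ?Y = ?lo"
    proof (rule Min_eqI)
      show "finite ?Y" using f by simp
      show "?lo \<in> ?Y" using lo la by auto
    next
      fix y assume "y \<in> ?Y" then show "?lo \<le> y" using f la by (auto intro: Min_le)
    qed
    have zero: "0 \<notin> X" using less.prems(4) f by (metis Min_le leD)
    have Ysub: "?Y \<subseteq> {?lo..hi}" using less.prems(3) x a la by auto
    have "(\<Sum>x\<in>?Y. hi - x) = (hi - Suc (Suc a)) + (\<Sum>x\<in>X - {a}. hi - x)"
      using f sh by (subst sum.insert) auto
    moreover have "(\<Sum>x\<in>X. hi - x) = (hi - a) + (\<Sum>x\<in>X - {a}. hi - x)"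
      using f sh by (simp add: sum.remove)
    ultimately have dec: "(\<Sum>x\<in>?Y. hi - x) < (\<Sum>x\<in>X. hi - x)" using x a by simp
    have IH: "(?Y \<in> FF \<and> Max ?Y = hi \<longrightarrow> split_block ?lo hi \<in> FF) \<and> (split_block ?lo hi \<in> FF \<longrightarrow> ?Y \<in> FF)"
      using less.hyps[OF dec] paired_shift_right[OF less.prems(1) sh] less.prems(2,4) MinY Ysub by simp
    have fwd: "?Y \<in> FF \<and> Max ?Y = hi" if "X \<in> FF" "Max X = hi"
    proof
      have hiX: "hi \<in> X" using that f ne Max_in by blast
      then show "?Y \<in> FF" using shift_right[OF that(1) zero sh hiX] x a by simp
      show "Max ?Y = hi"
      proof (rule Max_eqI)
        show "finite ?Y" using f by simp
        show "hi \<in> ?Y" using hiX x a by auto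
      next
        fix y assume "y \<in> ?Y" then show "y \<le> hi" using Ysub by auto
      qed
    qed
    have bwd: "X \<in> FF" if Y: "?Y \<in> FF"
    proof -
      have "0 \<notin> ?Y" using zero by simp
      moreover have "?lo \<in> ?Y" "?lo < Suc a" using lo la by auto
      moreover have "a \<notin> ?Y" "Suc a \<in> ?Y" "Suc (Suc a) \<in> ?Y" using sh by auto
      ultimately have "insert a (?Y - {Suc (Suc a)}) \<in> FF" by (intro shift_left[OF Y])
      moreover have "insert a (?Y - {Suc (Suc a)}) = X" using sh by auto
      ultimately show ?thesis by simp
    qed
    show ?thesis using IH fwd bwd by blast
  next
    case False
    let ?Z = "X - {?lo, Suc ?lo}"
    have cZ: "card ?Z = d - 2" using less.prems(2) lo f by (simp add: card_Diff_subset)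
    have Zne: "?Z \<noteq> {}"
    proof
      assume "?Z = {}"
      then have "card ?Z = 0" by (simp only: card.empty)
      then show False using cZ d6 by simp
    qed
    have ZX: "?Z \<subseteq> {Suc (Suc ?lo)..hi}"
    proof
      fix y assume y: "y \<in> ?Z"
      then have "?lo \<le> y" using f by simp
      then show "y \<in> {Suc (Suc ?lo)..hi}" using y less.prems(3) by auto
    qed
    \<comment> \<open>Above the lowest pair no index below \<open>hi\<close> is followed by a gap,
      so the rest is an interval ending at \<open>hi\<close>.\<close>
    define u where "u = Min ?Z"
    have uZ: "u \<in> ?Z" using Zne f unfolding u_def by (intro Min_in) auto
    have up: "u + k \<in> X" if "u + k \<le> hi" for k
      using that
    proof (induction k)
      case 0 then show ?case using uZ by simp
    next
      case (Suc k)
      moreover have "Suc ?lo < u + k" using uZ ZX by fastforce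
      ultimately show ?case using False by auto
    qed
    have "?Z = {u..hi}"
    proof
      show "?Z \<subseteq> {u..hi}" using ZX f by (auto simp: u_def)
      show "{u..hi} \<subseteq> ?Z"
      proof
        fix y assume "y \<in> {u..hi}"
        then have "y \<in> X" using up[of "y - u"] by simp
        moreover have "Suc ?lo < y" using uZ ZX \<open>y \<in> {u..hi}\<close> by fastforce
        ultimately show "y \<in> ?Z" by auto
      qed
    qed
    moreover have "u = hi + 3 - d" using calculation cZ d6 by simp
    ultimately have "X = split_block ?lo hi" using lo by (auto simp: split_block_def)
    then show ?thesis by simp
  qed
qed

text \<open>Lowering the least pair by one yields a set covered by the induction hypothesis. It can
  be moved back by \<open>shift_right\<close>, since a set of \<open>d\<close> indices has another
  index above that pair.\<close>

lemma in_hull_aux: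
  assumes "split_block lo hi \<in> FF" "paired X" "card X = d" "X \<subseteq> {lo..hi}" "0 < lo"
  shows "X \<in> FF"
  using assms(2-4)
proof (induction "Min X" arbitrary: X)
  case 0
  have f: "finite X" and ne: "X \<noteq> {}" using 0 paired_finite d6 by auto
  then show ?case using 0 assms(5) Min_in[OF f ne] by auto
next
  case (Suc a)
  have f: "finite X" and ne: "X \<noteq> {}" using Suc.prems paired_finite d6 by auto
  have lo: "Suc a \<in> X" "Suc (Suc a) \<in> X" using paired_Min[OF Suc.prems(1) ne] Suc.hyps(2) by auto
  have ge: "y \<in> X \<Longrightarrow> Suc a \<le> y" for y using f Suc.hyps(2) by simp
  have lower: "lo \<le> Suc a" using lo Suc.prems by auto
  show ?case
  proof (cases "lo = Suc a")
    case True
    then have "X \<subseteq> {Min X..hi}" using Suc.prems(3) Suc.hyps(2) by simp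
    then show ?thesis using stretch[OF Suc.prems(1,2), of hi] assms(1,5) True Suc.hyps(2) by simp
  next
    case False
    then have la: "lo \<le> a" using lower by simp
    have sh: "a \<notin> X" using ge by fastforce
    let ?Y = "insert a (X - {Suc (Suc a)})"
    have "Min ?Y = a"
    proof (rule Min_eqI)
      fix y assume "y \<in> ?Y" then show "a \<le> y" using ge by fastforce
    qed (use f in auto)
    moreover have "?Y \<subseteq> {lo..hi}" using la Suc.prems(3) lo by auto
    ultimately have Y: "?Y \<in> FF"
      using Suc.hyps(1)[of ?Y] paired_shift_left[OF Suc.prems(1) sh lo] Suc.prems(2) by simp
    have "\<not> X \<subseteq> {Suc a, Suc (Suc a)}"
    proof
      assume "X \<subseteq> {Suc a, Suc (Suc a)}"
      then have "card X \<le> card {Suc a, Suc (Suc a)}" by (intro card_mono) auto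
      then show False using Suc.prems(2) d6 by simp
    qed
    then obtain z where z: "z \<in> X" "z \<noteq> Suc a" "z \<noteq> Suc (Suc a)" by auto
    then have "Suc a < z" using ge[of z] by simp
    moreover have "0 \<notin> ?Y" using la assms(5) ge by auto
    moreover have "a \<in> ?Y" "Suc a \<in> ?Y" "Suc (Suc a) \<notin> ?Y" "z \<in> ?Y" using lo z by auto
    ultimately have "insert (Suc (Suc a)) (?Y - {a}) \<in> FF" by (intro shift_right[OF Y])
    moreover have "insert (Suc (Suc a)) (?Y - {a}) = X" using lo sh by auto
    ultimately show ?thesis by simp
  qed
qed

lemma in_hull:
  assumes F: "F \<in> FF" "0 \<notin> F" and X: "paired X" "card X = d" "X \<subseteq> {Min F..Max F}"
  shows "X \<in> FF"
proof -
  have f: "finite F" by (rule facet_finite[OF F(1)])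
  have ne: "F \<noteq> {}" using simplex_facet[OF F] d6 by auto
  have m: "0 < Min F" using Min_in[OF f ne] F(2) by (metis gr0I)
  have "split_block (Min F) (Max F) \<in> FF"
    using stretch[OF facet_paired[OF F] simplex_facet[OF F], of "Max F"] f m F by (auto simp: subset_iff)
  then show ?thesis using in_hull_aux X m by blast
qed

section \<open>Translating the hull of a longest facet without 0\<close>

lemma slide_right:
  assumes hull: "\<forall>F\<in>FF. 0 \<notin> F \<longrightarrow> (\<forall>u\<in>F. \<forall>v\<in>F. v < u + L)"
    and B: "B \<in> FF" "0 \<notin> B" "Suc (Max B) = Min B + L" "Max B < n"
  shows "\<exists>G\<in>FF. 0 \<notin> G \<and> Min G = Suc (Min B) \<and> Suc (Max G) = Min G + L"
proof -
  note short = hull[rule_format]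
  note p = facet_paired[OF B(1,2)]
  have f: "finite B" by (rule paired_finite[OF p])
  have cB: "card B = d" by (rule simplex_facet[OF B(1,2)])
  have ne: "B \<noteq> {}" using cB d6 by auto
  define lo where "lo = Min B"
  define a where "a = Max B - 1"
  have hi: "Max B = Suc a" using paired_Max(2)[OF p ne] by (simp add: a_def)
  have m: "lo \<in> B" "Suc lo \<in> B" "Suc a \<in> B" "a \<in> B"
    using paired_Min[OF p ne] paired_Max(1,3)[OF p ne] hi unfolding lo_def by simp_all
  have rng: "B \<subseteq> {lo..Suc a}" using Min_le[OF f] Max_ge[OF f] unfolding hi lo_def by auto
  have len: "d \<le> Suc (Suc a) - lo" using card_mono[OF _ rng] cB by simp
  obtain G where G: "G \<in> FF" "G \<inter> B = B - {a}" "a \<notin> G" "B - {a} \<subseteq> G"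
    "0 \<in> G \<longrightarrow> (\<forall>v\<in>B - {a}. \<forall>w\<in>B - {a}. G \<inter> {v..w} \<subseteq> B - {a})"
    using simplex_nbr[OF B(1,2) m(4)] .
  have s: "Suc (Suc a) \<in> G" using gale_adj[OF G(1,3)] G(4) m B(4) hi by auto
  have loG: "lo \<in> G" using G(4) m len d6 by auto
  \<comment> \<open>Otherwise \<open>lo\<close> and \<open>Suc (Suc a)\<close> would lie in a facet
    without 0 whose hull is longer than \<open>L\<close>.\<close>
  have "0 \<in> G"
  proof (rule ccontr)
    assume "0 \<notin> G"
    from short[OF G(1) this loG s] show False using B(3) hi by (simp add: lo_def)
  qed
  moreover have "lo \<in> B - {a}" "Suc a \<in> B - {a}" using m len d6 by auto
  ultimately have "G \<inter> {lo..Suc a} \<subseteq> B - {a}" using G(5) by blast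
  then have c: "G \<inter> {lo..Suc a} = B - {a}" using G(4) rng by blast
  \<comment> \<open>Dropping \<open>lo\<close> as well leaves \<open>d - 1\<close> consecutive
    vertices without 0. The facet \<open>H\<close> across meets \<open>G\<close> only in these, so
    it misses 0.\<close>
  let ?R = "G \<inter> {Suc lo..Suc (Suc a)}"
  have R: "?R = insert (Suc (Suc a)) (B - {a, lo})"
  proof -
    have "?R = insert (Suc (Suc a)) (G \<inter> {lo..Suc a} - {lo})" using s len d6 by auto
    then show ?thesis unfolding c by auto
  qed
  have "Suc (Suc a) \<notin> B" using rng by auto
  then have "card ?R = d - 1" using R f cB m len d6 by (simp add: card_Diff_subset)
  then have "ridge (d - 1) G ?R"
    by (rule ridge_T_interval[OF facet_finite[OF G(1)] refl]) (use d6 in simp)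
  then obtain H where H: "H \<in> FF" "H \<inter> G = ?R" using nbr[OF G(1)] by blast
  have mem: "y \<in> H \<longleftrightarrow> y \<in> ?R" if "y \<in> G" for y using H(2) that by blast
  have "0 \<notin> H" using mem[OF \<open>0 \<in> G\<close>] by simp
  have hm: "Suc lo \<in> H" "Suc (Suc a) \<in> H" using mem s G(4) m len d6 by auto
  have fH: "finite H" by (rule facet_finite[OF H(1)])
  then have "Min H \<in> H" "Max H \<in> H" using hm(1) by (auto intro: Min_in Max_in)
  note sh = short[OF H(1) \<open>0 \<notin> H\<close>]
  \<comment> \<open>From \<open>Suc lo\<close> to \<open>Suc (Suc a)\<close> there are already
    \<open>L\<close> indices, so maximality of \<open>L\<close> pins down both ends of
    \<open>H\<close>.\<close>
  have "Min H \<le> Suc lo" "Suc (Suc a) \<le> Max H" using hm fH by auto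
  moreover have "Suc (Suc a) < Min H + L" "Max H < Suc lo + L" using sh[OF \<open>Min H \<in> H\<close> hm(2)] sh[OF hm(1) \<open>Max H \<in> H\<close>] by auto
  ultimately have "Min H = Suc lo \<and> Suc (Max H) = Min H + L"
    using B(3) hi by (simp add: lo_def)
  then show ?thesis using H(1) \<open>0 \<notin> H\<close> by (auto simp: lo_def)
qed

text \<open>Mirror image of \<open>slide_right\<close>, exchanging the second smallest vertex. The
  hypothesis \<open>1 < Min B\<close> keeps the new index \<open>a\<close> away from 0, so that the
  second ridge avoids 0.\<close>

lemma slide_left:
  assumes hull: "\<forall>F\<in>FF. 0 \<notin> F \<longrightarrow> (\<forall>u\<in>F. \<forall>v\<in>F. v < u + L)"
    and B: "B \<in> FF" "0 \<notin> B" "Suc (Max B) = Min B + L" "1 < Min B"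
  shows "\<exists>G\<in>FF. 0 \<notin> G \<and> Suc (Min G) = Min B \<and> Suc (Max G) = Min G + L"
proof -
  note short = hull[rule_format]
  note p = facet_paired[OF B(1,2)]
  have f: "finite B" by (rule paired_finite[OF p])
  have cB: "card B = d" by (rule simplex_facet[OF B(1,2)])
  have ne: "B \<noteq> {}" using cB d6 by auto
  define a where "a = Min B - 1"
  define b where "b = Max B - 1"
  have lo: "Min B = Suc a" and a0: "0 < a" using B(4) by (auto simp: a_def)
  have hi: "Max B = Suc b" using paired_Max(2)[OF p ne] by (simp add: b_def)
  have m: "Suc a \<in> B" "Suc (Suc a) \<in> B" "Suc b \<in> B" "b \<in> B"
    using paired_Min[OF p ne] paired_Max(1,3)[OF p ne] hi lo by simp_all
  have rng: "B \<subseteq> {Suc a..Suc b}" using Min_le[OF f] Max_ge[OF f] unfolding hi lo by auto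
  have len: "d \<le> Suc b - a" using card_mono[OF _ rng] cB by simp
  have aB: "a \<notin> B" using rng by auto
  obtain G where G: "G \<in> FF" "G \<inter> B = B - {Suc (Suc a)}" "Suc (Suc a) \<notin> G" "B - {Suc (Suc a)} \<subseteq> G"
    "0 \<in> G \<longrightarrow> (\<forall>v\<in>B - {Suc (Suc a)}. \<forall>w\<in>B - {Suc (Suc a)}. G \<inter> {v..w} \<subseteq> B - {Suc (Suc a)})"
    using simplex_nbr[OF B(1,2) m(2)] .
  have "Suc (Suc a) \<le> n" using m facet_le[OF B(1)] by blast
  then have s: "a \<in> G" using gale_adj'[OF G(1,3)] G(4) m by auto
  have hiG: "Suc b \<in> G" "b \<in> G" using G(4) m len d6 by auto
  have "0 \<in> G"
  proof (rule ccontr)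
    assume "0 \<notin> G"
    from short[OF G(1) this s hiG(1)] show False using B(3) hi lo by simp
  qed
  moreover have "Suc a \<in> B - {Suc (Suc a)}" "Suc b \<in> B - {Suc (Suc a)}" using m len d6 by auto
  ultimately have "G \<inter> {Suc a..Suc b} \<subseteq> B - {Suc (Suc a)}" using G(5) by blast
  then have c: "G \<inter> {Suc a..Suc b} = B - {Suc (Suc a)}" using G(4) rng by blast
  let ?R = "G \<inter> {a..b}"
  have R: "?R = insert a (B - {Suc (Suc a), Suc b})"
  proof -
    have "?R = insert a (G \<inter> {Suc a..Suc b} - {Suc b})" using s len d6 by (auto simp: Suc_le_eq order_le_less)
    then show ?thesis unfolding c by auto
  qed
  have "card ?R = d - 1" using R f cB m len d6 aB by (simp add: card_Diff_subset)
  then have "ridge (d - 1) G ?R"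
    by (rule ridge_T_interval[OF facet_finite[OF G(1)] refl]) (use d6 in simp)
  then obtain H where H: "H \<in> FF" "H \<inter> G = ?R" using nbr[OF G(1)] by blast
  have mem: "y \<in> H \<longleftrightarrow> y \<in> ?R" if "y \<in> G" for y using H(2) that by blast
  have "0 \<notin> H" using mem[OF \<open>0 \<in> G\<close>] a0 by simp
  have hm: "a \<in> H" "b \<in> H" using mem s hiG len d6 by auto
  have fH: "finite H" by (rule facet_finite[OF H(1)])
  then have "Min H \<in> H" "Max H \<in> H" using hm(1) by (auto intro: Min_in Max_in)
  note sh = short[OF H(1) \<open>0 \<notin> H\<close>]
  have "Min H \<le> a" "b \<le> Max H" using hm fH by auto
  moreover have "b < Min H + L" "Max H < a + L" using sh hm \<open>Min H \<in> H\<close> \<open>Max H \<in> H\<close> by auto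
  ultimately have "Min H = a \<and> Suc (Max H) = Min H + L"
    using B(3) hi lo by simp
  then show ?thesis using H(1) \<open>0 \<notin> H\<close> lo by auto
qed

text \<open>\<open>L\<close> is the greatest length of the hull of a facet without 0. Translation
  puts a facet with such a hull into every window of \<open>L\<close> indices in
  \<open>{1..n}\<close>, and \<open>in_hull\<close> then supplies all paired sets of that
  window.\<close>

lemma hull_length:
  obtains L where "d \<le> L" "L \<le> n"
    "\<And>F u v. F \<in> FF \<Longrightarrow> 0 \<notin> F \<Longrightarrow> u \<in> F \<Longrightarrow> v \<in> F \<Longrightarrow> v < u + L"
    "\<And>X. paired X \<Longrightarrow> card X = d \<Longrightarrow> X \<subseteq> {1..n} \<Longrightarrow> \<forall>u\<in>X. \<forall>v\<in>X. v < u + L \<Longrightarrow> X \<in> FF"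
proof -
  let ?S = "{F \<in> FF. 0 \<notin> F}"
  let ?len = "\<lambda>F. Suc (Max F) - Min F"
  have "?S \<subseteq> Pow {..n}" using facet_sub by blast
  then have fS: "finite ?S" by (rule finite_subset) simp
  have neS: "?S \<noteq> {}" using miss_zero by blast
  define L where "L = Max (?len ` ?S)"
  have "L \<in> ?len ` ?S" unfolding L_def using fS neS by (intro Max_in) auto
  then obtain B where B: "B \<in> FF" "0 \<notin> B" "L = ?len B" by auto
  have short: "v < u + L" if F: "F \<in> FF" "0 \<notin> F" "u \<in> F" "v \<in> F" for F u v
  proof -
    have "?len F \<le> L" unfolding L_def using fS F by (intro Max_ge) auto
    moreover have "Min F \<le> u" "v \<le> Max F" using facet_finite[OF F(1)] F by auto
    ultimately show ?thesis by simp
  qed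
  have hull: "\<forall>F\<in>FF. 0 \<notin> F \<longrightarrow> (\<forall>u\<in>F. \<forall>v\<in>F. v < u + L)" using short by blast
  have fin: "finite B" by (rule facet_finite[OF B(1)])
  have cB: "card B = d" by (rule simplex_facet[OF B(1,2)])
  have ne: "B \<noteq> {}" using cB d6 by auto
  have mm: "Min B \<in> B" "Max B \<in> B" using fin ne by auto
  have "Min B \<le> Max B" using fin mm by simp
  have BL: "Suc (Max B) = Min B + L" using B(3) \<open>Min B \<le> Max B\<close> by simp
  have "card B \<le> card {Min B..Max B}" using fin by (intro card_mono) auto
  then have dL: "d \<le> L" using cB B(3) by simp
  have B1: "1 \<le> Min B" using mm(1) B(2) by (metis One_nat_def Suc_leI gr0I)
  have "Max B \<le> n" using facet_le[OF B(1) mm(2)] .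
  then have Ln: "L \<le> n" using BL B1 by simp
  have right: "\<exists>G\<in>FF. 0 \<notin> G \<and> Min G = Min B + k \<and> Suc (Max G) = Min G + L" if "Max B + k \<le> n" for k
    using that
  proof (induction k)
    case 0 then show ?case using B BL by auto
  next
    case (Suc k)
    then obtain G where G: "G \<in> FF" "0 \<notin> G" "Min G = Min B + k" "Suc (Max G) = Min G + L" by auto
    have "Max G < n" using G(3,4) BL Suc.prems by simp
    from slide_right[OF hull G(1,2,4) this] show ?case using G(3) by auto
  qed
  have left: "\<exists>G\<in>FF. 0 \<notin> G \<and> Min G + k = Min B \<and> Suc (Max G) = Min G + L" if "k < Min B" for k
    using that
  proof (induction k)
    case 0 then show ?case using B BL by auto
  next
    case (Suc k)
    then obtain G where G: "G \<in> FF" "0 \<notin> G" "Min G + k = Min B" "Suc (Max G) = Min G + L" by auto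
    have "1 < Min G" using G(3) Suc.prems by simp
    from slide_left[OF hull G(1,2,4) this] show ?case using G(3) by auto
  qed
  have win: "\<exists>G\<in>FF. 0 \<notin> G \<and> Min G = i \<and> Suc (Max G) = i + L" if "1 \<le> i" "i + L \<le> Suc n" for i
  proof (cases "Min B \<le> i")
    case True
    then have "Max B + (i - Min B) \<le> n" "Min B + (i - Min B) = i" using that BL by auto
    then show ?thesis using right[of "i - Min B"] by metis
  next
    case False
    then have "Min B - i < Min B" "m + (Min B - i) = Min B \<longleftrightarrow> m = i" for m using that by auto
    then show ?thesis using left[of "Min B - i"] by metis
  qed
  have all: "X \<in> FF" if X: "paired X" "card X = d" "X \<subseteq> {1..n}" "\<forall>u\<in>X. \<forall>v\<in>X. v < u + L" for X
  proof -
    have fX: "finite X" and neX: "X \<noteq> {}" using X(1,2) paired_finite d6 by auto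
    have mX: "Min X \<in> X" using fX neX by simp
    \<comment> \<open>The window starts at \<open>Min X\<close> unless it would then extend beyond
      \<open>n\<close>.\<close>
    define i where "i = min (Min X) (Suc n - L)"
    have "1 \<le> i" "i + L \<le> Suc n" using mX X(3) Ln by (auto simp: i_def)
    then obtain G where G: "G \<in> FF" "0 \<notin> G" "Min G = i" "Suc (Max G) = i + L" using win by blast
    have "X \<subseteq> {Min G..Max G}"
    proof
      fix y assume y: "y \<in> X"
      have "Min X \<le> y" "y < Min X + L" "y \<le> n" using fX y X(4) mX y X(3) by auto
      then have "i \<le> y" "y < i + L" by (auto simp: i_def min_def)
      then show "y \<in> {Min G..Max G}" using G by simp
    qed
    then show ?thesis using in_hull[OF G(1,2) X(1,2)] by simp
  qed
  show ?thesis using that[OF dL Ln] short all by blast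
qed

end

lemma pos_slice:
  assumes f: "finite Z" and b: "b \<le> card Z"
  shows "pos {y \<in> Z. a \<le> pos Z y \<and> pos Z y < b} z = min (pos Z z) b - a"
proof -
  have "y < z \<longleftrightarrow> pos Z y < pos Z z" if "y \<in> Z" for y
    using that by (meson linorder_not_less pos_less pos_mono)
  then have "{y \<in> Z. a \<le> pos Z y \<and> pos Z y < b} \<inter> {..<z} = {y \<in> Z. a \<le> pos Z y \<and> pos Z y < min (pos Z z) b}"
    by auto
  then show ?thesis using card_pos_between[OF f, of "min (pos Z z) b" a] b by (simp add: pos_def)
qed

section \<open>Traces of facets on windows of \<open>L + 1\<close> indices\<close>

locale braxial_hull = braxial_family +
  fixes L :: nat
  assumes dL: "d \<le> L" and Ln: "L \<le> n"
    and short: "F \<in> FF \<Longrightarrow> 0 \<notin> F \<Longrightarrow> u \<in> F \<Longrightarrow> v \<in> F \<Longrightarrow> v < u + L"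
    and all: "paired X \<Longrightarrow> card X = d \<Longrightarrow> X \<subseteq> {1..n} \<Longrightarrow> \<forall>u\<in>X. \<forall>v\<in>X. v < u + L \<Longrightarrow> X \<in> FF"

lemma (in braxial_family) braxial_hull_exists: "\<exists>L. braxial_hull n d FF L"
proof (rule hull_length)
  fix L assume L: "d \<le> L" "L \<le> n"
    "\<And>F u v. F \<in> FF \<Longrightarrow> 0 \<notin> F \<Longrightarrow> u \<in> F \<Longrightarrow> v \<in> F \<Longrightarrow> v < u + L"
    "\<And>X. paired X \<Longrightarrow> card X = d \<Longrightarrow> X \<subseteq> {1..n} \<Longrightarrow> \<forall>u\<in>X. \<forall>v\<in>X. v < u + L \<Longrightarrow> X \<in> FF"
  have "braxial_hull n d FF L"
    by unfold_locales (use L in auto)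
  then show ?thesis ..
qed

context braxial_hull
begin

lemma all_window:
  assumes "paired X" "card X = d" "X \<subseteq> {i..<i + L}" "1 \<le> i" "X \<subseteq> {..n}"
  shows "X \<in> FF"
proof (rule all[OF assms(1,2)])
  show "X \<subseteq> {1..n}" using assms(3-5) by fastforce
  show "\<forall>u\<in>X. \<forall>v\<in>X. v < u + L"
  proof (intro ballI)
    fix u v assume "u \<in> X" "v \<in> X"
    then have "i \<le> u" "v < i + L" using assms(3) by auto
    then show "v < u + L" by simp
  qed
qed

lemma not_subfacet: "X \<in> FF \<Longrightarrow> G \<in> FF \<Longrightarrow> X \<subseteq> G \<Longrightarrow> 0 \<in> G \<Longrightarrow> 0 \<notin> X \<Longrightarrow> False"
  using antichain by blast

text \<open>The vertices of \<open>G\<close> directly before and after the omitted vertex belong to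
  \<open>W\<close> and have positive position, which places \<open>x\<close> between
  \<open>v\<close> and \<open>w\<close>. Uniqueness of inner gaps excludes any further vertex
  there.\<close>

lemma inner_extra:
  assumes G: "G \<in> FF" and W: "ridge (d - 1) G W" "d \<le> card W"
    and v: "v \<in> W" "w \<in> W" "0 < pos G v"
    and rng: "\<And>u. u \<in> W \<Longrightarrow> 0 < pos G u \<Longrightarrow> v \<le> u \<and> u \<le> w"
  obtains x where "x \<in> G" "x \<notin> W" "W = ridge_E (d - 1) G x" "v < x" "x < w"
    "G \<inter> {v..w} = insert x (W \<inter> {v..w})" "pos G x \<noteq> 2"
proof -
  note f = facet_finite[OF G]
  have WG: "W \<subseteq> G" by (rule ridge_subset[OF W(1)])
  obtain x where x: "x \<in> G" "2 \<le> pos G x" "pos G x + 1 < card G" "W = ridge_E (d - 1) G x"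
    using ridge_big[OF G W] by blast
  have xW: "x \<notin> W" using x(4) by (simp add: ridge_E_def)
  have lt: "pos G x - 1 < card G" using x(3) by simp
  obtain l where l: "l \<in> G" "pos G l = pos G x - 1" using pos_surj[OF f lt] .
  obtain r where r: "r \<in> G" "pos G r = pos G x + 1" using pos_surj[OF f x(3)] .
  have "l < x" "x < r" using pos_less_iff[OF l(1) x(1)] pos_less_iff[OF x(1) r(1)] l r x by auto
  moreover have "l \<in> W" "r \<in> W" using l r x d6 \<open>l < x\<close> \<open>x < r\<close> by (auto simp: ridge_E_def)
  moreover have "0 < pos G l" "0 < pos G r" using l r x by auto
  ultimately have vxw: "v < x" "x < w" using rng[of l] rng[of r] by auto
  have "G \<inter> {v..w} = insert x (W \<inter> {v..w})"
  proof
    show "insert x (W \<inter> {v..w}) \<subseteq> G \<inter> {v..w}" using x(1) vxw WG by auto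
    show "G \<inter> {v..w} \<subseteq> insert x (W \<inter> {v..w})"
    proof
      fix y assume y: "y \<in> G \<inter> {v..w}"
      show "y \<in> insert x (W \<inter> {v..w})"
      proof (cases "y \<in> W")
        case False
        then have "v < y" "y < w" using y v by (auto simp: order_le_less)
        then have "y = x"
          using ridge_gap_unique[OF W(1) v, of y x] y False x(1) xW vxw by blast
        then show ?thesis by simp
      qed (use y in simp)
    qed
  qed
  then show ?thesis using that x xW vxw ridge_not_2[OF G x(1,4) W(2)] by blast
qed

text \<open>A set with both ends of the window is too long to be a facet. Replacing its top index by
  the highest gap \<open>y\<close> of the window gives a facet; the one across the ridge without
  \<open>y\<close> regains \<open>i + L\<close> by parity. This facet is too long to miss 0, hence
  the ridge is consecutive in it and its trace is exactly \<open>B\<close>.\<close>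

lemma window_facet_pos:
  assumes B: "paired B" "card B = d" "B \<subseteq> {i..i + L}" and i: "1 \<le> i" "i + L \<le> n"
  shows "\<exists>G\<in>FF. G \<inter> {i..i + L} = B \<and> (i \<in> B \<and> i + L \<in> B \<longrightarrow> 0 \<in> G)"
proof (cases "i \<in> B \<and> i + L \<in> B")
  case False
  have "\<forall>u\<in>B. \<forall>v\<in>B. v < u + L"
  proof (intro ballI)
    fix u v assume uv: "u \<in> B" "v \<in> B"
    then have "u \<in> {i..i + L}" "v \<in> {i..i + L}" using B(3) by auto
    moreover have "\<not> (u = i \<and> v = i + L)" using False uv by auto
    ultimately show "v < u + L" by auto
  qed
  then have "B \<in> FF" using B i by (intro all) auto
  then show ?thesis using False B(3) by (intro bexI[of _ B]) auto
next
  case True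
  have f: "finite B" by (rule paired_finite[OF B(1)])
  let ?D = "{i..i + L} - B"
  have "?D \<noteq> {}"
  proof
    assume "?D = {}"
    then have "card {i..i + L} \<le> card B" using f by (intro card_mono) auto
    then show False using B(2) dL by simp
  qed
  define y where "y = Max ?D"
  have yD: "y \<in> ?D" unfolding y_def using \<open>?D \<noteq> {}\<close> by (intro Max_in) auto
  then have y: "y \<notin> B" "i < y" "y < i + L" using True by (auto simp: order_le_less)
  have above: "z \<in> B" if "y < z" "z \<le> i + L" for z
  proof (rule ccontr)
    assume "z \<notin> B"
    then have "z \<le> y" unfolding y_def using that y by (intro Max_ge) auto
    then show False using that by simp
  qed
  have MaxB: "Max B = i + L" using True B(3) f by (intro Max_eqI) auto
  have ne: "B \<noteq> {}" using True by auto
  have pred: "i + L - 1 \<in> B" using paired_Max(3)[OF B(1) ne] MaxB by simp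
  have "B = insert (i + L) (B \<inter> {..<i + L})" using True B(3) by (auto simp: order_le_less)
  then have "d = Suc (pos B (i + L))" using B(2) f unfolding pos_def
    by (metis card_insert_disjoint finite_Int Int_iff lessThan_iff order_less_irrefl)
  then have odd: "odd (pos B (i + L))" using even_d by presburger
  let ?X = "insert y (B - {i + L})"
  have e: "pos ?X z + (if i + L < z then 1 else 0) = pos B z + (if y < z then 1 else 0)" for z
    using f y True pos_insert[of "B - {i + L}" y z] pos_remove[of B "i + L" z] by simp
  have pX: "paired ?X" unfolding paired_def
  proof (intro conjI allI impI)
    fix z assume z: "z \<notin> ?X"
    show "even (pos ?X z)"
    proof (cases "z = i + L")
      case True then show ?thesis using e[of z] odd y by auto
    next
      case False
      then have "z \<notin> B" "z \<noteq> y" using z by auto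
      moreover from this have "z < y \<or> i + L < z" using above[of z] by fastforce
      ultimately show ?thesis using e[of z] paired_even[OF B(1), of z] y by auto
    qed
  qed (use f in simp)
  have "card ?X = Suc (card (B - {i + L}))" using f y by simp
  then have cX: "card ?X = d" using f True B(2) d6 by simp
  have Xsub: "?X \<subseteq> {i..<i + L}" using y B(3) True by (auto simp: order_le_less)
  have XF: "?X \<in> FF"
  proof (rule all_window[OF pX cX Xsub i(1)])
    show "?X \<subseteq> {..n}" using Xsub i by fastforce
  qed
  have X0: "0 \<notin> ?X" using Xsub i by fastforce
  obtain G where G: "G \<in> FF" "G \<inter> ?X = ?X - {y}" "y \<notin> G" "?X - {y} \<subseteq> G"
    "0 \<in> G \<longrightarrow> (\<forall>v\<in>?X - {y}. \<forall>w\<in>?X - {y}. G \<inter> {v..w} \<subseteq> ?X - {y})"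
    using simplex_nbr[OF XF X0 insertI1] .
  have Xy: "?X - {y} = B - {i + L}" using y by auto
  have BG: "B - {i + L} \<subseteq> G" using G(4) Xy by simp
  \<comment> \<open>If \<open>i + L\<close> were a gap, \<open>G\<close> and \<open>B\<close> would
    agree between \<open>y\<close> and \<open>i + L\<close>. The number of indices there is odd:
    \<open>B\<close> has \<open>d - 1\<close> elements below \<open>i + L\<close> and evenly many
    below \<open>y\<close>.\<close>
  have top: "i + L \<in> G"
  proof (rule ccontr)
    assume nG: "i + L \<notin> G"
    have "G \<inter> {y..<i + L} = B \<inter> {y..<i + L}"
    proof (rule set_eqI)
      fix z
      have "z = y \<or> z < y \<or> y < z" by auto
      then show "z \<in> G \<inter> {y..<i + L} \<longleftrightarrow> z \<in> B \<inter> {y..<i + L}"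
        using above[of z] BG G(3) y by auto
    qed
    then have "pos G (i + L) - pos G y = pos B (i + L) - pos B y"
      using pos_split[of y "i + L" G] pos_split[of y "i + L" B] y by simp
    moreover have "pos G y \<le> pos G (i + L)" "pos B y \<le> pos B (i + L)" using y by (auto intro: pos_mono)
    moreover have "even (pos G y) = even (pos G (i + L))" using gale[OF G(1) _ _ G(3) nG] i y by simp
    moreover have "even (pos B y)" using paired_even[OF B(1) y(1)] .
    ultimately show False using odd by presburger
  qed
  have iG: "i \<in> G" using BG True dL d6 by auto
  have "0 \<in> G"
  proof (rule ccontr)
    assume "0 \<notin> G"
    from short[OF G(1) this iG top] show False by simp
  qed
  moreover have "i \<in> B - {i + L}" "i + L - 1 \<in> B - {i + L}" using True pred dL d6 by auto
  ultimately have "G \<inter> {i..i + L - 1} \<subseteq> B - {i + L}" using G(5) Xy by metis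
  then have "G \<inter> {i..i + L} = B"
  proof -
    have "{i..i + L} = insert (i + L) {i..i + L - 1}" using dL d6 by auto
    then show ?thesis using \<open>G \<inter> {i..i + L - 1} \<subseteq> B - {i + L}\<close> top True BG B(3) by auto
  qed
  then show ?thesis using G(1) \<open>0 \<in> G\<close> by blast
qed

text \<open>Now 0 is exchanged for the lowest gap \<open>y\<close> and returns by parity, but the
  consecutive ridge says nothing about indices between \<open>Max B\<close> and \<open>L\<close>. An
  extra vertex there must be excluded or circumvented: in each case a facet properly inside another
  one appears.\<close>

lemma window_facet_zero:
  assumes B: "paired B" "card B = d" "B \<subseteq> {0..L}" and L: "L < n"
  shows "\<exists>G\<in>FF. G \<inter> {0..L} = B"
proof (cases "0 \<in> B")
  case False
  then have B1: "B \<subseteq> {1..L}" using B(3) by (auto simp: subset_iff Suc_le_eq) (metis gr0I)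
  have "B \<in> FF"
    using all_window[OF B(1,2), of 1] B1 L by fastforce
  then show ?thesis using B(3) by blast
next
  case True
  have f: "finite B" by (rule paired_finite[OF B(1)])
  have ne: "B \<noteq> {}" using True by auto
  have one: "1 \<in> B" using paired_Suc[OF B(1) True] by simp
  have "\<exists>y\<le>d. y \<notin> B"
  proof (rule ccontr)
    assume "\<not> (\<exists>y\<le>d. y \<notin> B)"
    then have "{..d} \<subseteq> B" by auto
    then have "card {..d} \<le> card B" using f by (intro card_mono)
    then show False using B(2) by simp
  qed
  then have ex: "\<exists>y. y \<notin> B" by blast
  define y where "y = (LEAST y. y \<notin> B)"
  have y: "y \<notin> B" unfolding y_def using LeastI_ex[OF ex] .
  have below: "z \<in> B" if "z < y" for z using not_less_Least that unfolding y_def by blast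
  have yd: "y \<le> d" using \<open>\<exists>y\<le>d. y \<notin> B\<close> unfolding y_def by (meson Least_le le_trans)
  have y2: "2 \<le> y" using True one y by (metis One_nat_def Suc_1 Suc_leI le_neq_implies_less not_less_eq_eq less_2_cases_iff not_le)
  have "B \<inter> {..<y} = {..<y}" using below by auto
  then have posy: "pos B y = y" by (simp add: pos_def)
  then have ey: "even y" using paired_even[OF B(1) y] by simp
  let ?X = "insert y (B - {0})"
  have e: "pos ?X z + (if 0 < z then 1 else 0) = pos B z + (if y < z then 1 else 0)" for z
    using f y True pos_insert[of "B - {0}" y z] pos_remove[of B 0 z] by simp
  have pX: "paired ?X" unfolding paired_def
  proof (intro conjI allI impI)
    fix z assume z: "z \<notin> ?X"
    show "even (pos ?X z)"
    proof (cases "z = 0")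
      case False
      then have "z \<notin> B" "z \<noteq> y" using z by auto
      moreover from this have "y < z" using below[of z] by fastforce
      ultimately show ?thesis using e[of z] paired_even[OF B(1), of z] by auto
    qed simp
  qed (use f in simp)
  have "card ?X = Suc (card (B - {0}))" using f y by simp
  then have cX: "card ?X = d" using f True B(2) d6 by simp
  have Xsub: "?X \<subseteq> {1..L}" using B(3) y2 yd dL by (auto simp: Suc_le_eq)
  have XF: "?X \<in> FF"
    using all_window[OF pX cX, of 1] Xsub L by fastforce
  have X0: "0 \<notin> ?X" using Xsub by fastforce
  obtain G where G: "G \<in> FF" "G \<inter> ?X = ?X - {y}" "y \<notin> G" "?X - {y} \<subseteq> G"
    "0 \<in> G \<longrightarrow> (\<forall>v\<in>?X - {y}. \<forall>w\<in>?X - {y}. G \<inter> {v..w} \<subseteq> ?X - {y})"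
    using simplex_nbr[OF XF X0 insertI1] .
  have Xy: "?X - {y} = B - {0}" using y by auto
  have BG: "B - {0} \<subseteq> G" using G(4) Xy by simp
  have yn: "y \<le> n" using yd dL L by simp
  have "0 \<in> G"
  proof (rule ccontr)
    assume nG: "0 \<notin> G"
    have "G \<inter> {..<y} = {1..<y}" 
    proof
      show "G \<inter> {..<y} \<subseteq> {1..<y}" using nG by (auto simp: Suc_le_eq) (metis gr0I)
      show "{1..<y} \<subseteq> G \<inter> {..<y}" using BG below by auto
    qed
    then have "pos G y = y - 1" by (simp add: pos_def)
    moreover have "even (pos G y)" by (rule gale_zero[OF G(1) nG yn G(3)])
    ultimately show False using ey y2 by simp
  qed
  then have BG': "B \<subseteq> G" using BG by auto
  have gap_even: "even (pos G z)" if "z \<le> n" "z \<notin> G" for z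
  proof -
    have "G \<inter> {..<y} = {..<y}" using BG' below by auto
    then have "pos G y = y" by (simp add: pos_def)
    then show ?thesis using gale[OF G(1) yn that(1) G(3) that(2)] ey by simp
  qed
  have hi: "Max B \<in> B" "Max B \<noteq> 0" using paired_Max[OF B(1) ne] by auto
  have "1 \<in> B - {0}" "Max B \<in> B - {0}" using one hi by auto
  then have "G \<inter> {1..Max B} \<subseteq> B - {0}" using G(5) Xy \<open>0 \<in> G\<close> by metis
  then have low: "z \<in> B" if "z \<in> G" "z \<le> Max B" for z
    using that True by (cases "z = 0") (auto simp: subset_iff Suc_le_eq)
  show ?thesis
  proof (cases "G \<inter> {0..L} = B")
    case True then show ?thesis using G(1) by blast
  next
    case False
    let ?V = "G \<inter> {0..L} - B"
    have "?V \<noteq> {}" using False BG' B(3) by auto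
    define v where "v = Min ?V"
    have "v \<in> ?V" unfolding v_def using \<open>?V \<noteq> {}\<close> by (intro Min_in) auto
    then have v: "v \<in> G" "v \<le> L" "v \<notin> B" by auto
    have hv: "Max B < v" using low[OF v(1)] v(3) by fastforce
    have Bv: "z < v" if "z \<in> B" for z using Max_ge[OF f that] hv by simp
    have "G \<inter> {..<v} = B"
    proof
      show "B \<subseteq> G \<inter> {..<v}" using BG' Bv by auto
      show "G \<inter> {..<v} \<subseteq> B"
      proof
        fix z assume z: "z \<in> G \<inter> {..<v}"
        show "z \<in> B"
        proof (rule ccontr)
          assume "z \<notin> B"
          then have "v \<le> z" unfolding v_def using z v(2) by (intro Min_le) auto
          then show False using z by simp
        qed
      qed
    qed
    then have posv: "pos G v = d" using B(2) by (simp add: pos_def)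
    have sv: "Suc v \<in> G"
    proof (rule ccontr)
      assume "Suc v \<notin> G"
      then have "even (pos G (Suc v))" using gap_even v L by simp
      then show False using posv v(1) even_d by (simp add: pos_Suc)
    qed
    \<comment> \<open>For \<open>v < L\<close> the pair \<open>{0, 1}\<close> can be traded for
      \<open>{v, Suc v}\<close>, which gives a facet without 0 inside \<open>G\<close>.\<close>
    have vL: "v = L"
    proof (rule ccontr)
      assume "v \<noteq> L"
      let ?Y = "(B - {0, 1}) \<union> {v..Suc v}"
      have d1: "(B - {0, 1}) \<inter> {v..Suc v} = {}" using Bv by fastforce
      have cY: "card ?Y = d"
        using card_Un_disjoint[OF _ _ d1] f B(2) True one d6 by (simp add: card_Diff_subset)
      have e1: "pos ?Y z = pos (B - {0, 1}) z + pos {v..Suc v} z" for z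
        using pos_Un[OF _ _ d1, of z] f by simp
      have e2: "pos B z = pos (B - {0, 1}) z + 2" if "2 \<le> z" for z
      proof -
        have "pos B z = pos (B - {0}) z + 1" using pos_remove[OF f True, of z] that by simp
        moreover have "pos (B - {0}) z = pos (B - {0} - {1}) z + 1"
          using pos_remove[of "B - {0}" 1 z] f one that by simp
        moreover have "B - {0} - {1} = B - {0, 1}" by auto
        ultimately show ?thesis by simp
      qed
      have pY: "paired ?Y" unfolding paired_def
      proof (intro conjI allI impI)
        fix z assume z: "z \<notin> ?Y"
        show "even (pos ?Y z)"
        proof (cases "2 \<le> z")
          case True
          then have zB: "z \<notin> B" using z by auto
          then have "even (pos (B - {0, 1}) z)" using e2[OF True] paired_even[OF B(1) zB] by simp
          moreover have "z \<le> v \<or> Suc (Suc v) \<le> z" using z by auto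
          then have "pos {v..Suc v} z = 0 \<or> pos {v..Suc v} z = 2" unfolding pos_interval by auto
          then have "even (pos {v..Suc v} z)" by auto
          ultimately show ?thesis using e1 by simp
        next
          case False
          have "?Y \<inter> {..<z} = {}" using False Bv[OF one] by (auto simp: not_le less_2_cases_iff)
          then show ?thesis by (simp add: pos_none)
        qed
      qed (use f in simp)
      have Ysub: "?Y \<subseteq> {2..L}"
        using B(3) v(2) \<open>v \<noteq> L\<close> Bv[OF one] by (auto simp: subset_iff)
      have "?Y \<in> FF"
        using all_window[OF pY cY, of 1] Ysub L by fastforce
      moreover have "?Y \<subseteq> G" using BG' v(1) sv by (auto simp: le_Suc_eq)
      moreover have "0 \<notin> ?Y" using Ysub by fastforce
      ultimately show False using not_subfacet[OF _ G(1)] \<open>0 \<in> G\<close> by blast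
    qed
    have fG: "finite G" by (rule facet_finite[OF G(1)])
    have pS: "pos G (Suc L) = Suc d" using posv v(1) vL by (simp add: pos_Suc)
    then have cG: "d + 1 \<le> card G" using pos_le_card[OF fG, of "Suc L"] by simp
    obtain x W H where x: "x \<in> G" "pos G x = 3" and W: "W = {y \<in> G. pos G y \<le> d} - {x}" "card W = d"
      and H: "H \<in> FF" "H \<inter> G = W" "ridge (d - 1) H W" using ridge_3[OF G(1) cG] .
    have "pos G 1 = 1" using \<open>0 \<in> G\<close> by (simp add: pos_Suc)
    then have W1: "1 \<in> W" "0 \<in> W" using W(1) x BG' one d6 \<open>0 \<in> G\<close> by auto
    have WL: "L \<in> W" using W(1) x v(1) posv d6 vL by auto
    have H1: "0 \<in> H" "1 \<in> H" using H(2) W1 by auto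
    \<comment> \<open>\<open>Suc L\<close> belongs to \<open>G\<close> but comes after position
      \<open>d\<close>, so it is outside the ridge and hence not in \<open>H\<close>. This gap fixes
      the parity of all gaps of \<open>H\<close>.\<close>
    have "Suc L \<notin> W" using W(1) pS by simp
    then have LH: "Suc L \<notin> H" using H(2) sv vL by blast
    have Wle: "u \<le> L" if "u \<in> W" for u
    proof -
      have "u \<in> G" "pos G u \<le> pos G v" using that W(1) posv by auto
      then show ?thesis using pos_le_iff[of u G v] v(1) vL by blast
    qed
    have p1: "0 < pos H 1" using H1 by (simp add: pos_Suc)
    have rng: "1 \<le> u \<and> u \<le> L" if "u \<in> W" "0 < pos H u" for u
      using Wle[OF that(1)] that(2) by (cases u) auto
    have cW: "d \<le> card W" using W(2) by simp
    obtain x' where x': "x' \<in> H" "x' \<notin> W" "W = ridge_E (d - 1) H x'" "1 < x'" "x' < L"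
      "H \<inter> {1..L} = insert x' (W \<inter> {1..L})" "pos H x' \<noteq> 2"
      using inner_extra[OF H(1,3) cW W1(1) WL p1 rng] .
    have "W = insert 0 (W \<inter> {1..L})" using W1 Wle by (auto simp: Suc_le_eq)
    then have "d = Suc (card (W \<inter> {1..L}))" using W(2)
      by (metis atLeastAtMost_iff card_insert_disjoint finite_Int finite_atLeastAtMost Int_iff not_one_le_zero)
    then have cY: "card (H \<inter> {1..L}) = d" using x'(2,6) by simp
    have H0: "pos H z = Suc (pos (H \<inter> {1..L}) z)" if "1 \<le> z" "z \<le> Suc L" for z
    proof -
      have "H \<inter> {..<z} = insert 0 (H \<inter> {1..L} \<inter> {..<z})" using that H1 by (auto simp: Suc_le_eq)
      then show ?thesis by (simp add: pos_def)
    qed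
    have "pos (H \<inter> {1..L}) (Suc L) = d" using cY by (subst pos_all) auto
    then have oddL: "odd (pos H (Suc L))" using H0[of "Suc L"] even_d by simp
    \<comment> \<open>Gaps of \<open>H\<close> up to \<open>n\<close> have odd counts, like
      \<open>Suc L\<close>. Without 0 the counts are even, so the trace on \<open>{1..L}\<close> is
      itself a facet, properly inside \<open>H\<close>.\<close>
    have pY: "paired (H \<inter> {1..L})" unfolding paired_def
    proof (intro conjI allI impI)
      fix z assume z: "z \<notin> H \<inter> {1..L}"
      consider "z = 0" | "1 \<le> z" "z \<le> L" | "L < z" by linarith
      then show "even (pos (H \<inter> {1..L}) z)"
      proof cases
        case 2
        then have "odd (pos H z)" using gale[OF H(1) _ _ _ LH, of z] z oddL L by auto
        then show ?thesis using H0[of z] 2 by simp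
      next
        case 3
        then show ?thesis using cY even_d by (subst pos_all) auto
      qed simp
    qed simp
    have s: "H \<inter> {1..L} \<subseteq> {1..<1 + L}" "H \<inter> {1..L} \<subseteq> {..n}" using L by auto
    have "H \<inter> {1..L} \<in> FF" by (rule all_window[OF pY cY s(1) order_refl s(2)])
    then have False by (rule not_subfacet[OF _ H(1) _ H1(1)]) auto
    then show ?thesis ..
  qed
qed

section \<open>Windows of \<open>L + 2\<close> indices\<close>

lemma two_blocks:
  assumes "i + d \<le> j + 2"
  shows "paired ({i..<i + (d - 2)} \<union> {j..Suc j})" "card ({i..<i + (d - 2)} \<union> {j..Suc j}) = d"
proof -
  let ?B = "{i..<i + (d - 2)} \<union> {j..Suc j}"
  have dis: "{i..<i + (d - 2)} \<inter> {j..Suc j} = {}" using assms d6 by auto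
  show "card ?B = d" using card_Un_disjoint[OF _ _ dis] d6 by simp
  show "paired ?B" unfolding paired_def
  proof (intro conjI allI impI)
    fix z assume z: "z \<notin> ?B"
    have e: "pos ?B z = (min z (i + (d - 2)) - i) + (min z (Suc (Suc j)) - j)"
      using pos_Un[OF _ _ dis, of z] unfolding pos_interval pos_interval_less by simp
    have "z < i \<or> i + (d - 2) \<le> z \<and> z < j \<or> Suc (Suc j) \<le> z" using z by auto
    then have "pos ?B z = 0 \<or> pos ?B z = d - 2 \<or> pos ?B z = d"
      using e assms d6 by (elim disjE) auto
    then show "even (pos ?B z)" using even_d d6 by auto
  qed simp
qed

text \<open>The chosen set uses both ends of the window \<open>{1..1 + L}\<close>, so its facet
  contains 0, which serves as the additional vertex.\<close>

lemma long_window_zero: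
  assumes "L < n" shows "\<exists>G\<in>FF. d + 1 \<le> card (G \<inter> {0..L + 1})"
proof -
  let ?B = "{1..<1 + (d - 2)} \<union> {L..Suc L}"
  have B: "paired ?B" "card ?B = d" using two_blocks[of 1 L] dL by auto
  have "?B \<subseteq> {1..1 + L}" using dL d6 by auto
  then obtain G where G: "G \<in> FF" "G \<inter> {1..1 + L} = ?B" "1 \<in> ?B \<and> 1 + L \<in> ?B \<longrightarrow> 0 \<in> G"
    using window_facet_pos[OF B, of 1] assms by auto
  then have "0 \<in> G" using d6 by auto
  then have "insert 0 ?B \<subseteq> G \<inter> {0..L + 1}" using G(2) by fastforce
  then have "card (insert 0 ?B) \<le> card (G \<inter> {0..L + 1})" by (intro card_mono) auto
  then have "d + 1 \<le> card (G \<inter> {0..L + 1})" using B(2) dL d6 by simp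
  then show ?thesis using G(1) by blast
qed

text \<open>If the last index of the window is a gap of \<open>G\<close>, cross the ridge omitting
  the last vertex \<open>x\<close> of the long block; it has at least \<open>d\<close> vertices. The
  extra vertex \<open>x'\<close> of \<open>H\<close> is squeezed between \<open>x\<close> and
  \<open>j\<close>, so three vertices follow the gap \<open>x\<close> and parity puts
  \<open>Suc (Suc j)\<close> into \<open>H\<close>. Its absence from the ridge would require
  \<open>d - 3 >= 3\<close> ridge vertices between it and \<open>x'\<close>, but only
  \<open>j\<close> and \<open>Suc j\<close> are there.\<close>

lemma long_window_pos:
  assumes i: "1 \<le> i" "i + L + 1 \<le> n"
  shows "\<exists>G\<in>FF. d + 1 \<le> card (G \<inter> {i..i + L + 1})"
proof -
  define j where "j = i + L - 1"
  have ij: "i + L = Suc j" "i + d \<le> Suc j" using dL d6 by (auto simp: j_def)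
  let ?B = "{i..<i + (d - 2)} \<union> {j..Suc j}"
  have B: "paired ?B" "card ?B = d" using two_blocks[of i j] ij by auto
  have Bs: "?B \<subseteq> {i..i + L}" using ij d6 by auto
  obtain G where G: "G \<in> FF" "G \<inter> {i..i + L} = ?B" "i \<in> ?B \<and> i + L \<in> ?B \<longrightarrow> 0 \<in> G"
    using window_facet_pos[OF B Bs] i by auto
  have G0: "0 \<in> G" using G(3) d6 ij by auto
  have fG: "finite G" by (rule facet_finite[OF G(1)])
  have mem: "z \<in> G \<longleftrightarrow> z \<in> ?B" if "i \<le> z" "z \<le> Suc j" for z
  proof -
    have "z \<in> {i..i + L}" using that ij by simp
    then show ?thesis using G(2) by blast
  qed
  show ?thesis
  proof (cases "Suc (Suc j) \<in> G")
    case True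
    have "insert (Suc (Suc j)) ?B \<subseteq> G \<inter> {i..i + L + 1}" using G(2) True ij by fastforce
    then have "card (insert (Suc (Suc j)) ?B) \<le> card (G \<inter> {i..i + L + 1})" by (intro card_mono) auto
    moreover have "Suc (Suc j) \<notin> ?B" using ij d6 by auto
    ultimately have "d + 1 \<le> card (G \<inter> {i..i + L + 1})" using B(2) by simp
    then show ?thesis using G(1) by blast
  next
    case False
    define x where "x = i + (d - 3)"
    have xj: "x < j" "i < x" using ij d6 by (auto simp: x_def)
    have pz: "pos G z = pos G i + (z - i)" if "i \<le> z" "z \<le> Suc x" for z
    proof -
      have "G \<inter> {i..<z} = {i..<z}" using that xj d6 mem by (auto simp: x_def)
      then show ?thesis using pos_split[OF that(1), of G] by simp
    qed
    have xG: "x \<in> G" using mem[of x] xj d6 by (auto simp: x_def)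
    have jG: "j \<in> G" "Suc j \<in> G" using mem[of j] mem[of "Suc j"] xj by auto
    have iG: "i \<in> G" using mem[of i] xj d6 by auto
    have pi1: "1 \<le> pos G i" using pos_less[OF G0, of i] i by simp
    have px: "pos G x = pos G i + (d - 3)" using pz[of x] xj by (simp add: x_def)
    have pj: "pos G j = pos G x + 1"
    proof -
      have "G \<inter> {Suc x..<j} = {}" using mem xj d6 by (auto simp: x_def)
      then have "pos G j = pos G (Suc x)" using pos_split[of "Suc x" j G] xj by simp
      then show ?thesis using xG by (simp add: pos_Suc)
    qed
    have psj: "pos G (Suc j) = pos G x + 2" using pj jG by (simp add: pos_Suc)
    define W where "W = ridge_E (d - 1) G x"
    have Wlow: "{i..<x} \<subseteq> W"
    proof
      fix z assume z: "z \<in> {i..<x}"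
      then have "z \<in> G" using mem[of z] xj by (auto simp: x_def)
      then show "z \<in> W" using z pz[of z] px d6 by (auto simp: W_def ridge_E_def x_def)
    qed
    have Whi: "j \<in> W" "Suc j \<in> W" using jG pj psj xj d6 by (auto simp: W_def ridge_E_def)
    have W0: "0 \<in> W" using G0 xj by (auto simp: W_def ridge_E_def)
    have WG: "W \<subseteq> G" by (auto simp: W_def ridge_E_def)
    have fW: "finite W" using WG fG finite_subset by blast
    have xW: "x \<notin> W" by (simp add: W_def ridge_E_def)
    have Wge: "i \<le> u" if "u \<in> W" "u \<noteq> 0" for u
    proof (rule ccontr)
      assume "\<not> i \<le> u"
      then have "pos G u < pos G i" using pos_less[of u G i] that WG by auto
      moreover have "0 < pos G u" using pos_less[OF G0, of u] that by simp
      ultimately show False using that(1) px d6 by (auto simp: W_def ridge_E_def)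
    qed
    have "insert 0 ({i..<x} \<union> {j, Suc j}) \<subseteq> W" using W0 Wlow Whi by auto
    then have "card (insert 0 ({i..<x} \<union> {j, Suc j})) \<le> card W" using fW by (intro card_mono)
    moreover have "card ({i..<x} \<union> {j, Suc j}) = (d - 3) + 2"
      using xj by (subst card_Un_disjoint) (auto simp: x_def)
    moreover have "0 \<notin> {i..<x} \<union> {j, Suc j}" using i xj by auto
    ultimately have cW: "d \<le> card W" using d6 by simp
    have "pos G x + 1 < card G" using pos_less_card[OF fG jG(2)] psj by simp
    moreover have "2 \<le> pos G x" using px pi1 d6 by simp
    ultimately have "ridge (d - 1) G W" using xG unfolding ridge_def W_def by blast
    then obtain H where H: "H \<in> FF" "H \<inter> G = W" "ridge (d - 1) H W" using nbr[OF G(1)] by blast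
    have fH: "finite H" by (rule facet_finite[OF H(1)])
    have WH: "W \<subseteq> H" using H(2) by auto
    define w where "w = Max W"
    have wW: "w \<in> W" unfolding w_def using fW W0 by (intro Max_in) auto
    have Wle: "u \<le> w" if "u \<in> W" for u unfolding w_def using fW that by simp
    have iW: "i \<in> W" using Wlow xj by auto
    have pHi: "0 < pos H i" using pos_less[of 0 H i] W0 WH i by auto
    have rng: "i \<le> u \<and> u \<le> w" if "u \<in> W" "0 < pos H u" for u
    proof -
      have "u \<noteq> 0" using that(2) by (metis pos_0 less_irrefl)
      then show ?thesis using Wge that(1) Wle by blast
    qed
    obtain x' where x': "x' \<in> H" "x' \<notin> W" "W = ridge_E (d - 1) H x'" "i < x'" "x' < w"
      "H \<inter> {i..w} = insert x' (W \<inter> {i..w})" "pos H x' \<noteq> 2"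
      using inner_extra[OF H(1,3) cW iW wW pHi rng] .
    have xH: "x \<notin> H" using xG xW H(2) by auto
    have x'gt: "x < x'"
    proof (rule ccontr)
      assume "\<not> x < x'"
      then have "x' \<in> {i..<x} \<or> x' = x" using x'(4) by auto
      then show False using Wlow x'(1,2) xH by auto
    qed
    \<comment> \<open>Otherwise \<open>d - 2\<close> ridge vertices of positive position would lie
      to the left of \<open>x'\<close>, one more than the reach \<open>d - 3\<close>
      permits.\<close>
    have x'lt: "x' < j"
    proof (rule ccontr)
      assume "\<not> x' < j"
      then have "j < x'" using x'(2) Whi by (cases "x' = j") auto
      have "insert j {i..<x} \<subseteq> {y \<in> ridge_E (d - 1) H x'. y < x' \<and> 0 < pos H y}"
      proof
        fix y assume y: "y \<in> insert j {i..<x}"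
        then have "y \<in> W" "i \<le> y" "y < x'" using Whi Wlow xj \<open>j < x'\<close> by auto
        moreover have "0 < pos H y" using pos_mono[OF \<open>i \<le> y\<close>, of H] pHi by simp
        ultimately show "y \<in> {y \<in> ridge_E (d - 1) H x'. y < x' \<and> 0 < pos H y}" using x'(3) by simp
      qed
      then have "card (insert j {i..<x}) \<le> card {y \<in> ridge_E (d - 1) H x'. y < x' \<and> 0 < pos H y}"
        using fW x'(3) by (intro card_mono) auto
      then have "card (insert j {i..<x}) \<le> d - 1 - 2"
        using ridge_E_left_card[OF fH x'(1), of "d - 1"] by simp
      then show False using xj d6 by (simp add: x_def)
    qed
    have Wmid: "u = j \<or> u = Suc j" if "u \<in> W" "x \<le> u" "u \<le> Suc j" for u
    proof -
      have "u \<noteq> x" using that(1) xW by auto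
      moreover have "u \<in> ?B" using mem[of u] that WG xj by auto
      ultimately show ?thesis using that by (auto simp: x_def)
    qed
    have jw: "Suc j \<le> w" using Wle Whi by auto
    have "H \<inter> {x..<Suc (Suc j)} = {x', j, Suc j}"
    proof
      show "{x', j, Suc j} \<subseteq> H \<inter> {x..<Suc (Suc j)}" using x'(1) x'gt x'lt Whi WH xj by auto
      show "H \<inter> {x..<Suc (Suc j)} \<subseteq> {x', j, Suc j}"
      proof
        fix u assume u: "u \<in> H \<inter> {x..<Suc (Suc j)}"
        then have "u \<in> H \<inter> {i..w}" using xj jw by auto
        then have "u \<in> insert x' (W \<inter> {i..w})" using x'(6) by simp
        then show "u \<in> {x', j, Suc j}" using Wmid[of u] u by auto
      qed
    qed
    then have "pos H (Suc (Suc j)) = pos H x + 3"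
      using pos_split[of x "Suc (Suc j)" H] xj x'lt by simp
    then have sH: "Suc (Suc j) \<in> H"
      using gale[OF H(1), of x "Suc (Suc j)"] xH i ij xj by fastforce
    have sW: "Suc (Suc j) \<notin> W" using False WG by auto
    have "ridge_E (d - 1) H x' \<inter> {x'<..<Suc (Suc j)} \<subseteq> {j, Suc j}"
    proof
      fix u assume u: "u \<in> ridge_E (d - 1) H x' \<inter> {x'<..<Suc (Suc j)}"
      then have "u \<in> W" "x \<le> u" "u \<le> Suc j" using x'(3) x'gt by auto
      then show "u \<in> {j, Suc j}" using Wmid by blast
    qed
    then have "card (ridge_E (d - 1) H x' \<inter> {x'<..<Suc (Suc j)}) \<le> card {j, Suc j}"
      by (intro card_mono) auto
    moreover have "d - 1 - 2 \<le> card (ridge_E (d - 1) H x' \<inter> {x'<..<Suc (Suc j)})"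
    proof (rule ridge_E_high[OF fH x'(1) sH])
      show "Suc (Suc j) \<notin> ridge_E (d - 1) H x'" using sW x'(3) by simp
    qed (use x'lt in simp)
    ultimately show ?thesis using d6 by simp
  qed
qed

lemma long_window:
  assumes "i + L + 1 \<le> n"
  shows "\<exists>G\<in>FF. d + 1 \<le> card (G \<inter> {i..i + L + 1})"
  using long_window_zero long_window_pos[of i] assms by (cases "i = 0") auto

section \<open>The case \<open>L = n\<close>: all facets are simplices\<close>

lemma slice_facet_aux:
  assumes H: "H \<in> FF" and a: "1 \<le> a" "a + d \<le> card H"
    and gap: "\<And>z. z \<le> n \<Longrightarrow> z \<notin> H \<Longrightarrow> even (min (pos H z) (a + d) - a)"
  shows "paired {y \<in> H. a \<le> pos H y \<and> pos H y < a + d}"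
    "card {y \<in> H. a \<le> pos H y \<and> pos H y < a + d} = d"
proof -
  have f: "finite H" by (rule facet_finite[OF H])
  let ?Y = "{y \<in> H. a \<le> pos H y \<and> pos H y < a + d}"
  show "card ?Y = d" using card_pos_between[OF f a(2), of a] by simp
  show "paired ?Y" unfolding paired_def
  proof (intro conjI allI impI)
    fix z assume z: "z \<notin> ?Y"
    have e: "pos ?Y z = min (pos H z) (a + d) - a" by (rule pos_slice[OF f a(2)])
    consider "z \<in> H" | "z \<notin> H" "z \<le> n" | "n < z" by linarith
    then show "even (pos ?Y z)"
    proof cases
      case 1
      then have "pos H z < a \<or> a + d \<le> pos H z" using z by auto
      then show ?thesis using e even_d by auto
    next
      case 2 then show ?thesis using e gap by simp
    next
      case 3
      then have "pos H z = card H" using facet_sub[OF H] by (intro pos_all) auto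
      then show ?thesis using e a even_d by simp
    qed
  qed (use f in simp)
qed

text \<open>For \<open>L = n\<close> every paired set of \<open>d\<close> positive indices is a
  facet, so \<open>H\<close> contains none. If gap counts were odd, positions 1 to \<open>d\<close>
  would form one; with even counts, positions 2 to \<open>d + 1\<close> would, as soon as
  \<open>H\<close> has \<open>d + 2\<close> vertices.\<close>

lemma full_hull_big:
  assumes L: "L = n" and H: "H \<in> FF" "0 \<in> H" "d + 1 \<le> card H"
  shows "(\<forall>z\<le>n. z \<notin> H \<longrightarrow> even (pos H z)) \<and> card H = d + 1 \<and> 1 \<in> H \<and> n \<in> H"
proof -
  have f: "finite H" by (rule facet_finite[OF H(1)])
  have no: False if Y: "paired Y" "card Y = d" "Y \<subseteq> H" "0 \<notin> Y" for Y
  proof -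
    have "Y \<subseteq> {..n}" using Y(3) facet_sub[OF H(1)] by auto
    then have "Y \<subseteq> {1..<1 + L}" using Y(4) L by (auto simp: Suc_le_eq less_Suc_eq_le subset_iff) (metis gr0I)
    then have "Y \<in> FF" by (rule all_window[OF Y(1,2) _ order_refl \<open>Y \<subseteq> {..n}\<close>])
    then show False using not_subfacet[OF _ H(1) Y(3) H(2) Y(4)] by simp
  qed
  have ev: "even (pos H z)" if z: "z \<le> n" "z \<notin> H" for z
  proof (rule ccontr)
    assume o: "odd (pos H z)"
    have "even (min (pos H y) (1 + d) - 1)" if "y \<le> n" "y \<notin> H" for y
      using gale[OF H(1) z(1) that(1) z(2) that(2)] o even_d by (auto simp: min_def)
    from slice_facet_aux[OF H(1) _ _ this] H(3)
    show False by (intro no[of "{y \<in> H. 1 \<le> pos H y \<and> pos H y < 1 + d}"]) auto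
  qed
  have c: "card H = d + 1"
  proof (rule ccontr)
    assume "card H \<noteq> d + 1"
    then have c: "2 + d \<le> card H" using H(3) by simp
    have "even (min (pos H y) (2 + d) - 2)" if "y \<le> n" "y \<notin> H" for y
      using ev[OF that] even_d by (auto simp: min_def)
    from slice_facet_aux[OF H(1) _ c this]
    show False by (intro no[of "{y \<in> H. 2 \<le> pos H y \<and> pos H y < 2 + d}"]) auto
  qed
  have "1 \<in> H"
  proof (rule ccontr)
    assume "1 \<notin> H"
    then have "even (pos H 1)" using ev dn by simp
    then show False using H(2) by (simp add: pos_Suc)
  qed
  moreover have "n \<in> H"
  proof (rule ccontr)
    assume "n \<notin> H"
    then have "even (pos H n)" using ev by simp
    moreover have "H \<subseteq> {..<n}" using facet_sub[OF H(1)] \<open>n \<notin> H\<close> by (auto simp: order_le_less)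
    ultimately show False using c even_d by (simp add: pos_all)
  qed
  ultimately show ?thesis using ev c by blast
qed

text \<open>\<open>G\<close> and its neighbour \<open>H\<close> across the ridge of
  \<open>ridge_3\<close> both have \<open>d + 1\<close> vertices and even gap counts. The gap
  \<open>x\<close> of \<open>H\<close> has three ridge vertices below it, so the extra vertex
  \<open>x'\<close> is below \<open>x\<close> too. It falls between 1 and \<open>z2\<close>, at
  position 2 of \<open>H\<close>, which is excluded.\<close>

lemma full_hull_simplicial:
  assumes L: "L = n" and G: "G \<in> FF" shows "card G = d"
proof (rule ccontr)
  assume "card G \<noteq> d"
  then have c: "d + 1 \<le> card G" and G0: "0 \<in> G" using facet_card[OF G] simplex_facet[OF G] by auto
  have fG: "finite G" by (rule facet_finite[OF G])
  have evG: "even (pos G z)" if "z \<le> n" "z \<notin> G" for z using full_hull_big[OF L G G0 c] that by blast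
  have cG: "card G = d + 1" and G1: "1 \<in> G" and Gn: "n \<in> G" using full_hull_big[OF L G G0 c] by auto
  obtain x W H where x: "x \<in> G" "pos G x = 3" and W: "W = {y \<in> G. pos G y \<le> d} - {x}" "card W = d"
    and H: "H \<in> FF" "H \<inter> G = W" "ridge (d - 1) H W" using ridge_3[OF G c] .
  have We: "W = G - {x}" using W(1) pos_less_card[OF fG] cG by fastforce
  have p1: "pos G 1 = 1" using G0 by (simp add: pos_Suc)
  have W01: "0 \<in> W" "1 \<in> W" using We G0 G1 x p1 by (auto simp: numeral_eq_Suc) 
  have "G \<inter> {..<n} = G - {n}" using facet_sub[OF G] by (auto simp: order_le_less)
  then have pn: "pos G n = d" using cG Gn by (simp add: pos_def)
  then have Wn: "n \<in> W" using We Gn x d6 by auto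
  have WH: "W \<subseteq> H" using H(2) by auto
  have H0: "0 \<in> H" using W01 WH by auto
  have cW: "d \<le> card W" using W(2) by simp
  have pH1: "0 < pos H 1" using H0 by (simp add: pos_Suc)
  have rng: "1 \<le> u \<and> u \<le> n" if "u \<in> W" "0 < pos H u" for u
    using that We facet_le[OF G, of u] by (cases u) auto
  obtain x' where x': "x' \<in> H" "x' \<notin> W" "W = ridge_E (d - 1) H x'" "1 < x'" "x' < n"
    "H \<inter> {1..n} = insert x' (W \<inter> {1..n})" "pos H x' \<noteq> 2"
    using inner_extra[OF H(1,3) cW W01(2) Wn pH1 rng] .
  have HW: "H = insert x' W"
  proof
    show "H \<subseteq> insert x' W"
    proof
      fix u assume u: "u \<in> H"
      show "u \<in> insert x' W"
      proof (cases u)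
        case 0 then show ?thesis using W01 by simp
      next
        case (Suc m)
        then have "u \<in> H \<inter> {1..n}" using u facet_le[OF H(1) u] by simp
        then have "u \<in> insert x' (W \<inter> {1..n})" by (simp only: x'(6))
        then show ?thesis by blast
      qed
    qed
    show "insert x' W \<subseteq> H" using x'(1) WH by auto
  qed
  have fW: "finite W" using We fG by simp
  have "card H = d + 1" using HW x'(2) fW W(2) by simp
  then have evH: "even (pos H z)" if "z \<le> n" "z \<notin> H" for z using full_hull_big[OF L H(1) H0] that by simp
  have xH: "x \<notin> H" using H(2) x(1) We by auto
  obtain z2 where z2: "z2 \<in> G" "pos G z2 = 2" using pos_surj[OF fG, of 2] cG d6 by auto
  have "z2 < x" using pos_less_iff[OF z2(1) x(1)] z2 x by simp
  have xn: "x \<le> n" by (rule facet_le[OF G x(1)])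
  have ps: "pos G (Suc z2) = 3" using z2 by (simp add: pos_Suc)
  then have "Suc z2 \<in> G" using evG[of "Suc z2"] \<open>z2 < x\<close> xn by auto
  then have xs: "x = Suc z2" using inj_pos[of G] x ps by (metis inj_onD)
  have z2W: "z2 \<in> W" using We z2 \<open>z2 < x\<close> by auto
  have "W \<inter> {..<x} = G \<inter> {..<x}" using We by auto
  then have "pos W x = 3" using x by (simp add: pos_def)
  then have "pos H x = 3 + (if x' < x then 1 else 0)" unfolding HW using pos_insert[OF fW x'(2)] by simp
  then have "x' < x" using evH[OF xn xH] by (auto split: if_splits)
  then have "x' < z2" using xs z2W x'(2) by (cases "x' = z2") auto
  have "G \<inter> {..<z2} = {0, 1}"
  proof (rule sym, rule card_subset_eq)
    show "card {0, 1 :: nat} = card (G \<inter> {..<z2})" using z2(2) by (simp add: pos_def)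
    have "1 < z2" using pos_less_iff[OF G1 z2(1)] p1 z2(2) by simp
    then show "{0, 1} \<subseteq> G \<inter> {..<z2}" using G0 G1 by auto
  qed simp
  then have low: "u = 0 \<or> u = 1" if "u \<in> G" "u < z2" for u using that by blast
  have "H \<inter> {..<x'} = {0, 1}"
  proof
    show "H \<inter> {..<x'} \<subseteq> {0, 1}"
    proof
      fix u assume u: "u \<in> H \<inter> {..<x'}"
      then have "u \<in> W" using HW by auto
      then have "u \<in> G" "u < z2" using We u \<open>x' < z2\<close> by auto
      then show "u \<in> {0, 1}" using low by blast
    qed
    show "{0, 1} \<subseteq> H \<inter> {..<x'}" using W01 WH x'(4) by auto
  qed
  then have "pos H x' = 2" by (simp add: pos_def)
  then show False using x'(7) by simp
qed

section \<open>Facets through the last vertex\<close>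

lemma block_paired: "paired {i..<i + d}"
  unfolding paired_def
proof (intro conjI allI impI)
  fix z assume z: "z \<notin> {i..<i + d}"
  have "pos {i..<i + d} z = min z (i + d) - i" by (rule pos_interval_less)
  moreover have "z < i \<or> i + d \<le> z" using z by auto
  ultimately show "even (pos {i..<i + d} z)" using even_d by auto
qed simp

lemma block_facet: "1 \<le> i \<Longrightarrow> i + d \<le> n + 1 \<Longrightarrow> {i..<i + d} \<in> FF"
  using all_window[OF block_paired, of i i] dL by fastforce

text \<open>The last \<open>d\<close> indices serve if \<open>j\<close> is among them. Otherwise the
  pair at \<open>j\<close> together with the last \<open>d - 2\<close> indices fits, because there
  are at most \<open>L\<close> indices from \<open>j\<close> to \<open>n\<close>.\<close>

lemma top_edge_facet:
  assumes j: "n + 1 \<le> j + L" "1 \<le> j" "j < n"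
  shows "\<exists>B\<in>FF. card B = d \<and> j \<in> B \<and> n \<in> B"
proof (cases "n + 1 \<le> j + d")
  case True
  have "{n + 1 - d..<n + 1 - d + d} \<in> FF" using dn by (intro block_facet) auto
  moreover have "j \<in> {n + 1 - d..<n + 1 - d + d}" "n \<in> {n + 1 - d..<n + 1 - d + d}" using True j dn d6 by auto
  ultimately show ?thesis by (metis card_atLeastLessThan diff_add_inverse)
next
  case False
  define i where "i = n + 3 - d"
  have ij: "Suc (Suc j) \<le> i" "i + (d - 2) = n + 1" using False dn d6 by (auto simp: i_def)
  let ?B = "{j..Suc j} \<union> {i..<i + (d - 2)}"
  have dis: "{j..Suc j} \<inter> {i..<i + (d - 2)} = {}" using ij by auto
  have cB: "card ?B = d" using card_Un_disjoint[OF _ _ dis] d6 by simp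
  have pB: "paired ?B" unfolding paired_def
  proof (intro conjI allI impI)
    fix z assume z: "z \<notin> ?B"
    have e: "pos ?B z = (min z (Suc (Suc j)) - j) + (min z (i + (d - 2)) - i)"
      using pos_Un[OF _ _ dis, of z] unfolding pos_interval pos_interval_less by simp
    have "z < j \<or> Suc (Suc j) \<le> z \<and> z < i \<or> i + (d - 2) \<le> z" using z by auto
    then have "pos ?B z = 0 \<or> pos ?B z = 2 \<or> pos ?B z = d"
      using e ij(1) d6 by (elim disjE) auto
    then show "even (pos ?B z)" using even_d by auto
  qed simp
  have "?B \<subseteq> {j..<j + L}" using ij j d6 by auto
  moreover have "?B \<subseteq> {..n}" using ij j by auto
  ultimately have "?B \<in> FF" using all_window[OF pB cB, of j] j(2) by simp
  moreover have "n \<in> ?B" "j \<in> ?B" using ij d6 by auto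
  ultimately show ?thesis using cB by blast
qed

text \<open>Remove \<open>n - 1\<close> from the last block. If the neighbour missed 0, it would
  have evenly many vertices below the gap \<open>n - 1\<close> and only \<open>n\<close> above,
  whereas facets without 0 have \<open>d\<close> vertices.\<close>

lemma zero_top_facet: "\<exists>G\<in>FF. 0 \<in> G \<and> n \<in> G"
proof -
  let ?B = "{n + 1 - d..<n + 1 - d + d}"
  have B: "?B \<in> FF" using dn by (intro block_facet) auto
  have B0: "0 \<notin> ?B" using dn by auto
  have b: "n - 1 \<in> ?B" "n \<in> ?B" using dn d6 by auto
  obtain G where G: "G \<in> FF" "G \<inter> ?B = ?B - {n - 1}" "n - 1 \<notin> G" "?B - {n - 1} \<subseteq> G"
    "0 \<in> G \<longrightarrow> (\<forall>v\<in>?B - {n - 1}. \<forall>w\<in>?B - {n - 1}. G \<inter> {v..w} \<subseteq> ?B - {n - 1})"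
    using simplex_nbr[OF B B0 b(1)] .
  have nG: "n \<in> G" using G(4) b dn by auto
  have "0 \<in> G"
  proof (rule ccontr)
    assume n0: "0 \<notin> G"
    have "even (pos G (n - 1))" using gale_zero[OF G(1) n0 _ G(3)] by simp
    then have "even (pos G n)" using pos_Suc[of G "n - 1"] G(3) dn by simp
    then have "odd (pos G (Suc n))" using nG by (simp add: pos_Suc)
    moreover have "pos G (Suc n) = card G" using facet_sub[OF G(1)] by (intro pos_all) auto
    ultimately show False using simplex_facet[OF G(1) n0] even_d by simp
  qed
  then show ?thesis using G(1) nG by blast
qed

lemma low_top_facet: "F \<in> FF \<Longrightarrow> j \<in> F \<Longrightarrow> n \<in> F \<Longrightarrow> j + L \<le> n \<Longrightarrow> 0 \<in> F"
  using short[of F j n] by fastforce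

end

section \<open>The case \<open>L = d\<close>: the facets form a braxtope\<close>

lemma pos_atMost: "y \<le> Suc m \<Longrightarrow> pos {..m} y = y"
proof -
  assume "y \<le> Suc m"
  then have "{..m} \<inter> {..<y} = {..<y}" by auto
  then show ?thesis by (simp add: pos_def)
qed

lemma ridge_atMost:
  "ridge e {..m} R \<longleftrightarrow> (\<exists>i. i + e \<le> m + 1 \<and> R = {i..<i + e}) \<or>
    R = {y. y \<le> m \<and> (y = 0 \<or> m + 1 \<le> y + (e - 1))} \<or>
    (\<exists>x. 2 \<le> x \<and> x < m \<and> R = {y. y \<le> m \<and> y \<noteq> x \<and> (y = 0 \<or> y \<le> x + (e - 2) \<and> x \<le> y + (e - 2))})"
proof -
  have T: "ridge_T e {..m} i = {i..<i + e}" if "i + e \<le> m + 1" for i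
  proof (rule set_eqI)
    fix y show "y \<in> ridge_T e {..m} i \<longleftrightarrow> y \<in> {i..<i + e}"
      using that pos_atMost[of y m] by (cases "y \<le> m") (auto simp: ridge_T_def)
  qed
  have L: "ridge_L e {..m} = {y. y \<le> m \<and> (y = 0 \<or> m + 1 \<le> y + (e - 1))}"
  proof (rule set_eqI)
    fix y show "y \<in> ridge_L e {..m} \<longleftrightarrow> y \<in> {y. y \<le> m \<and> (y = 0 \<or> m + 1 \<le> y + (e - 1))}"
      using pos_atMost[of y m] by (cases "y \<le> m") (auto simp: ridge_L_def)
  qed
  have E: "ridge_E e {..m} x = {y. y \<le> m \<and> y \<noteq> x \<and> (y = 0 \<or> y \<le> x + (e - 2) \<and> x \<le> y + (e - 2))}"
    if "x \<le> m" for x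
  proof (rule set_eqI)
    fix y
    show "y \<in> ridge_E e {..m} x \<longleftrightarrow>
        y \<in> {y. y \<le> m \<and> y \<noteq> x \<and> (y = 0 \<or> y \<le> x + (e - 2) \<and> x \<le> y + (e - 2))}"
      using that pos_atMost[of y m] pos_atMost[of x m] by (cases "y \<le> m") (auto simp: ridge_E_def)
  qed
  have keyT: "i + e \<le> card {..m} \<and> R = ridge_T e {..m} i \<longleftrightarrow> i + e \<le> m + 1 \<and> R = {i..<i + e}" for i
    by (cases "i + e \<le> m + 1") (simp_all add: T)
  have keyE: "x \<in> {..m} \<and> 2 \<le> pos {..m} x \<and> pos {..m} x + 1 < card {..m} \<and> R = ridge_E e {..m} x \<longleftrightarrow>
      2 \<le> x \<and> x < m \<and> R = {y. y \<le> m \<and> y \<noteq> x \<and> (y = 0 \<or> y \<le> x + (e - 2) \<and> x \<le> y + (e - 2))}" for x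
    by (cases "x \<le> m") (simp_all add: pos_atMost E)
  show ?thesis unfolding ridge_def Bex_def keyT keyE L by (rule refl)
qed

lemma ridge_atMost_T: "i + e \<le> m + 1 \<Longrightarrow> ridge e {..m} {i..<i + e}"
  unfolding ridge_atMost by (rule disjI1) (rule exI[of _ i], simp)

lemma ridge_atMost_L: "ridge e {..m} {y. y \<le> m \<and> (y = 0 \<or> m + 1 \<le> y + (e - 1))}"
  unfolding ridge_atMost by (rule disjI2) (rule disjI1, rule refl)

lemma ridge_atMost_E: "2 \<le> x \<Longrightarrow> x < m \<Longrightarrow>
    ridge e {..m} {y. y \<le> m \<and> y \<noteq> x \<and> (y = 0 \<or> y \<le> x + (e - 2) \<and> x \<le> y + (e - 2))}"
  unfolding ridge_atMost by (rule disjI2)+ (rule exI[of _ x], simp)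

locale braxial_short = braxial_hull +
  assumes Ld: "L = d"
begin

lemma interval_facet:
  assumes H: "H \<in> FF" "0 \<notin> H"
  shows "\<exists>h\<ge>1. H = {h..<h + d}"
proof -
  have f: "finite H" and c: "card H = d" using facet_finite simplex_facet H by auto
  have ne: "H \<noteq> {}" using c d6 by auto
  have m: "Min H \<in> H" using f ne by simp
  have "H \<subseteq> {Min H..<Min H + d}"
    using short[OF H m] f Ld by auto
  then have "H = {Min H..<Min H + d}" using c by (intro card_subset_eq) auto
  moreover have "1 \<le> Min H" using m H(2) by (metis One_nat_def Suc_leI gr0I)
  ultimately show ?thesis by blast
qed

lemma no_block: "G \<in> FF \<Longrightarrow> 0 \<in> G \<Longrightarrow> 1 \<le> i \<Longrightarrow> \<not> {i..<i + d} \<subseteq> G"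
proof
  assume G: "G \<in> FF" "0 \<in> G" and i: "1 \<le> i" and s: "{i..<i + d} \<subseteq> G"
  have "i + d - 1 \<in> G" using s d6 by auto
  then have "i + d \<le> n + 1" using facet_le[OF G(1)] by fastforce
  then have "{i..<i + d} \<in> FF" using block_facet i by blast
  then show False using not_subfacet[OF _ G(1) s G(2)] i by auto
qed

text \<open>If fewer vertices separate the gaps, some \<open>d - 1\<close> consecutive vertices of
  \<open>G\<close> without 0 span both; \<open>a\<close> and \<open>b\<close> guarantee vertices on
  either side. The facet across misses 0, so it is an interval of \<open>d\<close> indices, yet it
  would contain the ridge and both gaps.\<close>

lemma gaps_far:
  assumes G: "G \<in> FF" "0 \<in> G" and y: "y \<notin> G" "y' \<notin> G" "y < y'"
    and a: "a \<in> G" "0 < a" "a < y" and b: "b \<in> G" "y' < b"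
  shows "d - 2 \<le> card (G \<inter> {y<..<y'})"
proof (rule ccontr)
  assume "\<not> ?thesis"
  moreover have "{y<..<y'} = {Suc y..<y'}" by auto
  ultimately have c: "card (G \<inter> {Suc y..<y'}) \<le> d - 3" by simp
  note f = facet_finite[OF G(1)]
  let ?c = "card (G \<inter> {Suc y..<y'})"
  have py: "pos G y' = pos G y + ?c"
    using pos_split[of "Suc y" y' G] y by (simp add: pos_Suc)
  have "pos G 0 < pos G a" "pos G a < pos G y" using pos_less[OF G(2) a(2)] pos_less[OF a(1,3)] by auto
  then have p2: "2 \<le> pos G y" by simp
  have pb: "pos G y' \<le> pos G b" "pos G b < card G"
    using pos_mono[of y' b G] b pos_less_card[OF f b(1)] by auto
  \<comment> \<open>The run must start at a positive position, begin no later than the last vertex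
    before \<open>y\<close>, reach the first vertex after \<open>y'\<close>, and end inside
    \<open>G\<close>. This is the latest start allowed by the second and the last
    requirement.\<close>
  define s where "s = min (pos G y - 1) (card G - (d - 1))"
  have cG: "d \<le> card G" by (rule facet_card[OF G(1)])
  have s: "1 \<le> s" "s \<le> pos G y - 1" "pos G y' + 1 \<le> s + (d - 1)" "s + (d - 1) \<le> card G"
    using p2 py pb c cG d6 by (auto simp: s_def min_def)
  let ?R = "ridge_T (d - 1) G s"
  have "ridge (d - 1) G ?R" using s(4) by (auto simp: ridge_def)
  then obtain H where H: "H \<in> FF" "H \<inter> G = ?R" using nbr[OF G(1)] by blast
  have "0 \<notin> ?R" using s(1) by (simp add: ridge_T_def)
  then have "0 \<notin> H" using H(2) G(2) by blast
  then obtain h where h: "H = {h..<h + d}" using interval_facet[OF H(1)] by blast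
  have lt: "pos G y - 1 < card G" using pb py by simp
  obtain u where u: "u \<in> G" "pos G u = pos G y - 1" using pos_surj[OF f lt] .
  have lt': "pos G y' < card G" using pb by simp
  obtain v where v: "v \<in> G" "pos G v = pos G y'" using pos_surj[OF f lt'] .
  have uR: "u \<in> ?R" "v \<in> ?R" using u v s py p2 by (auto simp: ridge_T_def)
  have "u < y"
  proof (rule ccontr)
    assume "\<not> u < y"
    then have "pos G y \<le> pos G u" by (intro pos_mono) simp
    then show False using u p2 by simp
  qed
  moreover have "y' < v"
  proof (rule ccontr)
    assume "\<not> y' < v"
    then have "v < y'" using v(1) y(2) by (cases "v = y'") auto
    then show False using pos_less[OF v(1), of y'] v by simp
  qed
  moreover have "u \<in> H" "v \<in> H" using uR H(2) by auto
  ultimately have yH: "y \<in> H" "y' \<in> H" using h y(3) by auto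
  have "insert y (insert y' ?R) \<subseteq> H" using yH H(2) by auto
  then have "card (insert y (insert y' ?R)) \<le> card H" by (intro card_mono) (auto simp: h)
  moreover have "card ?R = d - 1" using card_pos_between[OF f s(4), of s] by (simp add: ridge_T_def)
  moreover have "finite ?R" "y \<notin> ?R" "y' \<notin> ?R" using y f by (auto simp: ridge_T_def)
  ultimately show False using y(3) h d6 by simp
qed

text \<open>Successive gaps enclose exactly \<open>d - 2\<close> vertices: at least that many by
  \<open>gaps_far\<close>, fewer than \<open>d\<close> by \<open>no_block\<close>, and evenly many.
  Crossing a ridge that omits a vertex \<open>x\<close> between them makes \<open>x\<close> a gap of
  the neighbour, too near to \<open>y\<close> and \<open>y'\<close> for these to remain gaps. Both
  would then be extra vertices inside the ridge, which admits only one.\<close>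

lemma one_gap:
  assumes G: "G \<in> FF" "0 \<in> G" and g: "g \<notin> G" "g' \<notin> G" "g < g'"
    and a: "a \<in> G" "0 < a" "a < g" and b: "b \<in> G" "g' < b"
  shows False
proof -
  define y where "y = g"
  have y: "y \<notin> G" "a < y" using g a by (auto simp: y_def)
  define y' where "y' = (LEAST z. y < z \<and> z \<notin> G)"
  have y'1: "y < y' \<and> y' \<notin> G" unfolding y'_def by (rule LeastI[of _ g']) (use g y_def in simp)
  have "y' \<le> g'" unfolding y'_def by (rule Least_le) (use g y_def in simp)
  then have y': "y < y'" "y' \<notin> G" "y' < b" using y'1 b by auto
  have mid: "z \<in> G" if "y < z" "z < y'" for z
    using not_less_Least[of z "\<lambda>z. y < z \<and> z \<notin> G"] that unfolding y'_def by blast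
  have bn: "b \<le> n" by (rule facet_le[OF G(1) b(1)])
  have "G \<inter> {y<..<y'} = {Suc y..<y'}" using mid by auto
  then have "d - 2 \<le> y' - Suc y"
    using gaps_far[OF G y(1) y'(2,1) a(1,2) y(2) b(1) y'(3)] by simp
  moreover have "y' - Suc y < d"
  proof (rule ccontr)
    assume "\<not> ?thesis"
    then have "{Suc y..<Suc y + d} \<subseteq> G" using mid by auto
    then show False using no_block[OF G, of "Suc y"] by simp
  qed
  moreover have "even (y' - Suc y)"
  proof -
    have "G \<inter> {Suc y..<y'} = {Suc y..<y'}" using mid by auto
    then have "pos G y' = pos G y + (y' - Suc y)"
      using pos_split[of "Suc y" y' G] y'(1) y(1) by (simp add: pos_Suc)
    moreover have "even (pos G y) = even (pos G y')" using gale[OF G(1), of y y'] y(1) y' bn by simp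
    ultimately show ?thesis by (metis even_add)
  qed
  ultimately have len: "d - 2 \<le> y' - Suc y" "y' - Suc y < d" "even (y' - Suc y)" by blast+
  have "y' - Suc y \<noteq> d - 1"
  proof
    assume "y' - Suc y = d - 1"
    then show False using len(3) even_d d6 by simp
  qed
  then have len2: "y' - Suc y = d - 2" using len(1,2) by linarith
  then have y'd: "y' = y + (d - 1)" using y'(1) d6 by simp
  obtain q where q: "y = Suc q" using y(2) by (cases y) auto
  have qG: "q \<in> G" "0 < q"
  proof -
    show "q \<in> G"
    proof (rule ccontr)
      assume n: "q \<notin> G"
      then have "a < q" using y(2) q a by (cases "a = q") auto
      moreover have "{q<..<y} = {}" by (auto simp: q)
      ultimately show False using gaps_far[OF G n y(1) _ a(1,2) _ b(1)] q y' d6 by simp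
    qed
    show "0 < q" using y(2) q a by simp
  qed
  have sG: "Suc y' \<in> G"
  proof (rule ccontr)
    assume n: "Suc y' \<notin> G"
    then have "Suc y' < b" using y'(3) b by (cases "b = Suc y'") auto
    moreover have "{y'<..<Suc y'} = {}" by auto
    ultimately show False using gaps_far[OF G y'(2) n _ a(1,2) _ b(1)] y' y d6 by simp
  qed
  define p where "p = pos G q"
  have p1: "1 \<le> p" using pos_less[OF G(2) qG(2)] by (simp add: p_def)
  have py: "pos G y = p + 1" using q qG by (simp add: pos_Suc p_def)
  have pm: "pos G z = p + 1 + (z - Suc y)" if "Suc y \<le> z" "z \<le> y'" for z
  proof -
    have "G \<inter> {Suc y..<z} = {Suc y..<z}" using that mid by auto
    then show ?thesis using pos_split[OF that(1), of G] py y(1) by (simp add: pos_Suc)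
  qed
  \<comment> \<open>In position, \<open>x\<close> is 3 above \<open>q\<close> and
    \<open>d - 4\<close> below \<open>Suc y'\<close>. Both distances are within the reach
    \<open>d - 3\<close>, so the ridge contains these two vertices.\<close>
  define x where "x = y + 3"
  have x: "x \<in> G" "pos G x = p + 3" "x < y'" using mid[of x] pm[of x] y'd d6 by (auto simp: x_def)
  have ps: "pos G (Suc y') = p + d - 1"
  proof -
    have "pos G (Suc y') = pos G y'" using y'(2) by (simp add: pos_Suc)
    also have "\<dots> = p + 1 + (d - 2)" using pm[of y'] y'(1) len2 by simp
    finally show ?thesis using d6 by simp
  qed
  let ?W = "ridge_E (d - 1) G x"
  have W: "q \<in> ?W" "Suc y' \<in> ?W" "0 \<in> ?W"
    using qG sG x ps q G(2) d6 p1 by (auto simp: ridge_E_def x_def p_def)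
  have "pos G x + 1 < card G" using pos_less_card[OF facet_finite[OF G(1)] sG] ps x d6 by simp
  moreover have "2 \<le> pos G x" using x by simp
  ultimately have "ridge (d - 1) G ?W" using x(1) unfolding ridge_def by blast
  then obtain H where H: "H \<in> FF" "H \<inter> G = ?W" "ridge (d - 1) H ?W" using nbr[OF G(1)] by blast
  have WH: "q \<in> H" "Suc y' \<in> H" "0 \<in> H" using W H(2) by auto
  have xH: "x \<notin> H" using H(2) x(1) by (auto simp: ridge_E_def)
  have yH: "y \<in> H"
  proof (rule ccontr)
    assume n: "y \<notin> H"
    have "d - 2 \<le> card (H \<inter> {y<..<x})"
      using gaps_far[OF H(1) WH(3) n xH _ WH(1) qG(2) _ WH(2)] x(3) q by (simp add: x_def)
    also have "\<dots> \<le> card {y<..<x}" by (intro card_mono) auto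
    finally show False using d6 by (simp add: x_def)
  qed
  have y'H: "y' \<in> H"
  proof (rule ccontr)
    assume n: "y' \<notin> H"
    have "d - 2 \<le> card (H \<inter> {x<..<y'})"
      using gaps_far[OF H(1) WH(3) xH n x(3) WH(1) qG(2) _ WH(2)] q by (simp add: x_def)
    also have "\<dots> \<le> card {x<..<y'}" by (intro card_mono) auto
    finally show False using d6 y'd by (simp add: x_def)
  qed
  have "y \<notin> ?W" "y' \<notin> ?W" using y(1) y'(2) by (auto simp: ridge_E_def)
  moreover have "0 < pos H q" using pos_less[OF WH(3) qG(2)] by simp
  ultimately have "y = y'"
    using ridge_gap_unique[OF H(3) W(1,2), of y y'] yH y'H q y'(1) by simp
  then show False using y'(1) by simp
qed

text \<open>Each of the runs \<open>a\<close> to \<open>j - 1\<close> and \<open>j + 1\<close> to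
  \<open>b\<close> must have length \<open>d - 2\<close>, or less if an end of \<open>{1..n}\<close>
  stops it. For a longer run, the ridge omitting the neighbour of \<open>j\<close> in that run leads
  to a facet with \<open>d - 3\<close> vertices, an odd number, between two gaps. For a shorter run
  not at an end, the ridge omitting the neighbour of \<open>j\<close> on the other side leads to a
  facet that gains both \<open>j\<close> and the index just outside the run, but these would have to
  be separated by \<open>d - 3\<close> ridge vertices.\<close>

lemma facet_with_gap:
  assumes GF: "G \<in> FF" and G: "G = insert 0 ({a..b} - {j})" and aj: "1 \<le> a" "a < j" "j < b"
  shows "ridge d {..n} G"
proof -
  obtain m where dm: "d = m + 6" using d6 by (metis add.commute le_Suc_ex)
  have G0: "0 \<in> G" by (simp add: G)
  have bn: "b \<le> n" using facet_le[OF GF, of b] aj by (simp add: G)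
  have jG: "j \<notin> G" using aj by (simp add: G)
  have memG: "z \<in> G \<longleftrightarrow> z = 0 \<or> a \<le> z \<and> z \<le> b \<and> z \<noteq> j" for z by (auto simp: G)
  have pa: "pos G a = 1"
  proof -
    have "G \<inter> {..<a} = {0}" using aj by (auto simp: G)
    then show ?thesis by (simp add: pos_def)
  qed
  have p1: "pos G z = 1 + (z - a)" if "a \<le> z" "z \<le> j" for z
  proof -
    have "G \<inter> {a..<z} = {a..<z}" using that aj by (auto simp: G)
    then show ?thesis using pos_split[OF that(1), of G] pa by simp
  qed
  have p2: "pos G z = z - a" if "j < z" "z \<le> Suc b" for z
  proof -
    have "G \<inter> {Suc j..<z} = {Suc j..<z}" using that aj by (auto simp: G)
    then show ?thesis using pos_split[of "Suc j" z G] p1[of j] jG that aj by (simp add: pos_Suc)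
  qed
  have cG: "card G = 1 + (b - a)"
  proof -
    have "G \<subseteq> {..<Suc b}" using aj by (auto simp: G)
    then show ?thesis using pos_all[of G "Suc b"] p2[of "Suc b"] aj by simp
  qed
  then have cd: "d \<le> 1 + (b - a)" using facet_card[OF GF] by simp
  have lamd: "j - a < d"
  proof (rule ccontr)
    assume "\<not> ?thesis"
    then have "{a..<a + d} \<subseteq> G" using aj by (auto simp: G)
    then show False using no_block[OF GF G0 aj(1)] by simp
  qed
  have rhod: "b - j < d"
  proof (rule ccontr)
    assume "\<not> ?thesis"
    then have "{Suc j..<Suc j + d} \<subseteq> G" using aj by (auto simp: G)
    then show False using no_block[OF GF G0, of "Suc j"] by simp
  qed
  have lame: "even (j - a)" if "1 < a"
  proof -
    have "G \<inter> {..<a - 1} = {0}" "a - 1 \<notin> G" using that aj by (auto simp: G)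
    then have "pos G (a - 1) = 1" "a - 1 \<notin> G" by (auto simp: pos_def)
    then show ?thesis using gale[OF GF _ _ jG, of "a - 1"] p1[of j] aj bn by simp
  qed
  have rhoe: "even (b - j)" if "b < n"
  proof -
    have "Suc b \<notin> G" by (simp add: G)
    then have "even (pos G (Suc b)) = even (pos G j)" using gale[OF GF _ _ _ jG, of "Suc b"] that aj by simp
    moreover have "pos G (Suc b) = pos G j + (b - j)" using p1[of j] p2[of "Suc b"] aj by simp
    ultimately show ?thesis by (metis even_add)
  qed
  have nb: "\<exists>H\<in>FF. H \<inter> G = ridge_E (d - 1) G x \<and> ridge (d - 1) H (ridge_E (d - 1) G x)"
    if "x \<in> G" "2 \<le> pos G x" "pos G x + 1 < card G" for x
    using nbr[OF GF, of "ridge_E (d - 1) G x"] that unfolding ridge_def by blast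
  have lam2: "j - a \<le> d - 2"
  proof (rule ccontr)
    assume "\<not> ?thesis"
    then have lam: "j - a = d - 1" using lamd by simp
    then have a1: "a = 1" using lame even_d d6 aj(1) by (cases "a = 1") auto
    then have jd: "j = d" using lam d6 by simp
    define x where "x = d - 1"
    have x: "x \<in> G" "pos G x = d - 1" "x < b" "1 < x" using a1 jd aj dm p1[of x] by (auto simp: x_def G)
    have "pos G x + 1 < card G" using x cG a1 jd aj d6 by simp
    moreover have "2 \<le> pos G x" using x d6 by simp
    ultimately obtain H where H: "H \<in> FF" "H \<inter> G = ridge_E (d - 1) G x" using nb[OF x(1)] by blast
    have mem: "z \<in> H \<longleftrightarrow> z \<in> ridge_E (d - 1) G x" if "z \<in> G" for z using H(2) that by blast
    \<comment> \<open>The positions 1 and \<open>d - 1\<close> differ by \<open>d - 2\<close>, just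
      beyond the reach of the ridge.\<close>
    have "1 \<notin> H" using mem[of 1] p1[of 1] a1 x jd dm aj by (simp add: memG ridge_E_def; arith)
    moreover have "x \<notin> H" using mem[OF x(1)] by (simp add: ridge_E_def)
    moreover have "pos H x = pos H 1 + (d - 3)"
    proof -
      have "z \<in> H" if "2 \<le> z" "z < x" for z
        using mem[of z] p1[of z] that a1 x jd dm aj by (simp add: memG ridge_E_def x_def; arith)
      then have "H \<inter> {1..<x} = {2..<x}" using \<open>1 \<notin> H\<close> by (auto simp: order_le_less numeral_2_eq_2)
      then show ?thesis using pos_split[of 1 x H] x(4) by (simp add: x_def)
    qed
    ultimately show False using gale[OF H(1), of 1 x] x bn dn even_d dm by auto
  qed
  have rho2: "b - j \<le> d - 2"
  proof (rule ccontr)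
    assume "\<not> ?thesis"
    then have rho: "b - j = d - 1" using rhod by simp
    then have b1: "b = n" using rhoe even_d d6 bn by (cases "b = n") auto
    define x where "x = Suc j"
    have x: "x \<in> G" "pos G x = 1 + (j - a)" "x < b" using aj rho dm p2[of x] by (auto simp: x_def G)
    have "pos G x + 1 < card G" using x cG aj by (simp add: x_def)
    moreover have "2 \<le> pos G x" using x aj by simp
    ultimately obtain H where H: "H \<in> FF" "H \<inter> G = ridge_E (d - 1) G x" using nb[OF x(1)] by blast
    have mem: "z \<in> H \<longleftrightarrow> z \<in> ridge_E (d - 1) G x" if "z \<in> G" for z using H(2) that by blast
    have "b \<notin> H" using mem[of b] p2[of b] x rho dm aj by (simp add: memG ridge_E_def; arith)
    moreover have "x \<notin> H" using mem[OF x(1)] by (simp add: ridge_E_def)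
    moreover have "pos H b = pos H x + (d - 3)"
    proof -
      have "z \<in> H" if "x < z" "z < b" for z
        using mem[of z] p2[of z] that x dm aj rho by (simp add: memG ridge_E_def x_def; arith)
      then have "H \<inter> {x..<b} = {Suc x..<b}" using \<open>x \<notin> H\<close> by (auto simp: order_le_less)
      then show ?thesis using pos_split[of x b H] x(3) rho by (simp add: x_def)
    qed
    ultimately show False using gale[OF H(1), of x b] x bn even_d dm by auto
  qed
  have lam3: "j - a = d - 2" if a1: "1 < a"
  proof (rule ccontr)
    assume "j - a \<noteq> d - 2"
    moreover have "j - a \<noteq> d - 3"
    proof
      assume "j - a = d - 3"
      then show False using lame[OF a1] even_d d6 by simp
    qed
    ultimately have lam: "j - a \<le> d - 4" using lam2 by linarith
    then have rho: "3 \<le> b - j" using cd aj d6 by simp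
    define x where "x = Suc j"
    have x: "x \<in> G" "pos G x = 1 + (j - a)" using aj p2[of x] by (auto simp: x_def G)
    \<comment> \<open>Both runs are short enough to be within reach of \<open>x\<close>, so the
      ridge loses only \<open>x\<close>.\<close>
    have W: "ridge_E (d - 1) G x = G - {x}"
    proof (rule set_eqI)
      fix z
      have "pos G z \<le> pos G x + (d - 1 - 2) \<and> pos G x \<le> pos G z + (d - 1 - 2)" if z: "z \<in> G" "z \<noteq> 0"
      proof (cases "z \<le> j")
        case True
        then have "pos G z = 1 + (z - a)" "z < j" using z p1[of z] by (auto simp: memG order_le_less)
        then show ?thesis using x(2) lam d6 by linarith
      next
        case False
        then have "pos G z = z - a" "z \<le> b" using z p2[of z] by (auto simp: memG)
        then show ?thesis using False x(2) rho2 lam d6 aj by linarith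
      qed
      then show "z \<in> ridge_E (d - 1) G x \<longleftrightarrow> z \<in> G - {x}"
        by (cases "z = 0") (auto simp: ridge_E_def x_def)
    qed
    have "pos G x + 1 < card G" using x cG aj rho by simp
    moreover have "2 \<le> pos G x" using x aj by simp
    ultimately obtain H where H: "H \<in> FF" "H \<inter> G = G - {x}" "ridge (d - 1) H (G - {x})"
      using nb[OF x(1)] unfolding W by blast
    have xH: "x \<notin> H" using H(2) x(1) by blast
    have GH: "z \<in> H" if "z \<in> G" "z \<noteq> x" for z using H(2) that by blast
    have H0: "0 \<in> H" using GH[OF G0] by (simp add: x_def)
    have nbrs: "j - 1 \<in> G - {x}" "j + 2 \<in> G - {x}" using aj rho by (auto simp: memG x_def)
    have jH: "j \<in> H"
    proof (rule ccontr)
      assume n: "j \<notin> H"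
      have "d - 2 \<le> card (H \<inter> {j<..<x})"
        using gaps_far[OF H(1) H0 n xH, of "j - 1" "j + 2"] nbrs GH aj by (simp add: x_def)
      moreover have "{j<..<x} = {}" by (auto simp: x_def)
      ultimately show False using d6 by simp
    qed
    \<comment> \<open>Otherwise the gaps \<open>a - 1\<close> and \<open>x\<close> would enclose the
      even left run together with \<open>j\<close>, an odd number of vertices.\<close>
    have aH: "a - 1 \<in> H"
    proof (rule ccontr)
      assume n: "a - 1 \<notin> H"
      have "H \<inter> {a - 1..<x} = {a..<x}"
      proof (rule set_eqI)
        fix z
        have "z \<in> H" if "a \<le> z" "z \<le> j"
          using that jH GH[of z] aj by (cases "z = j") (auto simp: memG x_def)
        moreover have "z = a - 1 \<or> z < a - 1 \<or> a \<le> z" by auto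
        ultimately show "z \<in> H \<inter> {a - 1..<x} \<longleftrightarrow> z \<in> {a..<x}" using n a1 unfolding x_def by auto
      qed
      then have "pos H x = pos H (a - 1) + (Suc j - a)" using pos_split[of "a - 1" x H] aj by (simp add: x_def)
      moreover have "even (pos H (a - 1)) = even (pos H x)"
        using gale[OF H(1), of "a - 1" x] n xH aj bn by (simp add: x_def)
      moreover have "odd (Suc j - a)" using lame[OF a1] aj by (simp add: Suc_diff_le)
      ultimately show False by (metis even_add)
    qed
    have "0 < pos H (j - 1)" using pos_less[OF H0, of "j - 1"] aj by simp
    then have E: "G - {x} = ridge_E (d - 1) H j"
      using ridge_gap[OF H(3) nbrs _ _ _ jH] jG aj by simp
    have "a - 1 \<notin> G - {x}" using a1 aj by (auto simp: memG)
    then have nE: "a - 1 \<notin> ridge_E (d - 1) H j" unfolding E .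
    have "0 < pos H (a - 1)" using pos_less[OF H0, of "a - 1"] a1 by simp
    moreover have "a - 1 < j" using aj by simp
    ultimately have "d - 1 - 2 \<le> card (ridge_E (d - 1) H j \<inter> {a - 1<..<j})"
      by (intro ridge_E_low[OF facet_finite[OF H(1)] jH aH nE])
    also have "\<dots> \<le> card {a - 1<..<j}" by (intro card_mono) auto
    finally show False using lam d6 a1 aj by simp
  qed
  have rho3: "b - j = d - 2" if b1: "b < n"
  proof (rule ccontr)
    assume "b - j \<noteq> d - 2"
    moreover have "b - j \<noteq> d - 3"
    proof
      assume "b - j = d - 3"
      then show False using rhoe[OF b1] even_d d6 by simp
    qed
    ultimately have rho: "b - j \<le> d - 4" using rho2 by linarith
    then have lam: "3 \<le> j - a" using cd aj d6 by simp
    define x where "x = j - 1"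
    have x: "x \<in> G" "pos G x = j - a" using aj lam p1[of x] by (auto simp: x_def G)
    have W: "ridge_E (d - 1) G x = G - {x}"
    proof (rule set_eqI)
      fix z
      have "pos G z \<le> pos G x + (d - 1 - 2) \<and> pos G x \<le> pos G z + (d - 1 - 2)" if z: "z \<in> G" "z \<noteq> 0"
      proof (cases "z \<le> j")
        case True
        then have "pos G z = 1 + (z - a)" "z < j" using z p1[of z] by (auto simp: memG order_le_less)
        then show ?thesis using x(2) lam2 d6 by linarith
      next
        case False
        then have "pos G z = z - a" "z \<le> b" using z p2[of z] by (auto simp: memG)
        then show ?thesis using False x(2) rho d6 aj by linarith
      qed
      then show "z \<in> ridge_E (d - 1) G x \<longleftrightarrow> z \<in> G - {x}"
        by (cases "z = 0") (auto simp: ridge_E_def)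
    qed
    have "pos G x + 1 < card G" using x cG aj by simp
    moreover have "2 \<le> pos G x" using x lam by simp
    ultimately obtain H where H: "H \<in> FF" "H \<inter> G = G - {x}" "ridge (d - 1) H (G - {x})"
      using nb[OF x(1)] unfolding W by blast
    have xH: "x \<notin> H" using H(2) x(1) by blast
    have GH: "z \<in> H" if "z \<in> G" "z \<noteq> x" for z using H(2) that by blast
    have H0: "0 \<in> H" using GH[OF G0] lam by (simp add: x_def)
    have nbrs: "j - 2 \<in> G - {x}" "j + 1 \<in> G - {x}" using aj lam by (auto simp: memG x_def)
    have xj: "x < j" using aj by (simp add: x_def)
    have jH: "j \<in> H"
    proof (rule ccontr)
      assume n: "j \<notin> H"
      have "d - 2 \<le> card (H \<inter> {x<..<j})"
        using gaps_far[OF H(1) H0 xH n xj, of "j - 2" "j + 1"] nbrs GH aj lam by (simp add: x_def)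
      moreover have "{x<..<j} = {}" by (auto simp: x_def)
      ultimately show False using d6 by simp
    qed
    have bH: "Suc b \<in> H"
    proof (rule ccontr)
      assume n: "Suc b \<notin> H"
      have mid: "z \<in> H" if "j \<le> z" "z \<le> b" for z
        using that jH GH[of z] aj by (cases "z = j") (auto simp: memG x_def)
      have "Suc x = j" using aj by (simp add: x_def)
      then have "H \<inter> {Suc x..<Suc b} = {j..<Suc b}" "pos H (Suc x) = pos H x" "Suc x \<le> Suc b"
        using mid xH aj by (auto simp: pos_Suc)
      then have "pos H (Suc b) = pos H x + (Suc b - j)"
        using pos_split[of "Suc x" "Suc b" H] by simp
      moreover have "even (pos H x) = even (pos H (Suc b))"
        using gale[OF H(1), of x "Suc b"] n xH aj b1 by (simp add: x_def)
      moreover have "odd (Suc b - j)" using rhoe[OF b1] aj by (simp add: Suc_diff_le)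
      ultimately show False by (metis even_add)
    qed
    have "0 < pos H (j - 2)" using pos_less[OF H0, of "j - 2"] lam by simp
    then have E: "G - {x} = ridge_E (d - 1) H j"
      using ridge_gap[OF H(3) nbrs _ _ _ jH] jG aj lam by simp
    have "Suc b \<notin> G - {x}" using aj by (simp add: memG)
    then have nE: "Suc b \<notin> ridge_E (d - 1) H j" unfolding E .
    have "d - 1 - 2 \<le> card (ridge_E (d - 1) H j \<inter> {j<..<Suc b})"
      by (rule ridge_E_high[OF facet_finite[OF H(1)] jH bH nE]) (use aj in simp)
    also have "\<dots> \<le> card {j<..<Suc b}" by (intro card_mono) auto
    finally show False using rho d6 by simp
  qed
  have Geq: "G = {y. y \<le> n \<and> y \<noteq> j \<and> (y = 0 \<or> y \<le> j + (d - 2) \<and> j \<le> y + (d - 2))}"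
  proof (rule set_eqI)
    fix y
    have "y = 0 \<or> (a \<le> y \<longleftrightarrow> j \<le> y + (d - 2))" using lam2 lam3 aj by (cases "a = 1") auto
    moreover have "y \<le> b \<longleftrightarrow> y \<le> n \<and> y \<le> j + (d - 2)" using rho2 rho3 bn aj by (cases "b = n") auto
    ultimately show "y \<in> G \<longleftrightarrow> y \<in> {y. y \<le> n \<and> y \<noteq> j \<and> (y = 0 \<or> y \<le> j + (d - 2) \<and> j \<le> y + (d - 2))}"
      using memG[of y] aj by auto
  qed
  show ?thesis unfolding Geq by (rule ridge_atMost_E) (use aj bn in auto)
qed

text \<open>A facet with 0 has at most one gap between its least and greatest positive vertex.
  Without a gap its positive vertices form a run of length \<open>d - 1\<close>, which parity allows
  only at the start or the end of the array.\<close>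

lemma facet_is_ridge:
  assumes G: "G \<in> FF" shows "ridge d {..n} G"
proof (cases "0 \<in> G")
  case False
  then obtain h where h: "G = {h..<h + d}" using interval_facet[OF G] by blast
  then have "h + d - 1 \<in> G" using d6 by auto
  then have "h + d \<le> n + 1" using facet_le[OF G] by fastforce
  then show ?thesis unfolding h by (intro ridge_atMost_T) simp
next
  case True
  have f: "finite G" by (rule facet_finite[OF G])
  let ?D = "G - {0}"
  have cD: "card ?D = card G - 1" using True f by simp
  then have neD: "?D \<noteq> {}" using facet_card[OF G] d6 by (metis card.empty diff_is_0_eq not_less_eq_eq numeral_le_one_iff One_nat_def le_trans semiring_norm(69))
  define a where "a = Min ?D"
  define b where "b = Max ?D"
  have a: "a \<in> G" "0 < a" and b: "b \<in> G" using Min_in[of ?D] Max_in[of ?D] f neD by (auto simp: a_def b_def)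
  have rng: "a \<le> z \<and> z \<le> b" if "z \<in> G" "z \<noteq> 0" for z using that f by (auto simp: a_def b_def)
  have bn: "b \<le> n" by (rule facet_le[OF G b])
  have ab: "a \<le> b" using rng[OF a(1)] a by simp
  show ?thesis
  proof (cases "{a..b} \<subseteq> G")
    case full: True
    have "?D = {a..b}"
    proof
      show "?D \<subseteq> {a..b}"
      proof
        fix z assume "z \<in> ?D"
        then show "z \<in> {a..b}" using rng[of z] by simp
      qed
      show "{a..b} \<subseteq> ?D" using full a by auto
    qed
    then have Geq: "G = insert 0 {a..b}" and "card G = Suc (Suc b - a)"
      using True cD facet_card[OF G] d6 by (blast, simp)
    then have "d - 1 \<le> Suc b - a" using facet_card[OF G] by simp
    moreover have "Suc b - a < d"
    proof (rule ccontr)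
      assume "\<not> ?thesis"
      then have "{a..<a + d} \<subseteq> {a..b}" by auto
      then have "{a..<a + d} \<subseteq> G" using full by blast
      then show False using no_block[OF G True, of a] a by simp
    qed
    ultimately have len: "Suc b = a + (d - 1)" using ab by simp
    show ?thesis
    proof (cases "a = 1")
      case True
      have "y \<in> G \<longleftrightarrow> y \<in> {0..<0 + d}" for y unfolding Geq using len True d6 by auto
      then have Ge: "G = {0..<0 + d}" by blast
      show ?thesis unfolding Ge by (rule ridge_atMost_T) (use dn in simp)
    next
      case False
      then have a2: "2 \<le> a" using a by simp
      \<comment> \<open>Otherwise \<open>a - 1\<close> and \<open>Suc b\<close> would be gaps with
        counts 1 and \<open>d\<close>.\<close>
      have "b = n"
      proof (rule ccontr)
        assume "b \<noteq> n"
        then have "Suc b \<le> n" using bn by simp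
        moreover have "Suc b \<notin> G" "a - 1 \<notin> G" using Geq a2 by auto
        moreover have "pos G (a - 1) = 1"
        proof -
          have "G \<inter> {..<a - 1} = {0}" using Geq a2 by auto
          then show ?thesis by (simp add: pos_def)
        qed
        moreover have "pos G (Suc b) = d"
        proof -
          have "pos G (Suc b) = card G" using Geq by (intro pos_all) auto
          then show ?thesis using \<open>card G = Suc (Suc b - a)\<close> len d6 by simp
        qed
        moreover have "a - 1 \<le> n" using bn ab by simp
        ultimately show False using gale[OF G, of "a - 1" "Suc b"] even_d by simp
      qed
      then have "y \<in> G \<longleftrightarrow> y \<in> {y. y \<le> n \<and> (y = 0 \<or> n + 1 \<le> y + (d - 1))}" for y
        unfolding Geq using len d6 by auto
      then have Ge: "G = {y. y \<le> n \<and> (y = 0 \<or> n + 1 \<le> y + (d - 1))}" by blast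
      show ?thesis unfolding Ge by (rule ridge_atMost_L)
    qed
  next
    case False
    then obtain j where "j \<in> {a..b}" "j \<notin> G" by blast
    then have j: "a \<le> j" "j \<le> b" "j \<notin> G" by auto
    then have jj: "a < j" "j < b" using a b by (auto simp: order_le_less)
    have "G = insert 0 ({a..b} - {j})"
    proof
      show "G \<subseteq> insert 0 ({a..b} - {j})" using rng j by auto
      show "insert 0 ({a..b} - {j}) \<subseteq> G"
      proof
        fix z assume z: "z \<in> insert 0 ({a..b} - {j})"
        show "z \<in> G"
        proof (rule ccontr)
          assume zG: "z \<notin> G"
          then have "z \<noteq> 0" using True by metis
          then have "a < z" "z < b" "z \<noteq> j" using z zG a b by (auto simp: order_le_less)
          then show False
            using one_gap[OF G True zG j(3) _ a _ b] one_gap[OF G True j(3) zG _ a _ b] jj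
            by (cases "z < j") auto
        qed
      qed
    qed
    then show ?thesis using facet_with_gap[OF G _ _ jj] a by simp
  qed
qed

text \<open>Patterns with 0 are reached from a block \<open>{i..<i + d}\<close> by removing an index
  \<open>b\<close> that lies in every block containing the rest. The neighbour is then not a block,
  so it contains 0, and \<open>facet_is_ridge\<close> leaves a single candidate for it.\<close>

lemma ridge_is_facet:
  assumes R: "ridge d {..n} R" shows "R \<in> FF"
proof -
  have step: "\<exists>G\<in>FF. b \<notin> G \<and> 0 \<in> G \<and> {i..<i + d} - {b} \<subseteq> G"
    if i: "1 \<le> i" "i + d \<le> n + 1" and b: "b \<in> {i..<i + d}"
      and no: "\<forall>h. 1 \<le> h \<and> h + d \<le> n + 1 \<and> {i..<i + d} - {b} \<subseteq> {h..<h + d} \<longrightarrow> b \<in> {h..<h + d}" for i b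
  proof -
    have B: "{i..<i + d} \<in> FF" by (rule block_facet[OF i])
    have B0: "0 \<notin> {i..<i + d}" using i by simp
    obtain G where G: "G \<in> FF" "G \<inter> {i..<i + d} = {i..<i + d} - {b}" "b \<notin> G" "{i..<i + d} - {b} \<subseteq> G"
      "0 \<in> G \<longrightarrow> (\<forall>v\<in>{i..<i + d} - {b}. \<forall>w\<in>{i..<i + d} - {b}. G \<inter> {v..w} \<subseteq> {i..<i + d} - {b})"
      using simplex_nbr[OF B B0 b] .
    have "0 \<in> G"
    proof (rule ccontr)
      assume "0 \<notin> G"
      then obtain h where h: "1 \<le> h" "G = {h..<h + d}" using interval_facet[OF G(1)] by blast
      then have "h + d - 1 \<in> G" using d6 by auto
      then have "h + d \<le> n + 1" using facet_le[OF G(1)] by fastforce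
      then show False using no h(1) G(3,4) h(2) by blast
    qed
    then show ?thesis using G by blast
  qed
  show ?thesis using R[unfolded ridge_atMost]
  proof (elim disjE exE conjE)
    fix i assume T: "i + d \<le> n + 1" "R = {i..<i + d}"
    show ?thesis
    proof (cases "i = 0")
      case False then show ?thesis using block_facet T by simp
    next
      case True
      have "d \<in> {h..<h + d}" if "1 \<le> h" "h + d \<le> n + 1" "{1..<1 + d} - {d} \<subseteq> {h..<h + d}" for h
      proof -
        have "1 \<in> {1..<1 + d} - {d}" using d6 by auto
        then have "1 \<in> {h..<h + d}" using that(3) by blast
        then show ?thesis using that(1) d6 by auto
      qed
      then have key: "\<forall>h. 1 \<le> h \<and> h + d \<le> n + 1 \<and> {1..<1 + d} - {d} \<subseteq> {h..<h + d} \<longrightarrow> d \<in> {h..<h + d}"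
        by blast
      have "1 + d \<le> n + 1" "d \<in> {1..<1 + d}" using dn d6 by auto
      from step[OF order_refl this key] obtain G where G: "G \<in> FF" "d \<notin> G" "0 \<in> G" "{1..<1 + d} - {d} \<subseteq> G"
        by blast
      have lowG: "z \<in> G" if "z < d" for z using G(3,4) that by (cases "z = 0") auto
      have one: "1 \<in> G" "d - 1 \<in> G" using lowG d6 by auto
      have "G = {0..<0 + d}"
        using facet_is_ridge[OF G(1), unfolded ridge_atMost]
      proof (elim disjE exE conjE)
        fix i assume "G = {i..<i + d}" then show ?thesis using G(3) by simp
      next
        assume "G = {y. y \<le> n \<and> (y = 0 \<or> n + 1 \<le> y + (d - 1))}"
        then show ?thesis using one(1) dn by auto
      next
        fix x assume x: "2 \<le> x" "x < n" "G = {y. y \<le> n \<and> y \<noteq> x \<and> (y = 0 \<or> y \<le> x + (d - 2) \<and> x \<le> y + (d - 2))}"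
        then have "x \<notin> G" by simp
        then have "d \<le> x" using lowG[of x] by fastforce
        moreover have "x \<le> 1 + (d - 2)" using one(1) x(3) by simp
        ultimately show ?thesis using d6 by simp
      qed
      then show ?thesis using T True G(1) by simp
    qed
  next
    assume L: "R = {y. y \<le> n \<and> (y = 0 \<or> n + 1 \<le> y + (d - 1))}"
    define i where "i = n + 1 - d"
    have i: "1 \<le> i" "i + d = n + 1" using dn by (auto simp: i_def)
    have "i \<in> {h..<h + d}" if "1 \<le> h" "h + d \<le> n + 1" "{i..<i + d} - {i} \<subseteq> {h..<h + d}" for h
    proof -
      have "n \<in> {i..<i + d} - {i}" using i d6 by auto
      then have "n \<in> {h..<h + d}" using that(3) by blast
      then show ?thesis using that(2) i by auto
    qed
    then have key: "\<forall>h. 1 \<le> h \<and> h + d \<le> n + 1 \<and> {i..<i + d} - {i} \<subseteq> {h..<h + d} \<longrightarrow> i \<in> {h..<h + d}"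
      by blast
    have "i \<in> {i..<i + d}" using d6 by auto
    from step[OF i(1) eq_imp_le[OF i(2)] this key]
    obtain G where G: "G \<in> FF" "i \<notin> G" "0 \<in> G" "{i..<i + d} - {i} \<subseteq> G" by blast
    have hiG: "z \<in> G" if "i < z" "z \<le> n" for z using G(4) that i by auto
    have nG: "n \<in> G" using hiG[of n] i d6 by simp
    have "G = R"
      using facet_is_ridge[OF G(1), unfolded ridge_atMost]
    proof (elim disjE exE conjE)
      fix k assume "G = {k..<k + d}" then show ?thesis using G(3) nG dn by simp
    next
      assume "G = {y. y \<le> n \<and> (y = 0 \<or> n + 1 \<le> y + (d - 1))}"
      then show ?thesis using L by simp
    next
      fix x assume x: "2 \<le> x" "x < n" "G = {y. y \<le> n \<and> y \<noteq> x \<and> (y = 0 \<or> y \<le> x + (d - 2) \<and> x \<le> y + (d - 2))}"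
      then have "x \<notin> G" by simp
      then have "x \<le> i" using hiG[of x] x(2) by fastforce
      moreover have "n \<le> x + (d - 2)" using nG x by simp
      ultimately show ?thesis using d6 i by simp
    qed
    then show ?thesis using G(1) by simp
  next
    fix x assume E: "2 \<le> x" "x < n" "R = {y. y \<le> n \<and> y \<noteq> x \<and> (y = 0 \<or> y \<le> x + (d - 2) \<and> x \<le> y + (d - 2))}"
    \<comment> \<open>This block has \<open>x\<close> strictly inside: its ends survive the removal
      of \<open>x\<close>, and any block through both ends contains \<open>x\<close>.\<close>
    define i where "i = min (x - 1) (n + 1 - d)"
    have i: "1 \<le> i" "i + d \<le> n + 1" "i < x" "x < i + d - 1" using E dn d6 by (auto simp: i_def min_def)
    have ends: "i \<in> {i..<i + d} - {x}" "i + d - 1 \<in> {i..<i + d} - {x}" using i d6 by auto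
    have "x \<in> {h..<h + d}" if "1 \<le> h" "h + d \<le> n + 1" "{i..<i + d} - {x} \<subseteq> {h..<h + d}" for h
    proof -
      have "i \<in> {h..<h + d}" "i + d - 1 \<in> {h..<h + d}" using ends that(3) by blast+
      then show ?thesis using i by auto
    qed
    then have key: "\<forall>h. 1 \<le> h \<and> h + d \<le> n + 1 \<and> {i..<i + d} - {x} \<subseteq> {h..<h + d} \<longrightarrow> x \<in> {h..<h + d}"
      by blast
    have "x \<in> {i..<i + d}" using i(3,4) by auto
    from step[OF i(1,2) this key]
    obtain G where G: "G \<in> FF" "x \<notin> G" "0 \<in> G" "{i..<i + d} - {x} \<subseteq> G" by blast
    have eG: "i \<in> G" "i + d - 1 \<in> G" using G(4) ends by blast+
    have "G = R"
      using facet_is_ridge[OF G(1), unfolded ridge_atMost]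
    proof (elim disjE exE conjE)
      fix k assume "G = {k..<k + d}" then show ?thesis using G(2,3) eG i by simp
    next
      assume "G = {y. y \<le> n \<and> (y = 0 \<or> n + 1 \<le> y + (d - 1))}"
      then show ?thesis using G(2) eG(1) i E by simp
    next
      fix x' assume x': "G = {y. y \<le> n \<and> y \<noteq> x' \<and> (y = 0 \<or> y \<le> x' + (d - 2) \<and> x' \<le> y + (d - 2))}"
      have "i \<le> x' + (d - 2)" "x' \<le> i + (d - 2)" "i + d - 1 \<le> x' + (d - 2)" using eG i d6 unfolding x' by auto
      then have "x \<le> x' + (d - 2)" "x' \<le> x + (d - 2)" using i d6 by auto
      then have "x = x'" using G(2) E unfolding x' by simp
      then show ?thesis using x' E by simp
    qed
    then show ?thesis using G(1) by simp
  qed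
qed

lemma facets_eq: "FF = {R. ridge d {..n} R}"
  using facet_is_ridge ridge_is_facet by blast

end

section \<open>Affine dependencies and cyclic point sets\<close>

lemma paired_insert_pair:
  assumes "paired B" "B \<subseteq> {p + 2..}"
  shows "paired ({p, Suc p} \<union> B)" "card ({p, Suc p} \<union> B) = card B + 2"
proof -
  have f: "finite B" by (rule paired_finite[OF assms(1)])
  have dis: "{p, Suc p} \<inter> B = {}" using assms(2) by auto
  show "card ({p, Suc p} \<union> B) = card B + 2" using card_Un_disjoint[OF _ f dis] by simp
  show "paired ({p, Suc p} \<union> B)" unfolding paired_def
  proof (intro conjI allI impI)
    fix z assume z: "z \<notin> {p, Suc p} \<union> B"
    have "{p, Suc p} = {p..Suc p}" by auto
    then have "pos ({p, Suc p} \<union> B) z = (min z (Suc (Suc p)) - p) + pos B z"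
      using pos_Un[OF _ f dis, of z] by (simp add: pos_interval)
    moreover have "even (pos B z)" using z paired_even[OF assms(1)] by simp
    moreover have "z < p \<or> Suc (Suc p) \<le> z" using z by auto
    ultimately show "even (pos ({p, Suc p} \<union> B) z)" by auto
  qed (use f in simp)
qed

text \<open>The given pairs \<open>{y, Suc y}\<close> may overlap or leave the range. Greedy repair
  from the left: a pair is placed at \<open>p\<close> if \<open>p\<close> belongs to
  \<open>Z\<close>, using up one \<open>y\<close>; otherwise \<open>p\<close> is skipped, unless
  exactly \<open>2 * k\<close> places are left, which are then all taken.\<close>

lemma paired_cover:
  assumes "Z \<subseteq> {p..<q}" "p + 2 * k \<le> q" "finite Y" "card Y \<le> k" "Z \<subseteq> Y \<union> Suc ` Y"
  shows "\<exists>B. paired B \<and> card B = 2 * k \<and> Z \<subseteq> B \<and> B \<subseteq> {p..<q}"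
  using assms
proof (induction "q - p" arbitrary: p k Z Y rule: less_induct)
  case less
  show ?case
  proof (cases k)
    case 0
    then have "Z = {}" using less.prems(3-5) by auto
    then show ?thesis using 0 by (intro exI[of _ "{}"]) (auto simp: paired_def pos_def)
  next
    case (Suc k')
    show ?thesis
    proof (cases "p \<in> Z")
      case True
      then obtain y where y: "y \<in> Y" "y = p \<or> Suc y = p" using less.prems(5) by auto
      have "\<exists>B. paired B \<and> card B = 2 * k' \<and> Z - {p, Suc p} \<subseteq> B \<and> B \<subseteq> {p + 2..<q}"
      proof (rule less.hyps)
        show "q - (p + 2) < q - p" using less.prems(2) Suc by simp
        show "Z - {p, Suc p} \<subseteq> {p + 2..<q}" using less.prems(1) by (auto simp: le_less)
        show "p + 2 + 2 * k' \<le> q" using less.prems(2) Suc by simp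
        show "finite (Y - {y})" using less.prems(3) by simp
        show "card (Y - {y}) \<le> k'" using less.prems(3,4) y(1) Suc by simp
        show "Z - {p, Suc p} \<subseteq> (Y - {y}) \<union> Suc ` (Y - {y})"
        proof
          fix z assume z: "z \<in> Z - {p, Suc p}"
          then have "p + 2 \<le> z" using less.prems(1) by (auto simp: le_less)
          then show "z \<in> (Y - {y}) \<union> Suc ` (Y - {y})" using z y less.prems(5) by auto
        qed
      qed
      then obtain B where B: "paired B" "card B = 2 * k'" "Z - {p, Suc p} \<subseteq> B" "B \<subseteq> {p + 2..<q}" by blast
      have s: "B \<subseteq> {p + 2..}" using B(4) by auto
      show ?thesis
      proof (intro exI conjI)
        show "paired ({p, Suc p} \<union> B)" by (rule paired_insert_pair(1)[OF B(1) s])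
        show "card ({p, Suc p} \<union> B) = 2 * k" using paired_insert_pair(2)[OF B(1) s] B(2) Suc by simp
        show "Z \<subseteq> {p, Suc p} \<union> B" using B(3) by auto
        have "Suc p < q" using less.prems(2) Suc by simp
        then show "{p, Suc p} \<union> B \<subseteq> {p..<q}" using B(4) by auto
      qed
    next
      case False
      show ?thesis
      proof (cases "Suc p + 2 * k \<le> q")
        case True
        have "Z \<subseteq> {Suc p..<q}" using less.prems(1) False by (auto simp: Suc_le_eq le_less subset_iff)
        moreover have "q - Suc p < q - p" using True by simp
        ultimately obtain B where B: "paired B" "card B = 2 * k" "Z \<subseteq> B" "B \<subseteq> {Suc p..<q}"
          using less.hyps[OF _ _ True less.prems(3-5)] by blast
        then show ?thesis by (intro exI[of _ B]) auto
      next
        case False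
        then have q: "q = p + 2 * k" using less.prems(2) by simp
        have "paired {p..<q}" unfolding paired_def
        proof (intro conjI allI impI)
          fix z assume z: "z \<notin> {p..<q}"
          then have "z < p \<or> q \<le> z" by auto
          then show "even (pos {p..<q} z)" using q by (auto simp: pos_interval_less)
        qed simp
        then show ?thesis using q less.prems(1) by (intro exI[of _ "{p..<q}"]) auto
      qed
    qed
  qed
qed

text \<open>The data available for a window: hyperplanes that support the points and touch exactly
  the paired sets. Nothing is assumed about other facets of the hull.\<close>

locale cyclic_points =
  fixes N m :: nat and w :: "nat \<Rightarrow> 'a::euclidean_space"
  assumes m1: "1 \<le> m" and N: "2 * m < N" and inj: "inj_on w {..<N}"
    and dim: "aff_dim (w ` {..<N}) \<le> 2 * int m"
    and support: "paired B \<Longrightarrow> card B = 2 * m \<Longrightarrow> B \<subseteq> {..<N} \<Longrightarrow>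
      \<exists>a b. (\<forall>i<N. a \<bullet> w i \<le> b) \<and> (\<forall>i<N. a \<bullet> w i = b \<longleftrightarrow> i \<in> B)"
    and indep: "paired B \<Longrightarrow> card B = 2 * m \<Longrightarrow> B \<subseteq> {..<N} \<Longrightarrow> \<not> affine_dependent (w ` B)"
begin

text \<open>Coefficients vanish outside \<open>{..<N}\<close>, so that sets such as
  \<open>{i. l i < 0}\<close> are finite without an explicit bound on the index.\<close>

definition dep :: "(nat \<Rightarrow> real) \<Rightarrow> bool" where
  "dep l \<longleftrightarrow> (\<forall>i. l i \<noteq> 0 \<longrightarrow> i < N) \<and> (\<Sum>i<N. l i) = 0 \<and> (\<Sum>i<N. l i *\<^sub>R w i) = 0 \<and> (\<exists>i. l i \<noteq> 0)"

lemma dep_finite: "dep l \<Longrightarrow> finite {i. l i \<noteq> 0}"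
  by (rule finite_subset[of _ "{..<N}"]) (auto simp: dep_def)

lemma dep_uminus: "dep l \<Longrightarrow> dep (\<lambda>i. - l i)"
  by (simp add: dep_def sum_negf)

lemma dep_functional:
  assumes "dep l" shows "(\<Sum>i<N. l i * (a \<bullet> w i - b)) = 0"
proof -
  have "(\<Sum>i<N. l i * (a \<bullet> w i - b)) = a \<bullet> (\<Sum>i<N. l i *\<^sub>R w i) - b * (\<Sum>i<N. l i)"
    by (simp add: inner_sum_right sum_subtractf sum_distrib_left algebra_simps)
  then show ?thesis using assms by (simp add: dep_def)
qed

lemma dep_affine_dependent:
  assumes l: "dep l" and X: "{i. l i \<noteq> 0} \<subseteq> X" "X \<subseteq> {..<N}"
  shows "affine_dependent (w ` X)"
proof -
  have f: "finite X" using X(2) finite_subset by blast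
  have iX: "inj_on w X" using inj X(2) inj_on_subset by blast
  let ?U = "\<lambda>v. l (the_inv_into X w v)"
  have U: "?U (w i) = l i" if "i \<in> X" for i by (simp add: the_inv_into_f_f[OF iX that])
  have s: "(\<Sum>i\<in>X. g i) = (\<Sum>i<N. g i)" if "\<And>i. l i = 0 \<Longrightarrow> g i = 0" for g :: "nat \<Rightarrow> 'b::comm_monoid_add"
    by (rule sum.mono_neutral_left) (use X that in auto)
  have "sum ?U (w ` X) = 0"
    using l s[of l] U by (simp add: sum.reindex[OF iX] dep_def)
  moreover have "(\<Sum>v\<in>w ` X. ?U v *\<^sub>R v) = 0"
    using l s[of "\<lambda>i. l i *\<^sub>R w i"] U by (simp add: sum.reindex[OF iX] dep_def)
  moreover have "\<exists>v\<in>w ` X. ?U v \<noteq> 0"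
    using l X(1) U by (auto simp: dep_def)
  ultimately show ?thesis
    using affine_dependent_explicit_finite[of "w ` X"] f by (auto intro!: exI[of _ ?U])
qed

lemma affine_dependent_dep:
  assumes "affine_dependent (w ` X)" "X \<subseteq> {..<N}"
  shows "\<exists>l. dep l \<and> {i. l i \<noteq> 0} \<subseteq> X"
proof -
  have f: "finite (w ` X)" using assms(2) finite_subset by blast
  have iX: "inj_on w X" using inj assms(2) inj_on_subset by blast
  obtain U where U: "sum U (w ` X) = 0" "\<exists>v\<in>w ` X. U v \<noteq> 0" "(\<Sum>v\<in>w ` X. U v *\<^sub>R v) = 0"
    using assms(1) affine_dependent_explicit_finite[OF f] by blast
  define l where "l i = (if i \<in> X then U (w i) else 0)" for i
  have "(\<Sum>i<N. l i) = (\<Sum>i\<in>X. U (w i))"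
    by (rule sum.mono_neutral_cong_right) (use assms(2) in \<open>auto simp: l_def\<close>)
  moreover have "(\<Sum>i<N. l i *\<^sub>R w i) = (\<Sum>i\<in>X. U (w i) *\<^sub>R w i)"
    by (rule sum.mono_neutral_cong_right) (use assms(2) in \<open>auto simp: l_def\<close>)
  ultimately have "dep l"
    using U assms(2) by (auto simp: dep_def l_def sum.reindex[OF iX])
  moreover have "{i. l i \<noteq> 0} \<subseteq> X" by (auto simp: l_def)
  ultimately show ?thesis by blast
qed

text \<open>The functional supporting at \<open>B\<close> is nonpositive and vanishes only on
  \<open>B\<close>. If \<open>l\<close> were nonnegative off \<open>B\<close>, all terms of its zero
  weighted sum would be nonpositive, hence zero, and \<open>l\<close> would be a dependency on the
  independent set \<open>B\<close>.\<close>

lemma neg_not_covered: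
  assumes l: "dep l" and B: "paired B" "card B = 2 * m" "B \<subseteq> {..<N}"
  shows "\<not> {i. l i < 0} \<subseteq> B"
proof
  assume s: "{i. l i < 0} \<subseteq> B"
  obtain a b where ab: "\<forall>i<N. a \<bullet> w i \<le> b" "\<forall>i<N. a \<bullet> w i = b \<longleftrightarrow> i \<in> B" using support[OF B] by blast
  have nonpos: "l i * (a \<bullet> w i - b) \<le> 0" if "i < N" for i
  proof (cases "i \<in> B")
    case False
    then have "\<not> l i < 0" using s by blast
    then show ?thesis using ab(1) that by (simp add: mult_nonneg_nonpos)
  next
    case True
    then have "a \<bullet> w i = b" using ab(2) that by blast
    then show ?thesis by simp
  qed
  have "l i = 0" if "i < N" "i \<notin> B" for i
  proof -
    have "\<forall>i\<in>{..<N}. - (l i * (a \<bullet> w i - b)) = 0"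
      using nonpos dep_functional[OF l, of a b]
      by (subst sum_nonneg_eq_0_iff[symmetric]) (auto simp: sum_negf)
    then have "l i * (a \<bullet> w i - b) = 0" using that(1) by simp
    then show ?thesis using ab(2) that by simp
  qed
  then have "{i. l i \<noteq> 0} \<subseteq> B" using l by (auto simp: dep_def)
  from dep_affine_dependent[OF l this B(3)] show False using indep[OF B] by simp
qed

lemma neg_not_pairs:
  assumes l: "dep l" and Y: "finite Y" "card Y \<le> m" "{i. l i < 0} \<subseteq> Y \<union> Suc ` Y"
  shows False
proof -
  have "{i. l i < 0} \<subseteq> {0..<N}" using l by (auto simp: dep_def)
  from paired_cover[OF this _ Y, of ] N
  obtain B where B: "paired B" "card B = 2 * m" "{i. l i < 0} \<subseteq> B" "B \<subseteq> {0..<N}" by auto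
  then show False using neg_not_covered[OF l B(1,2)] by (auto simp: atLeast0LessThan)
qed

lemma dep_sub_finite: "dep l \<Longrightarrow> finite {i. l i < 0}" "dep l \<Longrightarrow> finite {i. 0 < l i}"
  by (rule finite_subset[OF _ dep_finite], auto)+

lemma card_neg:
  assumes l: "dep l" shows "m < card {i. l i < 0}"
proof (rule ccontr)
  assume "\<not> ?thesis"
  then show False using neg_not_pairs[OF l dep_sub_finite(1)[OF l]] by auto
qed

lemma card_pos: "dep l \<Longrightarrow> m < card {i. 0 < l i}"
  using card_neg[OF dep_uminus, of l] by simp

lemma card_supp:
  assumes l: "dep l"
  shows "card {i. l i \<noteq> 0} = card {i. l i < 0} + card {i. 0 < l i}"
proof -
  have "{i. l i \<noteq> 0} = {i. l i < 0} \<union> {i. 0 < l i}" by auto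
  then show ?thesis using dep_sub_finite[OF l] by (simp add: card_Un_disjoint disjoint_iff)
qed

text \<open>Both sign classes exceed \<open>m\<close>, since a dependency may be negated. The points
  are thus in general position with respect to dimension \<open>2 * m\<close>.\<close>

lemma supp_big: "dep l \<Longrightarrow> 2 * m + 2 \<le> card {i. l i \<noteq> 0}"
  using card_neg[of l] card_pos[of l] card_supp[of l] by simp

lemma small_independent:
  assumes "X \<subseteq> {..<N}" "card X \<le> 2 * m + 1" shows "\<not> affine_dependent (w ` X)"
proof
  assume "affine_dependent (w ` X)"
  then obtain l where l: "dep l" "{i. l i \<noteq> 0} \<subseteq> X" using affine_dependent_dep assms(1) by blast
  have "finite X" using assms(1) finite_subset by blast
  then have "card {i. l i \<noteq> 0} \<le> card X" using l(2) by (rule card_mono)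
  then show False using supp_big[OF l(1)] assms(2) by simp
qed

lemma circuit_exists:
  assumes X: "X \<subseteq> {..<N}" "card X = 2 * m + 2"
  obtains l where "dep l" "{i. l i \<noteq> 0} = X"
proof -
  have f: "finite X" using X finite_subset by blast
  have "card (w ` X) = 2 * m + 2" using card_image[of w X] inj X inj_on_subset by metis
  moreover have "aff_dim (w ` X) \<le> 2 * int m"
    using aff_dim_subset[of "w ` X" "w ` {..<N}"] X dim by (meson image_mono order_trans)
  ultimately have "affine_dependent (w ` X)" using affine_independent_iff_card[of "w ` X"] by auto
  then obtain l where l: "dep l" "{i. l i \<noteq> 0} \<subseteq> X" using affine_dependent_dep X(1) by blast
  then have "{i. l i \<noteq> 0} = X" using supp_big[OF l(1)] X(2) f by (intro card_seteq) auto
  then show ?thesis using that l(1) by blast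
qed

text \<open>There are at most \<open>m + 1\<close> negative indices, and two adjacent ones share a
  pair, so \<open>m\<close> pairs would cover them all.\<close>

lemma no_adjacent_neg:
  assumes l: "dep l" "card {i. l i \<noteq> 0} \<le> 2 * m + 2" and i: "l i < 0" "l (Suc i) < 0"
  shows False
proof (rule neg_not_pairs[OF l(1)])
  let ?Y = "{i. l i < 0} - {Suc i}"
  have f: "finite {i. l i < 0}" by (rule dep_sub_finite[OF l(1)])
  show "finite ?Y" using f by simp
  have "card {i. l i < 0} \<le> m + 1" using card_supp[OF l(1)] card_pos[OF l(1)] l(2) by simp
  then show "card ?Y \<le> m" using f i(2) by simp
  show "{i. l i < 0} \<subseteq> ?Y \<union> Suc ` ?Y" using i by auto
qed

text \<open>Replace \<open>i\<close> by \<open>i + 1\<close> in the support and let \<open>u\<close> be the resulting circuit, negative at \<open>i + 1\<close>.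
  Either \<open>u\<close> is again a counterexample with a smaller gap, or a positive multiple of \<open>u\<close> cancels a
  coefficient of \<open>l\<close> and leaves a circuit that is negative at the adjacent indices \<open>i\<close>, \<open>i + 1\<close>.\<close>

lemma no_consecutive_neg:
  assumes "dep l" "card {i. l i \<noteq> 0} = 2 * m + 2" "i < j" "l i < 0" "l j < 0" "\<And>k. i < k \<Longrightarrow> k < j \<Longrightarrow> l k = 0"
  shows False
  using assms
proof (induction "j - i" arbitrary: i j l rule: less_induct)
  case less
  note l = less.prems
  show ?case
  proof (cases "j = Suc i")
    case True
    then show ?thesis using no_adjacent_neg[OF l(1)] l(2,4,5) by simp
  next
    case False
    define x where "x = Suc i"
    have xj: "x < j" "i < x" using False l(3) by (auto simp: x_def)
    have lx: "l x = 0" using l(6) xj by blast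
    have jN: "j < N" "i < N" using l(1,4,5) by (auto simp: dep_def)
    let ?S = "{i. l i \<noteq> 0}"
    let ?X = "insert x (?S - {i})"
    have fS: "finite ?S" by (rule dep_finite[OF l(1)])
    have "?X \<subseteq> {..<N}" using l(1) xj jN by (auto simp: dep_def)
    moreover have "card ?X = 2 * m + 2"
    proof -
      have "card (?S - {i}) = 2 * m + 1" using fS l(2,4) by simp
      then show ?thesis using fS lx by simp
    qed
    ultimately obtain r where r: "dep r" "{i. r i \<noteq> 0} = ?X" by (rule circuit_exists)
    define u where "u = (if r x < 0 then r else (\<lambda>i. - r i))"
    have u: "dep u" using r(1) dep_uminus by (simp add: u_def)
    have us: "{i. u i \<noteq> 0} = ?X" using r(2) by (simp add: u_def)
    have ux: "u x < 0"
    proof -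
      have "r x \<noteq> 0" using r(2) by blast
      then show ?thesis by (simp add: u_def)
    qed
    have umem: "u k \<noteq> 0 \<longleftrightarrow> k \<in> ?X" for k using us by (auto simp only: set_eq_iff mem_Collect_eq)
    have ui: "u i = 0" using umem[of i] xj by simp
    show ?thesis
    proof (cases "\<exists>k. l k * u k < 0")
      case False
      have "u j \<noteq> 0" using umem[of j] l(3,5) by simp
      moreover have "0 \<le> l j * u j" using False by (simp add: not_less)
      ultimately have uj: "u j < 0" using l(5) by (simp add: zero_le_mult_iff)
      have "u k = 0" if "x < k" "k < j" for k
      proof -
        have "l k = 0" using l(6) that xj by simp
        then have "k \<notin> ?X" using that by simp
        then show ?thesis using umem by blast
      qed
      moreover have "card {i. u i \<noteq> 0} = 2 * m + 2" using us \<open>card ?X = 2 * m + 2\<close> by simp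
      moreover have "j - x < j - i" using xj by simp
      ultimately show ?thesis using less.hyps[of j x u] xj u ux uj by blast
    next
      case True
      then obtain k0 where k0: "l k0 * u k0 < 0" by blast
      define t where "t = - l k0 / u k0"
      have tpos: "0 < t" using k0 by (auto simp: t_def mult_less_0_iff zero_less_divide_iff divide_less_0_iff)
      define v where "v k = l k + t * u k" for k
      have vk0: "v k0 = 0" using k0 by (auto simp: v_def t_def)
      have vi: "v i < 0" using ui l(4) by (simp add: v_def)
      have vx: "v x < 0" using lx tpos ux by (simp add: v_def mult_pos_neg)
      have "(\<Sum>i<N. v i) = 0" using l(1) u by (simp add: v_def dep_def sum.distrib flip: sum_distrib_left)
      moreover have "(\<Sum>i<N. v i *\<^sub>R w i) = 0"
      proof -
        have "(\<Sum>i<N. v i *\<^sub>R w i) = (\<Sum>i<N. l i *\<^sub>R w i) + t *\<^sub>R (\<Sum>i<N. u i *\<^sub>R w i)"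
          by (simp add: v_def scaleR_add_left sum.distrib scaleR_sum_right)
        then show ?thesis using l(1) u by (simp add: dep_def)
      qed
      moreover have "i < N" if "v i \<noteq> 0" for i
        using that l(1) u by (cases "l i = 0") (auto simp: v_def dep_def)
      moreover have "v i \<noteq> 0" using vi by simp
      ultimately have v: "dep v" unfolding dep_def by blast
      have "{k. v k \<noteq> 0} \<subseteq> insert x (?S - {k0})"
      proof
        fix k assume k: "k \<in> {k. v k \<noteq> 0}"
        then have "k \<noteq> k0" using vk0 by auto
        moreover have "k = x \<or> l k \<noteq> 0"
        proof (rule ccontr)
          assume n: "\<not> (k = x \<or> l k \<noteq> 0)"
          then have "k \<notin> ?X" by simp
          then have "u k = 0" using umem by blast
          then show False using k n by (simp add: v_def)
        qed
        ultimately show "k \<in> insert x (?S - {k0})" by simp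
      qed
      then have "card {k. v k \<noteq> 0} \<le> card (insert x (?S - {k0}))" using fS by (intro card_mono) auto
      also have "\<dots> \<le> Suc (card (?S - {k0}))" by (rule card_insert_le_m1) auto
      also have "\<dots> = 2 * m + 2"
      proof -
        have "k0 \<in> ?S" using k0 by auto
        then show ?thesis using fS l(2) by simp
      qed
      finally show ?thesis using no_adjacent_neg[OF v] vi vx by (simp add: x_def)
    qed
  qed
qed

lemma alternating:
  assumes l: "dep l" "card {i. l i \<noteq> 0} = 2 * m + 2" and ij: "i < j" "l i \<noteq> 0" "l j \<noteq> 0"
    and z: "\<And>k. i < k \<Longrightarrow> k < j \<Longrightarrow> l k = 0"
  shows "l i * l j < 0"
proof (rule ccontr)
  assume "\<not> ?thesis"
  then consider "l i < 0" "l j < 0" | "0 < l i" "0 < l j"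
    using ij by (auto simp: mult_less_0_iff not_less)
  then show False
  proof cases
    case 1 then show ?thesis using no_consecutive_neg[OF l ij(1)] z by blast
  next
    case 2 then show ?thesis
      using no_consecutive_neg[OF dep_uminus[OF l(1)], of i j] l(2) ij(1) z by simp
  qed
qed

lemma sign_parity:
  assumes l: "dep l" "card {i. l i \<noteq> 0} = 2 * m + 2" and k: "l k \<noteq> 0"
  shows "0 < l k \<longleftrightarrow> (even (pos {i. l i \<noteq> 0} k) \<longleftrightarrow> 0 < l (Min {i. l i \<noteq> 0}))"
  using k
proof (induction "pos {i. l i \<noteq> 0} k" arbitrary: k)
  case 0
  let ?S = "{i. l i \<noteq> 0}"
  have f: "finite ?S" by (rule dep_finite[OF l(1)])
  have "Min ?S \<in> ?S" using f 0 by (intro Min_in) auto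
  moreover have "Min ?S \<le> k" using f 0 by simp
  ultimately have "k = Min ?S" using 0 pos_less[of "Min ?S" ?S k] by (cases "k = Min ?S") auto
  then show ?case using 0 by simp
next
  case (Suc p)
  let ?S = "{i. l i \<noteq> 0}"
  have f: "finite ?S" by (rule dep_finite[OF l(1)])
  have "p < card ?S" using pos_less_card[OF f, of k] Suc by simp
  then obtain u where u: "u \<in> ?S" "pos ?S u = p" using pos_surj[OF f] by blast
  have uk: "u < k" using pos_less_iff[OF u(1), of k] Suc u by simp
  have "l z = 0" if "u < z" "z < k" for z
  proof (rule ccontr)
    assume "l z \<noteq> 0"
    then have "pos ?S u < pos ?S z" "pos ?S z < pos ?S k" using pos_less[of u ?S z] pos_less[of z ?S k] u that by auto
    then show False using u Suc by simp
  qed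
  then have "l u * l k < 0" using alternating[OF l uk] u Suc by blast
  then have "0 < l k \<longleftrightarrow> \<not> 0 < l u" by (auto simp: mult_less_0_iff)
  moreover have "0 < l u \<longleftrightarrow> (even p \<longleftrightarrow> 0 < l (Min ?S))" using Suc.hyps(1)[of u] u by simp
  ultimately show ?case using Suc.hyps(2)[symmetric] by auto
qed

end

section \<open>Vertices and facets of polytopes\<close>

lemma polytope_hull_vertices: "polytope P \<Longrightarrow> P = convex hull vertices P"
  unfolding vertices_def by (rule Krein_Milman_Minkowski) (auto simp: polytope_imp_compact polytope_imp_convex)

lemma vertices_face: "F face_of P \<Longrightarrow> vertices F = vertices P \<inter> F"
  using extreme_point_of_face[of F P] by (auto simp: vertices_def)

lemma vertices_hull_subset: "vertices (convex hull S) \<subseteq> S"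
  by (auto simp: vertices_def extreme_points_of_convex_hull extreme_point_of_convex_hull)

lemma face_hull:
  assumes "polytope P" "F face_of P" shows "F = convex hull (vertices P \<inter> F)"
  using polytope_hull_vertices[OF face_of_polytope_polytope[OF assms]] vertices_face[OF assms(2)] by simp

lemma facet_supporting:
  assumes "polyhedron P" "F facet_of P"
  obtains a b where "P \<subseteq> {x. a \<bullet> x \<le> b}" "F = P \<inter> {x. a \<bullet> x = b}"
proof -
  have "F exposed_face_of P"
    using assms exposed_face_of_polyhedron facet_of_imp_face_of by blast
  then show ?thesis using that unfolding exposed_face_of_def by blast
qed

context cyclic_points
begin

text \<open>A representation of \<open>w k\<close> as a convex combination of other points is a
  dependency with one negative coefficient, while more than \<open>m >= 1\<close> are
  required.\<close>

lemma extreme_points: "i < N \<Longrightarrow> w i extreme_point_of (convex hull (w ` {..<N}))"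
proof -
  assume i: "i < N"
  have "w k \<notin> convex hull (w ` {..<N} - {w k})" if k: "k < N" for k
  proof
    assume h: "w k \<in> convex hull (w ` {..<N} - {w k})"
    have ik: "inj_on w ({..<N} - {k})" using inj by (rule inj_on_subset) auto
    have im: "w ` {..<N} - {w k} = w ` ({..<N} - {k})"
      using inj_on_image_set_diff[OF inj, of "{..<N}" "{k}"] k by simp
    obtain u where u: "\<forall>x\<in>w ` ({..<N} - {k}). 0 \<le> u x" "sum u (w ` ({..<N} - {k})) = 1"
      "(\<Sum>x\<in>w ` ({..<N} - {k}). u x *\<^sub>R x) = w k"
      using h unfolding im by (subst (asm) convex_hull_finite) auto
    define l where "l j = (if j = k then -1 else if j < N then u (w j) else 0)" for j
    have e: "{..<N} = insert k ({..<N} - {k})" using k by auto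
    have "(\<Sum>j<N. l j) = -1 + (\<Sum>j\<in>{..<N} - {k}. l j)" by (subst e, subst sum.insert) (auto simp: l_def)
    also have "(\<Sum>j\<in>{..<N} - {k}. l j) = (\<Sum>j\<in>{..<N} - {k}. u (w j))" by (rule sum.cong) (auto simp: l_def)
    finally have s1: "(\<Sum>j<N. l j) = 0" using u(2) by (simp add: sum.reindex[OF ik])
    have "(\<Sum>j<N. l j *\<^sub>R w j) = - w k + (\<Sum>j\<in>{..<N} - {k}. l j *\<^sub>R w j)"
      by (subst e, subst sum.insert) (auto simp: l_def)
    also have "(\<Sum>j\<in>{..<N} - {k}. l j *\<^sub>R w j) = (\<Sum>j\<in>{..<N} - {k}. u (w j) *\<^sub>R w j)"
      by (rule sum.cong) (auto simp: l_def)
    finally have s2: "(\<Sum>j<N. l j *\<^sub>R w j) = 0" using u(3) by (simp add: sum.reindex[OF ik])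
    have "l k \<noteq> 0" by (simp add: l_def)
    then have "dep l" using s1 s2 k by (auto simp: dep_def l_def)
    then have "m < card {j. l j < 0}" by (rule card_neg)
    moreover have "{j. l j < 0} \<subseteq> {k}"
    proof
      fix j assume j: "j \<in> {j. l j < 0}"
      show "j \<in> {k}"
      proof (rule ccontr)
        assume "j \<notin> {k}"
        then have "j \<noteq> k" "j < N" "u (w j) < 0" using j by (auto simp: l_def split: if_splits)
        then show False using u(1) by force
      qed
    qed
    then have "card {j. l j < 0} \<le> card {k}" by (intro card_mono) auto
    ultimately show False using m1 by simp
  qed
  then show ?thesis
    using extreme_point_of_convex_hull_convex_independent[of "w ` {..<N}" "w i"] i
    by (auto intro: finite_imp_compact)
qed

lemma vertices_hull: "vertices (convex hull (w ` {..<N})) = w ` {..<N}"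
  using vertices_hull_subset[of "w ` {..<N}"] extreme_points by (auto simp: vertices_def)

text \<open>General position and the dimension give exactly \<open>2 * m\<close> vertices. For Gale
  evenness, test the circuit on \<open>Y\<close> and two further indices \<open>u\<close>,
  \<open>v\<close> with the facet functional: the terms on \<open>Y\<close> vanish and both points
  lie strictly on one side, so the coefficients at \<open>u\<close> and \<open>v\<close> have
  opposite signs. As signs alternate, evenly many elements of \<open>Y\<close> lie between.\<close>

lemma hull_facet:
  assumes D: "aff_dim (w ` {..<N}) = 2 * int m" and F: "F facet_of (convex hull (w ` {..<N}))"
  shows "int (2 * m - 1) simplex F" "gale_subset (map w [0..<N]) (vertices F)"
proof -
  let ?C = "convex hull (w ` {..<N})"
  have pC: "polytope ?C" by (rule polytope_convex_hull) simp
  obtain a b where ab: "?C \<subseteq> {x. a \<bullet> x \<le> b}" "F = ?C \<inter> {x. a \<bullet> x = b}"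
    using facet_supporting[OF polytope_imp_polyhedron[OF pC] F] by blast
  have wC: "w i \<in> ?C" if "i < N" for i using that by (simp add: hull_inc)
  have le: "a \<bullet> w i \<le> b" if "i < N" for i using ab(1) wC[OF that] by auto
  define Y where "Y = {i. i < N \<and> a \<bullet> w i = b}"
  have YN: "Y \<subseteq> {..<N}" by (auto simp: Y_def)
  then have fY: "finite Y" using finite_subset by blast
  have vF: "vertices F = w ` Y"
    using vertices_face[OF facet_of_imp_face_of[OF F]] wC ab(2) vertices_hull by (auto simp: Y_def)
  have FY: "F = convex hull (w ` Y)"
    using face_hull[OF pC facet_of_imp_face_of[OF F]] vertices_face[OF facet_of_imp_face_of[OF F]] vF by simp
  have dF: "aff_dim (w ` Y) = 2 * int m - 1"
    using F D FY by (simp add: facet_of_def aff_dim_convex_hull)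
  have inj': "X \<subseteq> {..<N} \<Longrightarrow> card (w ` X) = card X" for X
    using inj card_image inj_on_subset by blast
  have ind: "aff_dim (w ` X) = int (card X) - 1" if X: "X \<subseteq> Y" "card X \<le> 2 * m + 1" for X
    using small_independent[of X] affine_independent_iff_card[of "w ` X"] inj'[of X] X YN by simp
  have "card Y \<le> 2 * m"
  proof (rule ccontr)
    assume "\<not> ?thesis"
    then obtain X where X: "X \<subseteq> Y" "card X = 2 * m + 1" "finite X"
      using obtain_subset_with_card_n[of "2 * m + 1" Y] by auto
    then have "aff_dim (w ` X) = 2 * int m" using ind[of X] by simp
    moreover have "aff_dim (w ` X) \<le> aff_dim (w ` Y)" using X by (intro aff_dim_subset) auto
    ultimately show False using dF by simp
  qed
  then have cY: "card Y = 2 * m" using ind[of Y] dF by simp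
  show "int (2 * m - 1) simplex F"
    unfolding simplex
    using FY small_independent[OF YN] cY inj'[OF YN] fY m1 by (intro exI[of _ "w ` Y"]) auto
  have parity: "even (card {c. u < c \<and> c < v \<and> c \<in> Y})" if uv: "u < v" "v < N" "u \<notin> Y" "v \<notin> Y" for u v
  proof -
    let ?X = "insert u (insert v Y)"
    have XN: "?X \<subseteq> {..<N}" using uv YN by auto
    have cX: "card ?X = 2 * m + 2" using uv fY cY by simp
    obtain l where l: "dep l" "{i. l i \<noteq> 0} = ?X" using circuit_exists[OF XN cX] .
    have lm: "l i \<noteq> 0 \<longleftrightarrow> i \<in> ?X" for i using l(2) by (simp only: set_eq_iff mem_Collect_eq)
    have "(\<Sum>i<N. l i * (a \<bullet> w i - b)) = (\<Sum>i\<in>{u, v}. l i * (a \<bullet> w i - b))"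
    proof (rule sum.mono_neutral_right)
      show "\<forall>i\<in>{..<N} - {u, v}. l i * (a \<bullet> w i - b) = 0"
      proof
        fix i assume i: "i \<in> {..<N} - {u, v}"
        show "l i * (a \<bullet> w i - b) = 0"
        proof (cases "i \<in> Y")
          case True then show ?thesis by (simp add: Y_def)
        next
          case False
          then have "l i = 0" using lm[of i] i by auto
          then show ?thesis by simp
        qed
      qed
    qed (use uv in auto)
    then have z: "l u * (a \<bullet> w u - b) + l v * (a \<bullet> w v - b) = 0"
      using dep_functional[OF l(1), of a b] uv(1) by simp
    have cu: "a \<bullet> w u - b < 0" and cv: "a \<bullet> w v - b < 0"
      using le[of u] le[of v] uv by (auto simp: Y_def order_le_less)
    have nz: "l u \<noteq> 0" "l v \<noteq> 0" using lm by auto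
    have "0 < l u \<longleftrightarrow> \<not> 0 < l v"
    proof
      assume "0 < l u"
      then have "l u * (a \<bullet> w u - b) < 0" using cu by (rule mult_pos_neg)
      then have "0 < l v * (a \<bullet> w v - b)" using z by linarith
      then show "\<not> 0 < l v" using cv by (auto simp: zero_less_mult_iff)
    next
      assume "\<not> 0 < l v"
      then have "l v < 0" using nz by simp
      then have "0 < l v * (a \<bullet> w v - b)" using cv by (rule mult_neg_neg)
      then have "l u * (a \<bullet> w u - b) < 0" using z by linarith
      then show "0 < l u" using cu by (auto simp: mult_less_0_iff)
    qed
    moreover have cl: "card {i. l i \<noteq> 0} = 2 * m + 2" using l(2) cX by simp
    ultimately have "even (pos ?X u) \<noteq> even (pos ?X v)"
      using sign_parity[OF l(1) cl nz(1)] sign_parity[OF l(1) cl nz(2)] l(2) by auto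
    moreover have "pos ?X v = pos ?X u + card (?X \<inter> {u..<v})" using uv by (intro pos_split) simp
    moreover have "?X \<inter> {u..<v} = insert u {c. u < c \<and> c < v \<and> c \<in> Y}" using uv by (auto simp: order_le_less)
    moreover have "finite {c. u < c \<and> c < v \<and> c \<in> Y}" using fY by (rule rev_finite_subset) auto
    ultimately have "even (pos ?X u) \<noteq> even (pos ?X u + Suc (card {c. u < c \<and> c < v \<and> c \<in> Y}))"
      by simp
    then show ?thesis by (metis even_Suc even_add)
  qed
  show "gale_subset (map w [0..<N]) (vertices F)"
    unfolding gale_subset_def
  proof (intro conjI allI impI)
    show "vertices F \<subseteq> set (map w [0..<N])" using vF YN by auto
    fix u v assume uv: "u < v \<and> v < length (map w [0..<N]) \<and>
      map w [0..<N] ! u \<notin> vertices F \<and> map w [0..<N] ! v \<notin> vertices F"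
    have mem: "w c \<in> vertices F \<longleftrightarrow> c \<in> Y" if "c < N" for c
      using that inj YN unfolding vF by (auto simp: inj_on_def)
    have "{c. u < c \<and> c < v \<and> map w [0..<N] ! c \<in> vertices F} = {c. u < c \<and> c < v \<and> c \<in> Y}"
      using uv mem by auto
    then show "even (card {c. u < c \<and> c < v \<and> map w [0..<N] ! c \<in> vertices F})"
      using parity[of u v] uv mem by auto
  qed
qed

lemma hull_cyclic:
  assumes D: "aff_dim (w ` {..<N}) = 2 * int m"
  shows "cyclic_polytope (convex hull (w ` {..<N})) (map w [0..<N])"
proof -
  let ?C = "convex hull (w ` {..<N})"
  have pC: "polytope ?C" by (rule polytope_convex_hull) simp
  have "aff_dim F simplex F" if F: "F facet_of ?C" for F
    using hull_facet(1)[OF D F] aff_dim_simplex by metis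
  then have "simplicial_polytope ?C" using pC by (simp add: simplicial_polytope_def)
  moreover have "vertex_array ?C (map w [0..<N])"
    unfolding vertex_array_def using vertices_hull inj by (auto simp: distinct_map atLeast0LessThan)
  ultimately show ?thesis
    using pC hull_facet(2)[OF D] by (simp add: cyclic_polytope_def gale_polytope_def)
qed

lemma hull_dim: "aff_dim (w ` {..<N}) = 2 * int m"
proof -
  obtain X where X: "X \<subseteq> {..<N}" "card X = 2 * m + 1"
    using obtain_subset_with_card_n[of "2 * m + 1" "{..<N}"] N by auto
  have "card (w ` X) = 2 * m + 1" using card_image[of w X] inj X inj_on_subset by metis
  then have "aff_dim (w ` X) = 2 * int m"
    using small_independent[OF X(1)] X(2) affine_independent_iff_card[of "w ` X"] by simp
  moreover have "aff_dim (w ` X) \<le> aff_dim (w ` {..<N})" using X by (intro aff_dim_subset) auto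
  ultimately show ?thesis using dim by simp
qed

end

section \<open>From polytopes to index sets\<close>

lemma sorted_nth_pos:
  assumes "finite Z" "t < card Z"
  shows "sorted_list_of_set Z ! t \<in> Z" "pos Z (sorted_list_of_set Z ! t) = t"
proof -
  let ?L = "sorted_list_of_set Z"
  have len: "length ?L = card Z" by simp
  have set: "set ?L = Z" using assms(1) by simp
  have ss: "sorted_wrt (<) ?L" by (rule strict_sorted_list_of_set)
  have lt: "?L ! s < ?L ! t \<longleftrightarrow> s < t" if "s < card Z" for s
    using sorted_wrt_nth_less[OF ss, of s t] sorted_wrt_nth_less[OF ss, of t s] that assms(2) len
    by (metis linorder_less_linear order_less_asym)
  show "?L ! t \<in> Z" using assms len set nth_mem by metis
  have "Z \<inter> {..<?L ! t} = (!) ?L ` {..<t}"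
  proof
    show "(!) ?L ` {..<t} \<subseteq> Z \<inter> {..<?L ! t}"
      using lt assms(2) len set nth_mem by fastforce
    show "Z \<inter> {..<?L ! t} \<subseteq> (!) ?L ` {..<t}"
    proof
      fix y assume y: "y \<in> Z \<inter> {..<?L ! t}"
      then obtain s where "s < card Z" "?L ! s = y" using set len by (metis IntD1 in_set_conv_nth)
      then show "y \<in> (!) ?L ` {..<t}" using lt[of s] y by auto
    qed
  qed
  moreover have "inj_on ((!) ?L) {..<t}"
    using assms(2) len by (intro inj_on_nth) auto
  ultimately show "pos Z (?L ! t) = t" by (simp add: pos_def card_image)
qed

lemma sorted_nth_image:
  assumes "finite Z" "A \<subseteq> {..<card Z}"
  shows "(!) (sorted_list_of_set Z) ` A = {y \<in> Z. pos Z y \<in> A}"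
proof
  show "(!) (sorted_list_of_set Z) ` A \<subseteq> {y \<in> Z. pos Z y \<in> A}"
    using sorted_nth_pos[OF assms(1)] assms(2) by auto
  show "{y \<in> Z. pos Z y \<in> A} \<subseteq> (!) (sorted_list_of_set Z) ` A"
  proof
    fix y assume y: "y \<in> {y \<in> Z. pos Z y \<in> A}"
    let ?t = "pos Z y"
    have t: "?t < card Z" using pos_less_card[OF assms(1)] y by simp
    have "sorted_list_of_set Z ! ?t = y"
      using inj_onD[OF inj_pos, of Z "sorted_list_of_set Z ! ?t" y] sorted_nth_pos[OF assms(1) t] y by simp
    then show "y \<in> (!) (sorted_list_of_set Z) ` A" using y by (metis (mono_tags) imageI mem_Collect_eq)
  qed
qed

text \<open>The two cases differ because for \<open>j = m\<close> the clipped index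
  \<open>m + 1\<close> restores the omitted position.\<close>

lemma clip_window:
  fixes j e m :: nat
  assumes "3 \<le> e" "2 \<le> j" "j \<le> m"
  defines "K \<equiv> insert 0 ((\<lambda>t. nat (max 0 (min t (int m)))) ` ({int j - int e + 2..int j + int e - 2} - {int j}))"
  shows "j < m \<Longrightarrow> K = {t. t \<le> m \<and> t \<noteq> j \<and> (t = 0 \<or> t \<le> j + (e - 2) \<and> j \<le> t + (e - 2))}"
    and "j = m \<Longrightarrow> K = {t. t \<le> m \<and> (t = 0 \<or> m + 1 \<le> t + (e - 1))}"
proof -
  have img: "t \<in> K" if "s \<in> {int j - int e + 2..int j + int e - 2} - {int j}" "t = nat (max 0 (min s (int m)))" for s t
    using that unfolding K_def by blast
  show "K = {t. t \<le> m \<and> t \<noteq> j \<and> (t = 0 \<or> t \<le> j + (e - 2) \<and> j \<le> t + (e - 2))}" if jm: "j < m"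
  proof
    show "K \<subseteq> {t. t \<le> m \<and> t \<noteq> j \<and> (t = 0 \<or> t \<le> j + (e - 2) \<and> j \<le> t + (e - 2))}"
      unfolding K_def using assms(1,2) jm by (auto simp: max_def min_def nat_le_iff split: if_splits)
    show "{t. t \<le> m \<and> t \<noteq> j \<and> (t = 0 \<or> t \<le> j + (e - 2) \<and> j \<le> t + (e - 2))} \<subseteq> K"
    proof
      fix t assume t: "t \<in> {t. t \<le> m \<and> t \<noteq> j \<and> (t = 0 \<or> t \<le> j + (e - 2) \<and> j \<le> t + (e - 2))}"
      show "t \<in> K"
      proof (cases "t = 0")
        case True then show ?thesis by (simp add: K_def)
      next
        case False
        then have "int t \<in> {int j - int e + 2..int j + int e - 2} - {int j}" using t assms(1) by auto
        moreover have "t = nat (max 0 (min (int t) (int m)))" using t by simp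
        ultimately show ?thesis by (rule img)
      qed
    qed
  qed
  show "K = {t. t \<le> m \<and> (t = 0 \<or> m + 1 \<le> t + (e - 1))}" if jm: "j = m"
  proof
    show "K \<subseteq> {t. t \<le> m \<and> (t = 0 \<or> m + 1 \<le> t + (e - 1))}"
      unfolding K_def using assms(1,2) jm by (auto simp: max_def min_def nat_le_iff split: if_splits)
    show "{t. t \<le> m \<and> (t = 0 \<or> m + 1 \<le> t + (e - 1))} \<subseteq> K"
    proof
      fix t assume t: "t \<in> {t. t \<le> m \<and> (t = 0 \<or> m + 1 \<le> t + (e - 1))}"
      consider "t = 0" | "t = m" | "t \<noteq> 0" "t < m" using t by fastforce
      then show "t \<in> K"
      proof cases
        case 1 then show ?thesis by (simp add: K_def)
      next
        case 2
        show ?thesis by (rule img[of "int m + 1"]) (use 2 jm assms(1) in auto)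
      next
        case 3
        show ?thesis by (rule img[of "int t"]) (use 3 t jm assms(1) in auto)
      qed
    qed
  qed
qed

text \<open>\<open>E_j\<close> with \<open>j < m\<close> becomes \<open>ridge_E\<close> at the
  vertex of position \<open>j\<close>, and \<open>E_m\<close> becomes \<open>ridge_L\<close>.
  Applied both to the facets of the polytope and, for \<open>L = d\<close>, to the polytope
  itself.\<close>

lemma braxtope_ridges:
  fixes f :: "nat \<Rightarrow> 'a::euclidean_space"
  assumes Z: "finite Z" "card Z = m + 1" and e: "3 \<le> e" "e \<le> m"
  defines "ys \<equiv> map f (sorted_list_of_set Z)"
  shows "braxtope_T e ys ` {0..m - e + 1} \<union> braxtope_E e ys ` {2..m} = (\<lambda>R. convex hull (f ` R)) ` {R. ridge e Z R}"
proof -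
  let ?L = "sorted_list_of_set Z"
  have len: "length ys = m + 1" using Z by (simp add: ys_def)
  have nth: "ys ! t = f (?L ! t)" if "t \<le> m" for t using that Z by (simp add: ys_def)
  have im: "(\<lambda>t. ys ! t) ` A = f ` {y \<in> Z. pos Z y \<in> A}" if "A \<subseteq> {..m}" for A
  proof -
    have "(\<lambda>t. ys ! t) ` A = f ` ((!) ?L ` A)" using that nth by (force simp: image_image)
    then show ?thesis using sorted_nth_image[OF Z(1), of A] that Z(2) by (auto simp: lessThan_Suc_atMost)
  qed
  have T0: "braxtope_T e ys i = convex hull (f ` ridge_T e Z i)" if "i \<le> m - e + 1" for i
  proof -
    have "{i..i + e - 1} \<subseteq> {..m}" using that e by auto
    moreover have "{y \<in> Z. pos Z y \<in> {i..i + e - 1}} = ridge_T e Z i" using e by (auto simp: ridge_T_def)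
    ultimately show ?thesis unfolding braxtope_T_def using im[of "{i..i + e - 1}"] by simp
  qed
  let ?K = "\<lambda>j. insert 0 ((\<lambda>t. nat (max 0 (min t (int m)))) ` ({int j - int e + 2..int j + int e - 2} - {int j}))"
  have E: "braxtope_E e ys j = convex hull (f ` {y \<in> Z. pos Z y \<in> ?K j})" for j
  proof -
    have s: "?K j \<subseteq> {..m}" by auto
    have c: "clipped_nth ys t = ys ! nat (max 0 (min t (int m)))" for t
      by (simp add: clipped_nth_def len)
    have "insert (ys ! 0) (clipped_nth ys ` ({int j - int e + 2..int j + int e - 2} - {int j})) = (\<lambda>t. ys ! t) ` ?K j"
      by (simp add: c image_image)
    then show ?thesis unfolding braxtope_E_def using im[OF s] by simp
  qed
  have E1: "braxtope_E e ys j = convex hull (f ` ridge_E e Z x)" if x: "x \<in> Z" "pos Z x = j" and j: "2 \<le> j" "j < m" for j x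
  proof -
    have "{y \<in> Z. pos Z y \<in> ?K j} = ridge_E e Z x"
    proof (rule set_eqI)
      fix y
      have "y \<in> Z \<Longrightarrow> pos Z y \<noteq> j \<longleftrightarrow> y \<noteq> x" using inj_onD[OF inj_pos, of Z y x] x by auto
      moreover have "y \<in> Z \<Longrightarrow> pos Z y \<le> m" using pos_less_card[OF Z(1), of y] Z(2) by simp
      ultimately show "y \<in> {y \<in> Z. pos Z y \<in> ?K j} \<longleftrightarrow> y \<in> ridge_E e Z x"
        using clip_window(1)[OF e(1) j(1) order_less_imp_le[OF j(2)] j(2)] x(2) by (auto simp: ridge_E_def)
    qed
    then show ?thesis using E by simp
  qed
  have E2: "braxtope_E e ys m = convex hull (f ` ridge_L e Z)"
  proof -
    have m2: "2 \<le> m" using e by simp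
    have "{y \<in> Z. pos Z y \<in> ?K m} = ridge_L e Z"
    proof (rule set_eqI)
      fix y
      have "y \<in> Z \<Longrightarrow> pos Z y \<le> m" using pos_less_card[OF Z(1), of y] Z(2) by simp
      then show "y \<in> {y \<in> Z. pos Z y \<in> ?K m} \<longleftrightarrow> y \<in> ridge_L e Z"
        using clip_window(2)[OF e(1) m2 order_refl refl] Z(2) by (auto simp: ridge_L_def)
    qed
    then show ?thesis using E by simp
  qed
  show ?thesis
  proof
    show "braxtope_T e ys ` {0..m - e + 1} \<union> braxtope_E e ys ` {2..m} \<subseteq> (\<lambda>R. convex hull (f ` R)) ` {R. ridge e Z R}"
    proof
      fix G assume "G \<in> braxtope_T e ys ` {0..m - e + 1} \<union> braxtope_E e ys ` {2..m}"
      then have "(\<exists>i. i \<le> m - e + 1 \<and> G = braxtope_T e ys i) \<or> (\<exists>j. 2 \<le> j \<and> j \<le> m \<and> G = braxtope_E e ys j)"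
        by auto
      then show "G \<in> (\<lambda>R. convex hull (f ` R)) ` {R. ridge e Z R}"
      proof (elim disjE exE conjE)
        fix i assume i: "i \<le> m - e + 1" "G = braxtope_T e ys i"
        then have "i + e \<le> card Z" using Z(2) e by simp
        then have "ridge e Z (ridge_T e Z i)" by (rule ridge_TI)
        then show ?thesis using i T0[OF i(1)] by blast
      next
        fix j assume j: "2 \<le> j" "j \<le> m" "G = braxtope_E e ys j"
        show ?thesis
        proof (cases "j = m")
          case True
          then show ?thesis using j(3) E2 ridge_LI by blast
        next
          case False
          then have jm: "j < m" using j(2) by simp
          then have "j < card Z" using Z(2) by simp
          then obtain x where x: "x \<in> Z" "pos Z x = j" by (rule pos_surj[OF Z(1)])
          then have "ridge e Z (ridge_E e Z x)" using j jm Z(2) by (intro ridge_EI) auto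
          then show ?thesis using j(3) E1[OF x j(1) jm] by blast
        qed
      qed
    qed
    show "(\<lambda>R. convex hull (f ` R)) ` {R. ridge e Z R} \<subseteq> braxtope_T e ys ` {0..m - e + 1} \<union> braxtope_E e ys ` {2..m}"
    proof clarify
      fix R assume R: "ridge e Z R" and n: "convex hull (f ` R) \<notin> braxtope_E e ys ` {2..m}"
      from R show "convex hull (f ` R) \<in> braxtope_T e ys ` {0..m - e + 1}"
      proof (cases rule: ridge_cases)
        case (T i)
        note ** = T
        then have "i \<le> m - e + 1" using Z(2) e by simp
        then show ?thesis using T0[of i] **(2) by (intro image_eqI[of _ _ i]) auto
      next
        case L
        have "convex hull (f ` R) = braxtope_E e ys m" using E2 L by simp
        then show ?thesis using n e by auto
      next
        case *: (E x)
        have j: "pos Z x < m" using *(3) Z(2) by simp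
        have "convex hull (f ` R) = braxtope_E e ys (pos Z x)" using E1[OF *(1) refl *(2) j] *(4) by simp
        then show ?thesis using n *(2) j by auto
      qed
    qed
  qed
qed

text \<open>The face \<open>R\<close> is the intersection of the facets containing it, so one of
  them, \<open>G\<close>, does not contain \<open>F\<close>. Then \<open>G \<inter> F\<close> is a
  proper face of \<open>F\<close> containing \<open>R\<close>, and dimension leaves only
  \<open>R\<close>.\<close>

lemma polytope_ridge_neighbour:
  assumes P: "polytope P" and F: "F facet_of P" and R: "R facet_of F"
  shows "\<exists>G. G facet_of P \<and> G \<inter> F = R \<and> R facet_of G"
proof -
  have FP: "F face_of P" and RF: "R face_of F" using F R facet_of_imp_face_of by auto
  have RP: "R face_of P" using face_of_trans[OF RF FP] .
  have nR: "R \<noteq> {}" using R by (simp add: facet_of_def)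
  have dims: "aff_dim F = aff_dim P - 1" "aff_dim R = aff_dim F - 1" using F R by (auto simp: facet_of_def)
  then have "R \<noteq> P" "R \<noteq> F" by auto
  then have Req: "R = \<Inter>{G. G facet_of P \<and> R \<subseteq> G}"
    by (intro face_of_polyhedron[OF polytope_imp_polyhedron[OF P] RP nR])
  have "\<exists>G. G facet_of P \<and> R \<subseteq> G \<and> \<not> F \<subseteq> G"
  proof (rule ccontr)
    assume "\<not> ?thesis"
    then have "F \<subseteq> R" by (subst Req) blast
    then show False using \<open>R \<noteq> F\<close> face_of_imp_subset[OF RF] by blast
  qed
  then obtain G where G: "G facet_of P" "R \<subseteq> G" "\<not> F \<subseteq> G" by blast
  have GP: "G face_of P" using G(1) facet_of_imp_face_of by blast
  have I: "(G \<inter> F) face_of P" by (rule face_of_Int[OF GP FP])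
  have IF: "(G \<inter> F) face_of F" using I by (rule face_of_subset) (use face_of_imp_subset[OF FP] in auto)
  have cF: "convex F" using face_of_imp_convex[OF FP] .
  have "aff_dim (G \<inter> F) < aff_dim F" using face_of_aff_dim_lt[OF cF IF] G(3) by blast
  moreover have RI: "R face_of (G \<inter> F)"
    by (rule face_of_subset[OF RF]) (use G(2) face_of_imp_subset[OF RF] in auto)
  have cI: "convex (G \<inter> F)" using face_of_imp_convex[OF I] .
  have eq: "G \<inter> F = R"
  proof (rule ccontr)
    assume "G \<inter> F \<noteq> R"
    then have "aff_dim R < aff_dim (G \<inter> F)" using face_of_aff_dim_lt[OF cI RI] by blast
    then show False using calculation dims by simp
  qed
  have "R face_of G" by (rule face_of_subset[OF RP G(2)]) (use face_of_imp_subset[OF GP] in auto)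
  then have "R facet_of G" using nR dims G(1) by (simp add: facet_of_def)
  then show ?thesis using G(1) eq by blast
qed

section \<open>The index family of a Gale and braxial polytope\<close>

locale gale_braxial =
  fixes P :: "'a::euclidean_space set" and xs :: "'a list" and d n :: nat
  assumes dP: "d_polytope d P" and va: "vertex_array P xs" and len: "length xs = n + 1"
    and gP: "gale_polytope P xs" and bP: "braxial d P xs"
    and nd: "d + 1 \<le> n" and d6: "6 \<le> d" and ev: "even d"
begin

definition ix :: "'a set \<Rightarrow> nat set" where
  "ix F = {i. i \<le> n \<and> xs ! i \<in> F}"

abbreviation FF :: "nat set set" where
  "FF \<equiv> ix ` {F. F facet_of P}"

lemma polytope_P: "polytope P" and aff_dim_P: "aff_dim P = int d"
  using dP by (auto simp: d_polytope_def)

lemma inj_nth: "inj_on ((!) xs) {..n}"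
  using va len by (auto simp: vertex_array_def intro!: inj_on_nth)

lemma nth_vertices: "(!) xs ` {..n} = vertices P"
proof -
  have "{..n} = {..<length xs}" using len by auto
  then show ?thesis using va by (auto simp: vertex_array_def set_conv_nth)
qed

lemma ix_sub: "ix F \<subseteq> {..n}" by (auto simp: ix_def)

lemma finite_ix: "finite (ix F)" using ix_sub finite_subset by blast

lemma face_vertices: "F face_of P \<Longrightarrow> vertices F = (!) xs ` ix F"
  using vertices_face[of F P] nth_vertices by (auto simp: ix_def)

lemma vertices_ix: "F face_of P \<Longrightarrow> i \<le> n \<Longrightarrow> xs ! i \<in> vertices F \<longleftrightarrow> i \<in> ix F"
  using vertices_face[of F P] nth_vertices by (auto simp: ix_def)

lemma face_ix_hull: "F face_of P \<Longrightarrow> F = convex hull ((!) xs ` ix F)"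
  using face_hull[OF polytope_P, of F] vertices_face[of F P] face_vertices[of F] by simp

lemma P_hull: "P = convex hull ((!) xs ` {..n})"
  using polytope_hull_vertices[OF polytope_P] nth_vertices by simp

text \<open>A vertex of \<open>P\<close> remains extreme in any convex subset containing it, so it
  must be one of the points spanning the hull.\<close>

lemma ix_hull: "S \<subseteq> {..n} \<Longrightarrow> ix (convex hull ((!) xs ` S)) = S"
proof
  assume S: "S \<subseteq> {..n}"
  show "S \<subseteq> ix (convex hull ((!) xs ` S))" using S by (auto simp: ix_def hull_inc)
  show "ix (convex hull ((!) xs ` S)) \<subseteq> S"
  proof
    fix i assume i: "i \<in> ix (convex hull ((!) xs ` S))"
    then have "xs ! i \<in> vertices P" using nth_vertices by (auto simp: ix_def)
    moreover have "convex hull ((!) xs ` S) \<subseteq> P" unfolding P_hull by (rule hull_mono) (use S in auto)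
    ultimately have "xs ! i extreme_point_of (convex hull ((!) xs ` S))"
      using i by (auto simp: vertices_def extreme_point_of_def ix_def)
    then have "xs ! i \<in> (!) xs ` S" by (rule extreme_point_of_convex_hull)
    then show "i \<in> S" using inj_nth S i by (auto simp: ix_def inj_on_def)
  qed
qed

lemma card_nth: "S \<subseteq> {..n} \<Longrightarrow> card ((!) xs ` S) = card S"
  using card_image inj_nth inj_on_subset by blast

lemma induced: "F face_of P \<Longrightarrow> induced_array xs F = map ((!) xs) (sorted_list_of_set (ix F))"
proof -
  assume F: "F face_of P"
  have "xs = map ((!) xs) [0..<length xs]" by (simp add: map_nth)
  then have "induced_array xs F = map ((!) xs) (filter (\<lambda>i. xs ! i \<in> vertices F) [0..<n + 1])"
    unfolding induced_array_def using filter_map[of "\<lambda>v. v \<in> vertices F" "(!) xs" "[0..<length xs]"] len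
    by (simp add: o_def)
  moreover have "filter (\<lambda>i. xs ! i \<in> vertices F) [0..<n + 1] = sorted_list_of_set (ix F)"
  proof (rule sorted_distinct_set_unique)
    show "set (filter (\<lambda>i. xs ! i \<in> vertices F) [0..<n + 1]) = set (sorted_list_of_set (ix F))"
      using vertices_ix[OF F] ix_sub[of F] finite_ix[of F]
      by (auto simp: less_Suc_eq_le subset_iff simp del: upt_Suc)
  qed (auto simp: sorted_wrt_filter simp del: upt_Suc)
  ultimately show ?thesis by (simp del: upt_Suc)
qed

lemma facet_dim: "F facet_of P \<Longrightarrow> aff_dim F = int d - 1"
  using aff_dim_P by (simp add: facet_of_def)

lemma facet_card_ix: "F facet_of P \<Longrightarrow> d \<le> card (ix F)"
proof -
  assume F: "F facet_of P"
  have "aff_dim F = aff_dim ((!) xs ` ix F)"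
    using face_ix_hull[OF facet_of_imp_face_of[OF F]] aff_dim_convex_hull by metis
  also have "\<dots> \<le> int (card ((!) xs ` ix F)) - 1" by (rule aff_dim_le_card) (simp add: finite_ix)
  finally show ?thesis using facet_dim[OF F] card_nth[OF ix_sub] by simp
qed

lemma facet_facets:
  assumes F: "F facet_of P"
  shows "{R. R facet_of F} = (\<lambda>R. convex hull ((!) xs ` R)) ` {R. ridge (d - 1) (ix F) R}"
proof -
  have "braxtope (d - 1) F (induced_array xs F)" using bP F by (simp add: braxial_def)
  then obtain m where m: "length (induced_array xs F) = m + 1" "d - 1 \<le> m"
    "{R. R facet_of F} = braxtope_T (d - 1) (induced_array xs F) ` {0..m - (d - 1) + 1}
      \<union> braxtope_E (d - 1) (induced_array xs F) ` {2..m}"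
    using d6 unfolding braxtope_def by (auto split: if_splits)
  have ind: "induced_array xs F = map ((!) xs) (sorted_list_of_set (ix F))"
    by (rule induced[OF facet_of_imp_face_of[OF F]])
  have c: "card (ix F) = m + 1" using m(1) ind by simp
  have "3 \<le> d - 1" using d6 by simp
  from braxtope_ridges[OF finite_ix c this m(2), of "(!) xs"] show ?thesis using m(3) unfolding ind by simp
qed

lemma ridge_facet:
  assumes F: "F facet_of P" and R: "ridge (d - 1) (ix F) R"
  shows "(convex hull ((!) xs ` R)) facet_of F"
  using facet_facets[OF F] R by blast

lemma facet_ridge:
  assumes F: "F facet_of P" and R: "R facet_of F"
  shows "ridge (d - 1) (ix F) (ix R)"
proof -
  obtain S where S: "ridge (d - 1) (ix F) S" "R = convex hull ((!) xs ` S)" using facet_facets[OF F] R by blast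
  have "S \<subseteq> {..n}" using ridge_subset[OF S(1)] ix_sub by blast
  then show ?thesis using S ix_hull by simp
qed

lemma family: "braxial_family n d FF"
proof
  show "even d" "6 \<le> d" "d < n" using ev d6 nd by auto
next
  fix F assume "F \<in> FF" then show "F \<subseteq> {..n}" using ix_sub by auto
next
  fix F assume "F \<in> FF" then show "d \<le> card F" using facet_card_ix by auto
next
  fix Z a b assume Z: "Z \<in> FF" and a: "a \<le> n" "a \<notin> Z" and b: "b \<le> n" "b \<notin> Z"
  then obtain F where F: "F facet_of P" "Z = ix F" by auto
  have face: "F face_of P" using F(1) facet_of_imp_face_of by blast
  have gs: "gale_subset xs (vertices F)" using gP F(1) by (simp add: gale_polytope_def)
  have lt: "even (pos Z u) = even (pos Z v)" if uv: "u < v" "v \<le> n" "u \<notin> Z" "v \<notin> Z" for u v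
  proof -
    have "xs ! u \<notin> vertices F" "xs ! v \<notin> vertices F" using vertices_ix[OF face] uv F(2) by auto
    then have "even (card {c. u < c \<and> c < v \<and> xs ! c \<in> vertices F})"
      using gs uv len unfolding gale_subset_def by auto
    moreover have "{c. u < c \<and> c < v \<and> xs ! c \<in> vertices F} = Z \<inter> {u..<v}"
      using vertices_ix[OF face] uv F(2) by (auto simp: order_le_less)
    ultimately show ?thesis using pos_split[of u v Z] uv(1) by simp
  qed
  show "even (pos Z a) = even (pos Z b)"
  proof (cases a b rule: linorder_cases)
    case less
    show ?thesis by (rule lt[OF less b(1) a(2) b(2)])
  next
    case greater
    show ?thesis by (rule lt[OF greater a(1) b(2) a(2), symmetric])
  qed simp
next
  fix Z R assume "Z \<in> FF" and R: "ridge (d - 1) Z R"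
  then obtain F where F: "F facet_of P" "Z = ix F" by auto
  let ?R = "convex hull ((!) xs ` R)"
  have "?R facet_of F" using ridge_facet[OF F(1)] R F(2) by simp
  then obtain G where G: "G facet_of P" "G \<inter> F = ?R" "?R facet_of G"
    using polytope_ridge_neighbour[OF polytope_P F(1)] by blast
  have iR: "ix ?R = R" using ridge_subset[OF R] F(2) ix_sub by (intro ix_hull) auto
  then have "ridge (d - 1) (ix G) R" using facet_ridge[OF G(1,3)] by simp
  moreover have "ix G \<inter> Z = R"
  proof -
    have "ix (G \<inter> F) = R" using G(2) iR by simp
    then show ?thesis using F(2) by (auto simp: ix_def)
  qed
  ultimately show "\<exists>G\<in>FF. G \<inter> Z = R \<and> ridge (d - 1) G R" using G(1) by blast
next
  fix Z Y assume "Z \<in> FF" "Y \<in> FF" and s: "Z \<subseteq> Y"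
  then obtain F G where F: "F facet_of P" "Z = ix F" and G: "G facet_of P" "Y = ix G" by auto
  have Ff: "F face_of P" and Gf: "G face_of P" using F G facet_of_imp_face_of by auto
  have "F \<subseteq> G"
    by (subst face_ix_hull[OF Ff], subst face_ix_hull[OF Gf]) (use s F G in \<open>auto intro!: hull_mono\<close>)
  then have "F face_of G" using face_of_subset[OF Ff] face_of_imp_subset[OF Gf] by blast
  then have "F = G"
    using face_of_aff_dim_lt[OF face_of_imp_convex[OF Gf]]
      facet_dim[OF F(1)] facet_dim[OF G(1)] by force
  then show "Z = Y" using F G by simp
next
  \<comment> \<open>The vertex \<open>xs ! 1\<close> is the intersection of the facets through it,
    so one of these avoids \<open>xs ! 0\<close>.\<close>
  have v1: "xs ! 1 \<in> vertices P" using nth_vertices nd by auto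
  then have s: "{xs ! 1} face_of P" by (simp add: vertices_def face_of_singleton)
  moreover have "{xs ! 1} \<noteq> P" using aff_dim_P d6 by (metis aff_dim_sing of_nat_0_eq_iff not_numeral_le_zero)
  ultimately have e: "{xs ! 1} = \<Inter>{F. F facet_of P \<and> {xs ! 1} \<subseteq> F}"
    by (intro face_of_polyhedron[OF polytope_imp_polyhedron[OF polytope_P]]) auto
  have "xs ! 0 \<noteq> xs ! 1" using inj_onD[OF inj_nth, of 0 1] nd by auto
  then have "xs ! 0 \<notin> \<Inter>{F. F facet_of P \<and> {xs ! 1} \<subseteq> F}" using e by blast
  then obtain F where "F facet_of P" "xs ! 0 \<notin> F" by blast
  then show "\<exists>F\<in>FF. 0 \<notin> F" by (auto simp: ix_def)
qed

sublocale braxial_family n d FF by (rule family)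

lemma aff_dim_facet_hull: "F facet_of P \<Longrightarrow> aff_dim ((!) xs ` ix F) = int d - 1"
  using facet_dim[of F] face_ix_hull[OF facet_of_imp_face_of, of F] aff_dim_convex_hull[of "(!) xs ` ix F"] by simp

lemma small_facet_independent:
  assumes F: "F facet_of P" "card (ix F) = d"
  shows "\<not> affine_dependent ((!) xs ` ix F)"
  using affine_independent_iff_card[of "(!) xs ` ix F"] aff_dim_facet_hull[OF F(1)] F(2)
    card_nth[OF ix_sub] finite_ix by simp

lemma small_facet_simplex:
  assumes F: "F facet_of P" "card (ix F) = d"
  shows "aff_dim F simplex F"
  unfolding simplex
proof (intro exI conjI)
  show "\<not> affine_dependent ((!) xs ` ix F)" by (rule small_facet_independent[OF F])
  show "int (card ((!) xs ` ix F)) = aff_dim F + 1"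
    using F(2) card_nth[OF ix_sub] facet_dim[OF F(1)] by simp
  show "F = convex hull ((!) xs ` ix F)" by (rule face_ix_hull[OF facet_of_imp_face_of[OF F(1)]])
qed (simp add: finite_ix)

lemma independent_edge:
  assumes S: "S \<subseteq> {..n}" "\<not> affine_dependent ((!) xs ` S)" "(convex hull ((!) xs ` S)) face_of P"
    and ij: "i \<in> S" "j \<in> S" "i \<noteq> j"
  shows "(convex hull {xs ! i, xs ! j}) edge_of P"
proof -
  have "(convex hull {xs ! i, xs ! j}) face_of (convex hull ((!) xs ` S))"
    unfolding face_of_convex_hull_affine_independent[OF S(2)]
    by (rule exI[of _ "{xs ! i, xs ! j}"]) (use ij in simp)
  then have "(convex hull {xs ! i, xs ! j}) face_of P" by (rule face_of_trans[OF _ S(3)])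
  moreover have "xs ! i \<noteq> xs ! j" using inj_onD[OF inj_nth, of i j] ij S(1) by auto
  then have "aff_dim (convex hull {xs ! i, xs ! j}) = 1" by (simp add: aff_dim_convex_hull aff_dim_2)
  ultimately show ?thesis by (simp add: edge_of_def)
qed

text \<open>Whatever the size of the facet, this ridge is a simplex, and it contains both the first
  and the last vertex. It therefore produces the edge from \<open>xs ! 0\<close> to
  \<open>xs ! n\<close>.\<close>

lemma card_ridge_L: "F facet_of P \<Longrightarrow> card (ridge_L (d - 1) (ix F)) = d - 1"
proof -
  assume F: "F facet_of P"
  let ?Z = "ix F"
  have c: "d \<le> card ?Z" by (rule facet_card_ix[OF F])
  have "ridge_L (d - 1) ?Z = {y \<in> ?Z. 0 \<le> pos ?Z y \<and> pos ?Z y < 1}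
      \<union> {y \<in> ?Z. card ?Z - (d - 2) \<le> pos ?Z y \<and> pos ?Z y < card ?Z}"
    using pos_less_card[OF finite_ix[of F]] d6 by (auto simp: ridge_L_def)
  moreover have "{y \<in> ?Z. 0 \<le> pos ?Z y \<and> pos ?Z y < 1} \<inter>
      {y \<in> ?Z. card ?Z - (d - 2) \<le> pos ?Z y \<and> pos ?Z y < card ?Z} = {}" using c d6 by auto
  ultimately have "card (ridge_L (d - 1) ?Z) = card {y \<in> ?Z. 0 \<le> pos ?Z y \<and> pos ?Z y < 1}
      + card {y \<in> ?Z. card ?Z - (d - 2) \<le> pos ?Z y \<and> pos ?Z y < card ?Z}"
    using finite_ix[of F] by (simp add: card_Un_disjoint)
  also have "\<dots> = (1 - 0) + (card ?Z - (card ?Z - (d - 2)))"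
    using card_pos_between[OF finite_ix, of 1 F 0] card_pos_between[OF finite_ix order_refl, of F "card ?Z - (d - 2)"] c d6
    by simp
  finally show ?thesis using c d6 by simp
qed

lemma ridge_independent:
  assumes F: "F facet_of P" and R: "ridge (d - 1) (ix F) R" "card R = d - 1"
  shows "\<not> affine_dependent ((!) xs ` R)"
proof -
  have Rn: "R \<subseteq> {..n}" using ridge_subset[OF R(1)] ix_sub by blast
  have "(convex hull ((!) xs ` R)) facet_of F" by (rule ridge_facet[OF F R(1)])
  then have "aff_dim ((!) xs ` R) = int d - 2"
    using facet_dim[OF F] by (simp add: facet_of_def aff_dim_convex_hull)
  moreover have "finite R" using Rn finite_subset by blast
  ultimately show ?thesis
    using affine_independent_iff_card[of "(!) xs ` R"] R(2) card_nth[OF Rn] d6 by simp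
qed

text \<open>The first \<open>d - 1\<close> of \<open>d\<close> consecutive vertices of a facet span a face of that facet,
  and this face does not contain the last one.\<close>

lemma consecutive_independent:
  assumes F: "F facet_of P" and B: "B = ix F \<inter> {a..b}" "card B = d"
  shows "\<not> affine_dependent ((!) xs ` B)"
proof -
  have fB: "finite B" using B(1) by simp
  have ne: "B \<noteq> {}" using B(2) d6 by auto
  define z where "z = Max B"
  have zB: "z \<in> B" using fB ne by (simp add: z_def)
  let ?R = "B - {z}"
  have Bz: "y \<le> z" if "y \<in> B" for y using fB that by (simp add: z_def)
  have "card B \<le> card {..z}" using Bz by (intro card_mono) auto
  then have z0: "z \<noteq> 0" using B(2) d6 by auto
  have "z \<le> b" "a \<le> z" using zB B(1) by auto
  then have "?R = ix F \<inter> {a..z - 1}"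
  proof (intro set_eqI)
    fix y
    show "y \<in> ?R \<longleftrightarrow> y \<in> ix F \<inter> {a..z - 1}"
      using Bz[of y] z0 \<open>z \<le> b\<close> unfolding B(1) by auto
  qed
  moreover have cR: "card ?R = d - 1" using fB zB B(2) by simp
  ultimately have R: "ridge (d - 1) (ix F) ?R"
    using d6 by (intro ridge_T_interval[OF finite_ix]) auto
  let ?G = "convex hull ((!) xs ` ?R)"
  have Rn: "?R \<subseteq> {..n}" using B(1) ix_sub[of F] by blast
  have GF: "?G face_of F" using ridge_facet[OF F R] facet_of_imp_face_of by blast
  have "convex F" using F facet_of_imp_face_of face_of_imp_convex by blast
  then have eq: "?G = affine hull ?G \<inter> F" using face_of_imp_eq_affine_Int[OF _ GF] by blast
  have "xs ! z \<notin> affine hull ((!) xs ` ?R)"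
  proof
    assume "xs ! z \<in> affine hull ((!) xs ` ?R)"
    moreover have "xs ! z \<in> F" using zB B(1) by (auto simp: ix_def)
    ultimately have "xs ! z \<in> ?G" using eq by (metis IntI affine_hull_convex_hull)
    then have "z \<in> ix ?G" using zB B(1) by (auto simp: ix_def)
    then show False using ix_hull[OF Rn] by simp
  qed
  then have "\<not> affine_dependent (insert (xs ! z) ((!) xs ` ?R))"
    by (rule affine_independent_insert[OF ridge_independent[OF F R cR]])
  moreover have "insert (xs ! z) ((!) xs ` ?R) = (!) xs ` B" using zB by auto
  ultimately show ?thesis by simp
qed

lemma window_list: "i + k \<le> n + 1 \<Longrightarrow> take k (drop i xs) = map (\<lambda>t. xs ! (i + t)) [0..<k]"
  by (rule nth_equalityI) (auto simp: len)

lemma window_image: "(\<lambda>t. xs ! (i + t)) ` {..<k} = (!) xs ` {i..<i + k}"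
proof -
  have "{i..<i + k} = (+) i ` {..<k}" by (simp add: lessThan_atLeast0 add.commute)
  then show ?thesis by (simp add: image_image)
qed

section \<open>Edges at the last vertex, cyclic windows and the three cases\<close>

context
  fixes L :: nat
  assumes hull: "braxial_hull n d FF L"
begin

interpretation H: braxial_hull n d FF L by (rule hull)

text \<open>For \<open>0 < j\<close> and \<open>j + L \<le> n\<close> every facet through both
  vertices contains \<open>xs ! 0\<close>; so would their intersection, which equals the alleged
  edge. Otherwise both vertices lie in a common simplex face: a \<open>ridge_L\<close> for
  \<open>j = 0\<close>, a simplex facet in the other case.\<close>

lemma edge_iff:
  assumes j: "j \<le> n - 1"
  shows "(convex hull {xs ! j, xs ! n}) edge_of P \<longleftrightarrow> j = 0 \<or> n + 1 \<le> j + L"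
proof
  assume E: "(convex hull {xs ! j, xs ! n}) edge_of P"
  show "j = 0 \<or> n + 1 \<le> j + L"
  proof (rule ccontr)
    assume n: "\<not> ?thesis"
    let ?E = "convex hull {xs ! j, xs ! n}"
    have EP: "?E face_of P" "aff_dim ?E = 1" using E by (auto simp: edge_of_def)
    have "?E \<noteq> P" using EP(2) aff_dim_P d6 by auto
    then have eq: "?E = \<Inter>{F. F facet_of P \<and> ?E \<subseteq> F}"
      by (intro face_of_polyhedron[OF polytope_imp_polyhedron[OF polytope_P] EP(1)]) auto
    have "xs ! 0 \<in> F" if F: "F facet_of P" "?E \<subseteq> F" for F
    proof -
      have "xs ! j \<in> F" "xs ! n \<in> F" using F(2) hull_subset[of "{xs ! j, xs ! n}" convex] by auto
      then have "j \<in> ix F" "n \<in> ix F" using j by (auto simp: ix_def)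
      then have "0 \<in> ix F" using H.low_top_facet[of "ix F" j] F(1) n by auto
      then show ?thesis by (simp add: ix_def)
    qed
    then have "xs ! 0 \<in> ?E" using eq by blast
    then have "0 \<in> ix ?E" by (simp add: ix_def)
    moreover have "ix ?E = {j, n}" using ix_hull[of "{j, n}"] j by simp
    ultimately show False using n nd by auto
  qed
next
  assume A: "j = 0 \<or> n + 1 \<le> j + L"
  show "(convex hull {xs ! j, xs ! n}) edge_of P"
  proof (cases "j = 0")
    case True
    obtain F where F: "F facet_of P" "0 \<in> ix F" "n \<in> ix F" using H.zero_top_facet by auto
    let ?R = "ridge_L (d - 1) (ix F)"
    have R: "ridge (d - 1) (ix F) ?R" by (rule ridge_LI)
    have "(convex hull ((!) xs ` ?R)) face_of P"
      by (rule face_of_trans[OF facet_of_imp_face_of[OF ridge_facet[OF F(1) R]] facet_of_imp_face_of[OF F(1)]])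
    moreover have "?R \<subseteq> {..n}" using ridge_subset[OF R] ix_sub by blast
    moreover have "0 \<in> ?R" using F(2) by (simp add: ridge_L_def)
    moreover have "n \<in> ?R"
    proof -
      have "ix F \<subseteq> {..<Suc n}" using ix_sub by (auto simp: less_Suc_eq_le subset_iff)
      then have "pos (ix F) (Suc n) = card (ix F)" by (rule pos_all)
      then have "pos (ix F) n + 1 = card (ix F)" using F(3) by (simp add: pos_Suc)
      then have "card (ix F) \<le> pos (ix F) n + (d - 1 - 1)" using d6 by linarith
      then show ?thesis using F(3) by (simp add: ridge_L_def)
    qed
    ultimately show ?thesis
      using independent_edge[OF _ ridge_independent[OF F(1) R card_ridge_L[OF F(1)]], of 0 n] True nd by simp
  next
    case False
    then have "n + 1 \<le> j + L" "1 \<le> j" "j < n" using A j nd by auto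
    then obtain F where F: "F facet_of P" "card (ix F) = d" "j \<in> ix F" "n \<in> ix F"
      using H.top_edge_facet by auto
    have FP: "F face_of P" using F(1) facet_of_imp_face_of by blast
    show ?thesis
    proof (rule independent_edge[OF ix_sub small_facet_independent[OF F(1,2)] _ F(3,4)])
      show "(convex hull ((!) xs ` ix F)) face_of P" using FP face_ix_hull[OF FP] by simp
    qed (use \<open>j < n\<close> in simp)
  qed
qed

lemma full_cyclic: "L = n \<Longrightarrow> cyclic_polytope P xs"
proof -
  assume L: "L = n"
  have "aff_dim F simplex F" if F: "F facet_of P" for F
    using small_facet_simplex[OF F] H.full_hull_simplicial[OF L, of "ix F"] F by auto
  then show ?thesis using gP polytope_P by (simp add: cyclic_polytope_def simplicial_polytope_def)
qed

lemma window_facet: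
  assumes L: "i + L \<le> n" "L < n" and B: "paired B" "card B = d" "B \<subseteq> {i..i + L}"
  shows "\<exists>F. F facet_of P \<and> ix F \<inter> {i..i + L} = B"
proof -
  have "\<exists>G\<in>FF. G \<inter> {i..i + L} = B"
    using H.window_facet_pos[OF B, of ] H.window_facet_zero[OF B(1,2), of ] B(3) L
    by (cases "i = 0") auto
  then show ?thesis by auto
qed

text \<open>A facet of \<open>P\<close> with the prescribed trace gives the supporting hyperplane.
  The facet may be nonsimplicial, but the trace is consecutive in it, which suffices for affine
  independence.\<close>

lemma window_points:
  assumes L: "i + L \<le> n" "L < n"
  shows "cyclic_points (L + 1) (d div 2) (\<lambda>t. xs ! (i + t))"
proof
  have dd: "2 * (d div 2) = d" using ev by simp
  show "1 \<le> d div 2" using d6 by simp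
  show "2 * (d div 2) < L + 1" using H.dL dd by simp
  have win: "B \<subseteq> {..<L + 1} \<Longrightarrow> (\<lambda>t. xs ! (i + t)) ` B = (!) xs ` ((+) i ` B)" for B
    by (simp add: image_image)
  show "inj_on (\<lambda>t. xs ! (i + t)) {..<L + 1}"
  proof (rule inj_onI)
    fix s t assume st: "s \<in> {..<L + 1}" "t \<in> {..<L + 1}" "xs ! (i + s) = xs ! (i + t)"
    then have "i + s = i + t" using L(1) by (intro inj_onD[OF inj_nth st(3)]) auto
    then show "s = t" by simp
  qed
  have "(\<lambda>t. xs ! (i + t)) ` {..<L + 1} \<subseteq> P"
  proof -
    have "(!) xs ` {..n} \<subseteq> P" unfolding P_hull by (rule hull_subset)
    then show ?thesis using L(1) by auto
  qed
  then have "aff_dim ((\<lambda>t. xs ! (i + t)) ` {..<L + 1}) \<le> int d"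
    using aff_dim_subset aff_dim_P by metis
  then show "aff_dim ((\<lambda>t. xs ! (i + t)) ` {..<L + 1}) \<le> 2 * int (d div 2)" using dd by linarith
  fix B assume B: "paired B" "card B = 2 * (d div 2)" "B \<subseteq> {..<L + 1}"
  let ?B = "(+) i ` B"
  have "paired ?B" "card ?B = d" "?B \<subseteq> {i..i + L}"
    using paired_shift[OF B(1)] B(2,3) dd by (auto simp: card_image)
  then obtain F where F: "F facet_of P" "ix F \<inter> {i..i + L} = ?B" using window_facet[OF L] by blast
  obtain a b where ab: "P \<subseteq> {x. a \<bullet> x \<le> b}" "F = P \<inter> {x. a \<bullet> x = b}"
    using facet_supporting[OF polytope_imp_polyhedron[OF polytope_P] F(1)] .
  have inP: "xs ! (i + t) \<in> P" if "t < L + 1" for t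
    using \<open>(\<lambda>t. xs ! (i + t)) ` {..<L + 1} \<subseteq> P\<close> that by auto
  show "\<exists>a b. (\<forall>t<L + 1. a \<bullet> xs ! (i + t) \<le> b) \<and> (\<forall>t<L + 1. a \<bullet> xs ! (i + t) = b \<longleftrightarrow> t \<in> B)"
  proof (intro exI conjI allI impI)
    fix t assume t: "t < L + 1"
    show "a \<bullet> xs ! (i + t) \<le> b" using ab(1) inP[OF t] by auto
    have "a \<bullet> xs ! (i + t) = b \<longleftrightarrow> i + t \<in> ix F" using ab(2) inP[OF t] t L(1) by (auto simp: ix_def)
    also have "\<dots> \<longleftrightarrow> i + t \<in> ?B" using F(2) t by (metis IntD1 IntI atLeastAtMost_iff le_add1 less_Suc_eq_le nat_add_left_cancel_le Suc_eq_plus1)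
    also have "\<dots> \<longleftrightarrow> t \<in> B" by auto
    finally show "a \<bullet> xs ! (i + t) = b \<longleftrightarrow> t \<in> B" .
  qed
  show "\<not> affine_dependent ((\<lambda>t. xs ! (i + t)) ` B)"
    using consecutive_independent[OF F(1) F(2)[symmetric] \<open>card ?B = d\<close>] win[OF B(3)] by simp
qed

lemma window_cyclic:
  assumes L: "i + L \<le> n" "L < n"
  shows "d_polytope d (convex hull set (take (L + 1) (drop i xs)))"
    "cyclic_polytope (convex hull set (take (L + 1) (drop i xs))) (take (L + 1) (drop i xs))"
    "aff_dim ((!) xs ` {i..<i + (L + 1)}) = int d"
proof -
  interpret C: cyclic_points "L + 1" "d div 2" "\<lambda>t. xs ! (i + t)" by (rule window_points[OF L])
  have dd: "2 * int (d div 2) = int d" using ev by auto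
  have l: "take (L + 1) (drop i xs) = map (\<lambda>t. xs ! (i + t)) [0..<L + 1]"
    using L(1) by (intro window_list) simp
  have s: "set (take (L + 1) (drop i xs)) = (\<lambda>t. xs ! (i + t)) ` {..<L + 1}"
    unfolding l by (auto simp: atLeast0LessThan simp del: upt_Suc)
  show "cyclic_polytope (convex hull set (take (L + 1) (drop i xs))) (take (L + 1) (drop i xs))"
    unfolding s using C.hull_cyclic[OF C.hull_dim] unfolding l .
  show "d_polytope d (convex hull set (take (L + 1) (drop i xs)))"
    unfolding s d_polytope_def using C.hull_dim dd
    by (auto simp: aff_dim_convex_hull intro: polytope_convex_hull)
  show "aff_dim ((!) xs ` {i..<i + (L + 1)}) = int d"
    using C.hull_dim dd window_image[of i "L + 1"] by simp
qed

text \<open>A facet of \<open>P\<close> with at least \<open>d + 1\<close> vertices in the window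
  cuts out a proper face of the hull of the window. A facet of this hull containing that face has
  more than \<open>d\<close> vertices and is no simplex.\<close>

lemma long_window_not_cyclic:
  assumes L: "i + L + 1 \<le> n"
  shows "\<not> cyclic_polytope (convex hull set (take (L + 2) (drop i xs))) (take (L + 2) (drop i xs))"
proof
  let ?W = "{i..i + L + 1}"
  let ?C = "convex hull ((!) xs ` ?W)"
  have Wn: "?W \<subseteq> {..n}" using L by auto
  have "set (take (L + 2) (drop i xs)) = (\<lambda>t. xs ! (i + t)) ` {..<L + 2}"
    using L by (subst window_list) (auto simp: atLeast0LessThan simp del: upt_Suc)
  also have "\<dots> = (!) xs ` ?W"
    using window_image[of i "L + 2"] by (simp add: atLeastLessThanSuc_atLeastAtMost)
  finally have s: "set (take (L + 2) (drop i xs)) = (!) xs ` ?W" .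
  assume "cyclic_polytope (convex hull set (take (L + 2) (drop i xs))) (take (L + 2) (drop i xs))"
  then have simp: "\<And>F. F facet_of ?C \<Longrightarrow> aff_dim F simplex F" and pC: "polytope ?C"
    unfolding s by (auto simp: cyclic_polytope_def simplicial_polytope_def)
  have CP: "?C \<subseteq> P" unfolding P_hull by (rule hull_mono) (use Wn in auto)
  \<comment> \<open>The window of \<open>L + 1\<close> indices contained in this one already has
    full dimension.\<close>
  have dC: "aff_dim ?C = int d"
  proof (rule antisym)
    show "aff_dim ?C \<le> int d" using aff_dim_subset[OF CP] aff_dim_P by simp
    have "(!) xs ` {i..<i + (L + 1)} \<subseteq> (!) xs ` ?W" by auto
    from aff_dim_subset[OF this] show "int d \<le> aff_dim ?C"
      using window_cyclic(3)[of i] L by (simp add: aff_dim_convex_hull)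
  qed
  obtain F where F: "F facet_of P" "d + 1 \<le> card (ix F \<inter> ?W)" using H.long_window[OF L] by auto
  have FP: "F face_of P" using F(1) facet_of_imp_face_of by blast
  have "(F \<inter> ?C) face_of (P \<inter> ?C)" by (rule face_of_slice[OF FP]) simp
  moreover have "P \<inter> ?C = ?C" using CP by blast
  ultimately have face: "(F \<inter> ?C) face_of ?C" by simp
  have mem: "xs ! c \<in> F \<inter> ?C" if "c \<in> ix F \<inter> ?W" for c using that by (auto simp: ix_def hull_inc)
  have ne: "F \<inter> ?C \<noteq> {}"
  proof -
    have "ix F \<inter> ?W \<noteq> {}" using F(2) by (metis Suc_eq_plus1 card.empty not_less_eq_eq le0)
    then show ?thesis using mem by blast
  qed
  have "F \<inter> ?C \<noteq> ?C"
  proof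
    assume "F \<inter> ?C = ?C"
    then have "aff_dim ?C \<le> aff_dim F" by (intro aff_dim_subset) blast
    then show False using dC facet_dim[OF F(1)] by simp
  qed
  then obtain G where G: "G facet_of ?C" "F \<inter> ?C \<subseteq> G"
    using face_of_polyhedron_subset_facet[OF polytope_imp_polyhedron[OF pC] face ne] by blast
  obtain S where S: "\<not> affine_dependent S" "int (card S) = aff_dim G + 1" "G = convex hull S"
    using simp[OF G(1)] unfolding simplex by blast
  have "aff_dim G = int d - 1" using G(1) dC by (simp add: facet_of_def)
  then have cS: "card S = d" using S(2) by simp
  have fS: "finite S" using S(1) aff_independent_finite by blast
  have "(!) xs ` (ix F \<inter> ?W) \<subseteq> S"
  proof
    fix x assume "x \<in> (!) xs ` (ix F \<inter> ?W)"
    then obtain c where c: "c \<in> ix F \<inter> ?W" "x = xs ! c" by blast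
    have "x \<in> G" using mem[OF c(1)] c(2) G(2) by blast
    moreover have "x \<in> vertices P" using c nth_vertices Wn by blast
    moreover have "G \<subseteq> P" using facet_of_imp_subset[OF G(1)] CP by blast
    ultimately have "x extreme_point_of G" by (auto simp: vertices_def extreme_point_of_def)
    then show "x \<in> S" unfolding S(3) by (rule extreme_point_of_convex_hull)
  qed
  then have "card ((!) xs ` (ix F \<inter> ?W)) \<le> d" using card_mono[OF fS] cS by metis
  moreover have "ix F \<inter> ?W \<subseteq> {..n}" using Wn by blast
  ultimately show False using card_nth[of "ix F \<inter> ?W"] F(2) by simp
qed

lemma periodic:
  assumes "d + 1 \<le> L" "L < n" shows "periodically_cyclic_wrt d (L + 1) P xs"
  unfolding periodically_cyclic_wrt_def
proof (intro conjI allI impI)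
  fix i assume i: "i + (L + 1) \<le> length xs"
  then have "i + L \<le> n" using len by simp
  then show "d_polytope d (convex hull set (take (L + 1) (drop i xs)))"
    "cyclic_polytope (convex hull set (take (L + 1) (drop i xs))) (take (L + 1) (drop i xs))"
    using window_cyclic assms(2) by blast+
next
  fix i assume "i + (L + 1 + 1) \<le> length xs"
  then have "i + L + 1 \<le> n" using len by simp
  from long_window_not_cyclic[OF this]
  show "\<not> cyclic_polytope (convex hull set (take (L + 1 + 1) (drop i xs))) (take (L + 1 + 1) (drop i xs))"
    by simp
qed (use dP va len assms in auto)

text \<open>The index sets of the facets are the ridge patterns for \<open>d\<close> on all of
  \<open>{..n}\<close>, and \<open>braxtope_ridges\<close> turns these patterns into the facet list
  of a braxtope.\<close>

lemma short_braxtope: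
  assumes L: "L = d" shows "braxtope d P xs"
proof -
  interpret S: braxial_short n d FF L by unfold_locales (rule L)
  have "{F. F facet_of P} = (\<lambda>R. convex hull ((!) xs ` R)) ` FF"
  proof -
    have "F = convex hull ((!) xs ` ix F)" if "F facet_of P" for F
      using face_ix_hull that facet_of_imp_face_of by blast
    then show ?thesis by (force simp: image_image)
  qed
  also have "\<dots> = (\<lambda>R. convex hull ((!) xs ` R)) ` {R. ridge d {..n} R}" using S.facets_eq by simp
  also have "\<dots> = braxtope_T d xs ` {0..n - d + 1} \<union> braxtope_E d xs ` {2..n}"
  proof -
    have "sorted_list_of_set {..n} = [0..<n + 1]"
      by (rule sorted_distinct_set_unique) (auto simp del: upt_Suc)
    then have "map ((!) xs) (sorted_list_of_set {..n}) = xs" using len by (metis map_nth)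
    moreover have "3 \<le> d" "d \<le> n" using d6 nd by auto
    ultimately show ?thesis using braxtope_ridges[of "{..n}" n d "(!) xs"] by simp
  qed
  finally have "{F. F facet_of P} = braxtope_T d xs ` {0..n - d + 1} \<union> braxtope_E d xs ` {2..n}" .
  then show ?thesis unfolding braxtope_def using va dP len nd d6 by auto
qed

end

end

theorem theorem4:
  fixes P :: "'a::euclidean_space set" and xs :: "'a list" and d n :: nat
  assumes "d_polytope d P"
    and "vertex_array P xs"
    and "length xs = n + 1"
    and "gale_polytope P xs"
    and "braxial d P xs"
    and "n \<ge> d + 1"
    and "d + 1 \<ge> 7"
    and "even d"
  shows "\<exists>s. 1 \<le> s \<and> s \<le> n - d + 1 \<and>
           (\<forall>j. j \<le> n - 1 \<longrightarrow>
              (convex hull {xs ! j, xs ! n}) edge_of P \<longleftrightarrow> j = 0 \<or> (s \<le> j \<and> j \<le> n - 1)) \<and>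
           (s = 1 \<longrightarrow> cyclic_polytope P xs) \<and>
           (2 \<le> s \<and> s \<le> n - d \<longrightarrow> periodically_cyclic d (n - s + 2) P) \<and>
           (s = n - d + 1 \<longrightarrow> braxtope d P xs)"
proof -
  interpret gale_braxial P xs d n
    using assms by unfold_locales auto
  obtain L where L: "braxial_hull n d FF L" using braxial_hull_exists by blast
  interpret H: braxial_hull n d FF L by (rule L)
  show ?thesis
  \<comment> \<open>The three cases become \<open>L = n\<close>, \<open>d < L < n\<close> and
    \<open>L = d\<close>; the period \<open>n - s + 2\<close> is \<open>L + 1\<close>, the size of
    the cyclic windows.\<close>
  proof (intro exI[of _ "n - L + 1"] conjI allI impI)
    show "1 \<le> n - L + 1" "n - L + 1 \<le> n - d + 1" using H.dL by auto
  next
    fix j assume j: "j \<le> n - 1"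
    show "(convex hull {xs ! j, xs ! n}) edge_of P \<longleftrightarrow> j = 0 \<or> n - L + 1 \<le> j \<and> j \<le> n - 1"
      using edge_iff[OF L j] H.Ln j by auto
  next
    assume "n - L + 1 = 1"
    then show "cyclic_polytope P xs" using full_cyclic[OF L] H.Ln by simp
  next
    assume s: "2 \<le> n - L + 1 \<and> n - L + 1 \<le> n - d"
    then have "d + 1 \<le> L" "L < n" "n - (n - L + 1) + 2 = L + 1" using H.Ln by auto
    then show "periodically_cyclic d (n - (n - L + 1) + 2) P"
      unfolding periodically_cyclic_def using periodic[OF L] by auto
  next
    assume "n - L + 1 = n - d + 1"
    then show "braxtope d P xs" using short_braxtope[OF L] H.Ln dn by simp
  qed
qed

end
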